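(* Let $S_n=\frac1n\Sigma_n^{1/2}X_nX_n^T\Sigma_n^{1/2}$, where $\Sigma_n$ is an $n\times n$ real symmetric matrix with non-negative eigenvalues $\theta,1,\dots,1$ and $v_1^{(n)}$ is a unit eigenvector of $\Sigma_n$ for $\theta$, as described in the context. Let $a=(1-\sqrt\alpha)^2$ and $b=(1+\sqrt\alpha)^2$. Then, in probability, the spectral measure $\mu_{(S_n,v_1^{(n)})}$ converges weakly as $n\to\infty$ towards $$\mu_{\mathrm{MP},\alpha,\theta}(dx)=\frac{\theta\sqrt{(b-x)(x-a)}}{2\pi x\bigl(x(1-\theta)+\theta(\alpha\theta-\alpha+1)\bigr)}\mathbf 1_{(a,b)}(x)\,dx+c_\alpha\mathbf 1_{\alpha<1}\delta_0(dx)+d_{\alpha,\theta}\mathbf 1_{|\theta-1|>\frac1{\sqrt\alpha}}\delta_{x_{\alpha,\theta}}(dx),$$ where $$c_\alpha=\frac{1-\alpha}{\alpha(\theta-1)+1},\qquad d_{\alpha,\theta}=\frac{1-\frac1{\alpha(\theta-1)^2}}{1+\frac1{\alpha(\theta-1)}},\qquad x_{\alpha,\theta}=\frac{\theta(\alpha\theta-\alpha+1)}{\theta-1}.$$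
   Context: $m=m(n)$ is a sequence of integers with $m/n\to\alpha\in(0,\infty)$. For each $n$, $X_n$ is an $n\times m$ real random matrix whose entries are i.i.d. copies of a fixed real random variable $X$ (whose law does not depend on $n$) with $\mathbf E[X]=0$, $\mathbf E[X^2]=1$ and finite moments of all orders. $\Sigma_n$ is deterministic (or random and independent of $X_n$), real symmetric with non-negative eigenvalues $\gamma_1^{(n)}=\theta$ and $\gamma_2^{(n)}=\dots=\gamma_n^{(n)}=1$ for all $n\ge1$, with $\theta$ fixed, i.e. $\Sigma_n=I_n+(\theta-1)v_1^{(n)}(v_1^{(n)})^T$ with $v_1^{(n)}$ a unit vector (independent of $X_n$). Let $\lambda_1^{(n)}\ge\dots\ge\lambda_n^{(n)}$ be the eigenvalues of $S_n$ and $\phi_1^{(n)},\dots,\phi_n^{(n)}$ an associated orthonormal basis of eigenvectors. The spectral measure in the direction of the spike is $\mu_{(S_n,v_1^{(n)})}=\sum_{i=1}^n|\langle\phi_i^{(n)},v_1^{(n)}\rangle|^2\delta_{\lambda_i^{(n)}}$. Weak convergence in probability of random probability measures $\mu_n$ to a deterministic $\mu$ means $\int f\,d\mu_n\to\int f\,d\mu$ in probability for every bounded continuous $f$. A term multiplied by a vanishing indicator is read as $0$.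
   Formalization: The case α = 1 and θ = 0 is excluded: there the spectral measure in the direction of the spike is the Dirac mass at 0, while the displayed limit is the zero measure, so the claim fails at that single point. *)

theory Defs
  imports
    "HOL-Probability.Probability"
    "Jordan_Normal_Form.Char_Poly"
begin

text \<open>Matrices and vectors of varying dimension are those of \<open>Jordan_Normal_Form.Matrix\<close>
  (indices start at \<open>0\<close>, so the spike direction \<open>v\<^sub>1\<close> is just called \<open>v\<close>).\<close>

no_notation inner (infix "\<bullet>" 70)
unbundle no vec_syntax
hide_type (open) Finite_Cartesian_Product.vec
hide_const (open) Finite_Cartesian_Product.vec Finite_Cartesian_Product.row
  Finite_Cartesian_Product.column Finite_Cartesian_Product.transpose

subsection \<open>Probability\<close>

text \<open>The \<open>\<sigma>\<close>-algebra generated by a family of real random variables. Independence is stated with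
  it because \<open>indep_var\<close> requires both variables to have the same value type.\<close>

definition rv_sigma :: "'w measure \<Rightarrow> 'i set \<Rightarrow> ('i \<Rightarrow> 'w \<Rightarrow> real) \<Rightarrow> 'w set set" where
  "rv_sigma M I Y =
     sigma_sets (space M) (\<Union>i\<in>I. {Y i -` A \<inter> space M | A. A \<in> sets borel})"

text \<open>Measurability is part of the notion because \<open>measure\<close> is \<open>0\<close> on non-measurable sets.\<close>

definition conv_in_prob :: "'w measure \<Rightarrow> (nat \<Rightarrow> 'w \<Rightarrow> real) \<Rightarrow> real \<Rightarrow> bool" where
  "conv_in_prob M Y c \<longleftrightarrow>
     (\<forall>\<^sub>F n in sequentially. Y n \<in> borel_measurable M) \<and>
     (\<forall>\<epsilon>>0. (\<lambda>n. measure M {\<omega> \<in> space M. \<bar>Y n \<omega> - c\<bar> > \<epsilon>}) \<longlonglongrightarrow> 0)"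

definition weak_conv_in_prob ::
    "'w measure \<Rightarrow> (nat \<Rightarrow> 'w \<Rightarrow> real measure) \<Rightarrow> real measure \<Rightarrow> bool" where
  "weak_conv_in_prob M \<mu> \<nu> \<longleftrightarrow>
     (\<forall>f :: real \<Rightarrow> real. continuous_on UNIV f \<longrightarrow> bounded (range f) \<longrightarrow>
        conv_in_prob M (\<lambda>n \<omega>. \<integral>x. f x \<partial>\<mu> n \<omega>) (\<integral>x. f x \<partial>\<nu>))"

subsection \<open>Linear algebra\<close>

definition has_eigenvalues :: "real mat \<Rightarrow> real list \<Rightarrow> bool" where
  "has_eigenvalues A es \<longleftrightarrow> char_poly A = (\<Prod>e\<leftarrow>es. [:- e, 1:])"

text \<open>The positive square root, which exists and is unique when \<open>A\<close> is symmetric with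
  non-negative eigenvalues.\<close>

definition mat_sqrt :: "real mat \<Rightarrow> real mat" where
  "mat_sqrt A = (THE B. B \<in> carrier_mat (dim_row A) (dim_row A) \<and> transpose_mat B = B \<and>
     (\<forall>k. eigenvalue B k \<longrightarrow> 0 \<le> k) \<and> B * B = A)"

definition sample_cov :: "nat \<Rightarrow> real mat \<Rightarrow> real mat \<Rightarrow> real mat" where
  "sample_cov n \<Sigma> X =
     (1 / real n) \<cdot>\<^sub>m (mat_sqrt \<Sigma> * X * transpose_mat X * mat_sqrt \<Sigma>)"

definition ordered_eigenbasis :: "nat \<Rightarrow> real mat \<Rightarrow> (nat \<Rightarrow> real) \<Rightarrow> (nat \<Rightarrow> real vec) \<Rightarrow> bool" where
  "ordered_eigenbasis n S lam \<phi> \<longleftrightarrow>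
     (\<forall>i<n. \<phi> i \<in> carrier_vec n \<and> eigenvector S (\<phi> i) (lam i)) \<and>
     (\<forall>i<n. \<forall>j<n. scalar_prod (\<phi> i) (\<phi> j) = (if i = j then 1 else 0)) \<and>
     (\<forall>i j. i \<le> j \<longrightarrow> j < n \<longrightarrow> lam j \<le> lam i)"

text \<open>The sum of the Dirac masses at \<open>lam i\<close> with weights \<open>\<langle>\<phi> i, v\<rangle>\<^sup>2\<close>, for \<open>i < n\<close>, written as the
  image under \<open>lam\<close> of the measure on \<open>{..<n}\<close> with these weights.\<close>

definition spectral_measure ::
    "nat \<Rightarrow> (nat \<Rightarrow> real) \<Rightarrow> (nat \<Rightarrow> real vec) \<Rightarrow> real vec \<Rightarrow> real measure" where
  "spectral_measure n lam \<phi> v =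
     distr (point_measure {..<n} (\<lambda>i. ennreal (\<bar>scalar_prod (\<phi> i) v\<bar>\<^sup>2))) borel lam"

lemma emeasure_spectral_measure:
  assumes "A \<in> sets borel"
  shows "emeasure (spectral_measure n lam \<phi> v) A =
    (\<Sum>i<n. ennreal (\<bar>scalar_prod (\<phi> i) v\<bar>\<^sup>2) * indicator A (lam i))"
proof -
  let ?w = "\<lambda>i. ennreal (\<bar>scalar_prod (\<phi> i) v\<bar>\<^sup>2)"
  have "emeasure (spectral_measure n lam \<phi> v) A =
      emeasure (point_measure {..<n} ?w) (lam -` A \<inter> {..<n})"
    unfolding spectral_measure_def using assms
    by (subst emeasure_distr) (auto simp: space_point_measure measurable_def sets_point_measure)
  also have "\<dots> = (\<Sum>i\<in>lam -` A \<inter> {..<n}. ?w i)"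
    by (rule emeasure_point_measure_finite) auto
  also have "\<dots> = (\<Sum>i<n. ?w i * indicator A (lam i))"
    by (intro sum.mono_neutral_cong_left) (auto simp: indicator_def)
  finally show ?thesis .
qed

subsection \<open>The limiting measure\<close>

definition add_measure :: "'a measure \<Rightarrow> 'a measure \<Rightarrow> 'a measure" where
  "add_measure M N = measure_of (space M) (sets M) (\<lambda>A. emeasure M A + emeasure N A)"

lemma sets_add_measure: "sets (add_measure M N) = sets M"
  by (simp add: add_measure_def)

lemma emeasure_add_measure:
  assumes "sets M = sets N" "A \<in> sets M"
  shows "emeasure (add_measure M N) A = emeasure M A + emeasure N A"
proof (rule emeasure_measure_of[OF add_measure_def])
  show "sets M \<subseteq> Pow (space M)" by (rule sets.space_closed)
  show "A \<in> sets (add_measure M N)" using assms by (simp add: sets_add_measure)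
  show "positive (sets (add_measure M N)) (\<lambda>A. emeasure M A + emeasure N A)"
    by (simp add: positive_def)
  show "countably_additive (sets (add_measure M N)) (\<lambda>A. emeasure M A + emeasure N A)"
    unfolding countably_additive_def sets_add_measure
  proof (intro allI impI)
    fix F :: "nat \<Rightarrow> _" assume F: "range F \<subseteq> sets M" "disjoint_family F"
    have "(\<Sum>i. emeasure M (F i) + emeasure N (F i)) =
        (\<Sum>i. emeasure M (F i)) + (\<Sum>i. emeasure N (F i))"
      by (rule suminf_add[symmetric]) auto
    then show "(\<Sum>i. emeasure M (F i) + emeasure N (F i)) =
        emeasure M (\<Union>(range F)) + emeasure N (\<Union>(range F))"
      using F assms(1) by (simp add: suminf_emeasure)
  qed
qed

definition mp_left :: "real \<Rightarrow> real" where
  "mp_left \<alpha> = (1 - sqrt \<alpha>)\<^sup>2"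

definition mp_right :: "real \<Rightarrow> real" where
  "mp_right \<alpha> = (1 + sqrt \<alpha>)\<^sup>2"

definition mp_density :: "real \<Rightarrow> real \<Rightarrow> real \<Rightarrow> real" where
  "mp_density \<alpha> \<theta> x =
     \<theta> * sqrt ((mp_right \<alpha> - x) * (x - mp_left \<alpha>)) /
       (2 * pi * x * (x * (1 - \<theta>) + \<theta> * (\<alpha> * \<theta> - \<alpha> + 1))) *
     indicator {mp_left \<alpha><..<mp_right \<alpha>} x"

definition mp_c :: "real \<Rightarrow> real \<Rightarrow> real" where
  "mp_c \<alpha> \<theta> = (1 - \<alpha>) / (\<alpha> * (\<theta> - 1) + 1)"

definition mp_d :: "real \<Rightarrow> real \<Rightarrow> real" where
  "mp_d \<alpha> \<theta> = (1 - 1 / (\<alpha> * (\<theta> - 1)\<^sup>2)) / (1 + 1 / (\<alpha> * (\<theta> - 1)))"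

definition mp_x :: "real \<Rightarrow> real \<Rightarrow> real" where
  "mp_x \<alpha> \<theta> = \<theta> * (\<alpha> * \<theta> - \<alpha> + 1) / (\<theta> - 1)"

text \<open>For \<open>\<alpha> > 0\<close> and \<open>\<theta> \<ge> 0\<close> the density and the two weights are non-negative wherever they
  are used, so that \<open>ennreal\<close> does not truncate anything.\<close>

definition mp_spiked :: "real \<Rightarrow> real \<Rightarrow> real measure" where
  "mp_spiked \<alpha> \<theta> =
     add_measure
       (add_measure
         (density lborel (\<lambda>x. ennreal (mp_density \<alpha> \<theta> x)))
         (if \<alpha> < 1 then scale_measure (ennreal (mp_c \<alpha> \<theta>)) (return borel 0)
          else null_measure borel))
       (if \<bar>\<theta> - 1\<bar> > 1 / sqrt \<alpha>
        then scale_measure (ennreal (mp_d \<alpha> \<theta>)) (return borel (mp_x \<alpha> \<theta>))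
        else null_measure borel)"

end

theory Submission
  imports Defs "Jordan_Normal_Form.Schur_Decomposition"
begin

text \<open>It suffices to follow Stieltjes transforms at the negative reals \<open>-s\<close>, \<open>s \<ge> 1\<close>, so that every resolvent is
  positive and bounded and no complex analysis is needed. Let \<open>R = (X X\<^sup>T / n + s)\<^sup>-\<^sup>1\<close>, \<open>h = v \<bullet> R v\<close> and
  \<open>g = tr R / n\<close>. From \<open>1 - s h = v \<bullet> (X X\<^sup>T / n) R v\<close>, a sum over the columns of \<open>X\<close>, and the rank-one update
  formula that isolates one column, \<open>F = 1 - s h - (m/n) h / (1 + g)\<close> is an average of terms that are, up to
  \<open>O(1 / sqrt n)\<close>, centred given the other columns even after multiplication by \<open>F\<close>; hence \<open>E F\<^sup>2 \<rightarrow> 0\<close>, uniformly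
  in the unit vector \<open>v\<close>. Averaging over the coordinate vectors gives the same for \<open>g\<close>, so \<open>g\<close> and \<open>h\<close> both tend to
  the positive solution of \<open>1 = s g + \<alpha> g / (1 + g)\<close>.

  Since \<open>\<Sigma> = I + (\<theta> - 1) v v\<^sup>T\<close> is a rank-one perturbation, the Stieltjes transform \<open>G\<close> of the spectral measure of
  \<open>S\<close> at \<open>v\<close> satisfies \<open>G (\<theta> + s (1 - \<theta>) h) = h\<close> exactly. The transform of the limit measure is computed with the
  substitution \<open>x = 1 + \<alpha> + 2 sqrt \<alpha> cos \<phi>\<close>, which turns its density into a multiple of
  \<open>sin\<^sup>2 \<phi> / (D p D q D r)\<close>, \<open>D p = 1 - 2 p cos \<phi> + p\<^sup>2\<close>; the integral over \<open>[0, \<pi>]\<close> of this function is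
  \<open>\<pi> / 2 / ((1 - p q) (1 - p r) (1 - q r))\<close>.\<close>

section \<open>Resolvents of sums of rank-one matrices\<close>

text \<open>Eigenvalues and eigenvectors are arbitrary choices at each outcome, with no
  measurability given, while convergence in probability includes measurability of the integrals
  against the spectral measure. The exact formula for \<open>G\<close> settles this as well: it
  exhibits the transform as a rational function of \<open>h\<close>, hence as measurable in the
  entries of \<open>X\<close> and \<open>v\<close>, and all other test functions are reached from
  such transforms by limits at fixed \<open>n\<close>. The direction \<open>v\<close> may be random.
  The estimate for \<open>h\<close> is uniform over deterministic unit vectors, so independence
  allows the entries to be integrated with \<open>v\<close> held fixed. Taking
  \<open>s \<ge> 1\<close> makes the fixed point equation stable with explicit constants, and a
  half-line of values of \<open>s\<close> still determines a law on \<open>[0, \<infinity>)\<close>.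
  The pair \<alpha> = 1, \<theta> = 0 has to be excluded: there \<open>S v = 0\<close>, so the
  spectral measure is the unit mass at 0, whereas the density vanishes identically and both
  indicators are off, so that the formula gives the zero measure.\<close>

definition ip :: "nat \<Rightarrow> (nat \<Rightarrow> real) \<Rightarrow> (nat \<Rightarrow> real) \<Rightarrow> real" where
  "ip n u w = (\<Sum>i<n. u i * w i)"

definition app :: "nat \<Rightarrow> (nat \<Rightarrow> nat \<Rightarrow> real) \<Rightarrow> (nat \<Rightarrow> real) \<Rightarrow> nat \<Rightarrow> real" where
  "app n r u = (\<lambda>i. \<Sum>a<n. r i a * u a)"

definition trc :: "nat \<Rightarrow> (nat \<Rightarrow> nat \<Rightarrow> real) \<Rightarrow> real" where
  "trc n r = (\<Sum>a<n. r a a)"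

definition sym_ker :: "(nat \<Rightarrow> nat \<Rightarrow> real) \<Rightarrow> bool" where
  "sym_ker r \<longleftrightarrow> (\<forall>a b. r a b = r b a)"

definition outer_sum :: "(nat \<Rightarrow> real) list \<Rightarrow> nat \<Rightarrow> nat \<Rightarrow> real" where
  "outer_sum zs a b = (\<Sum>z\<leftarrow>zs. z a * z b)"

text \<open>Sherman-Morrison: if \<open>r\<close> is the symmetric inverse of \<open>W + s\<close>,
  this is the inverse of \<open>W + z z\<^sup>T + s\<close>.\<close>

definition rank1_update :: "nat \<Rightarrow> (nat \<Rightarrow> nat \<Rightarrow> real) \<Rightarrow> (nat \<Rightarrow> real) \<Rightarrow> nat \<Rightarrow> nat \<Rightarrow> real" where
  "rank1_update n r z = (\<lambda>a b. r a b - app n r z a * app n r z b / (1 + ip n z (app n r z)))"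

text \<open>Successive rank-one updates of \<open>1 / s\<close> produce the inverse without
  determinants or an invertibility argument: every denominator \<open>1 + z \<bullet> R z\<close> is
  at least 1 when \<open>s > 0\<close>.\<close>

fun resolvent :: "nat \<Rightarrow> real \<Rightarrow> (nat \<Rightarrow> real) list \<Rightarrow> nat \<Rightarrow> nat \<Rightarrow> real" where
  "resolvent n s [] = (\<lambda>a b. if a = b then 1 / s else 0)"
| "resolvent n s (z # zs) = rank1_update n (resolvent n s zs) z"

text \<open>Only the block of indices below \<open>n\<close> is constrained, and only a right
  inverse is asked for; symmetry supplies the left inverse in
  \<open>is_resolvent_unique\<close>.\<close>

definition is_resolvent :: "nat \<Rightarrow> real \<Rightarrow> (nat \<Rightarrow> nat \<Rightarrow> real) \<Rightarrow> (nat \<Rightarrow> nat \<Rightarrow> real) \<Rightarrow> bool" where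
  "is_resolvent n s W r \<longleftrightarrow> (\<forall>i<n. \<forall>b<n. (\<Sum>a<n. W i a * r a b) + s * r i b = (if i = b then 1 else 0))"

text \<open>The inequality \<open>s |r u|^2 \<le> u \<bullet> r u\<close> contains positivity, the
  norm bound \<open>1 / s\<close> and the bound on quadratic forms. It speaks about \<open>r\<close>
  alone, so the one-column estimates hold for any such kernel.\<close>

definition contractive_ker :: "nat \<Rightarrow> real \<Rightarrow> (nat \<Rightarrow> nat \<Rightarrow> real) \<Rightarrow> bool" where
  "contractive_ker n s r \<longleftrightarrow> sym_ker r \<and> (\<forall>u. s * ip n (app n r u) (app n r u) \<le> ip n u (app n r u))"

lemma ip_commute: "ip n u w = ip n w u"
  by (simp add: ip_def mult.commute)

lemma ip_self_nonneg: "0 \<le> ip n u u"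
  by (auto simp: ip_def intro!: sum_nonneg)

lemma ip_add_right: "ip n u (\<lambda>i. w i + z i) = ip n u w + ip n u z"
  by (simp add: ip_def algebra_simps sum.distrib)

lemma ip_scale_right: "ip n u (\<lambda>i. c * w i) = c * ip n u w"
  by (simp add: ip_def algebra_simps sum_distrib_left)

lemma ip_cong: "(\<And>i. i < n \<Longrightarrow> u i = u' i) \<Longrightarrow> (\<And>i. i < n \<Longrightarrow> w i = w' i) \<Longrightarrow> ip n u w = ip n u' w'"
  by (simp add: ip_def)

lemma ip_Cauchy_Schwarz: "(ip n u w)\<^sup>2 \<le> ip n u u * ip n w w"
  using Cauchy_Schwarz_ineq_sum[of u w "{..<n}"] by (simp add: ip_def power2_eq_square)

lemma ip_app: "ip n u (app n r w) = (\<Sum>i<n. \<Sum>a<n. u i * r i a * w a)"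
  by (simp add: ip_def app_def sum_distrib_left mult.assoc)

lemma ip_app_sym: "sym_ker r \<Longrightarrow> ip n u (app n r w) = ip n w (app n r u)"
  unfolding ip_app by (subst sum.swap) (simp add: sym_ker_def mult_ac)

lemma ip_app_outer_sum: "ip n u (app n (outer_sum zs) w) = (\<Sum>z\<leftarrow>zs. ip n z u * ip n z w)"
proof (induction zs)
  case (Cons z zs)
  have "ip n u (app n (outer_sum (z # zs)) w) = (\<Sum>i<n. \<Sum>a<n. u i * (z i * z a) * w a) + ip n u (app n (outer_sum zs) w)"
    by (simp add: ip_app outer_sum_def algebra_simps sum.distrib)
  also have "(\<Sum>i<n. \<Sum>a<n. u i * (z i * z a) * w a) = ip n z u * ip n z w"
    by (simp add: ip_def sum_product algebra_simps)
  finally show ?case using Cons by simp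
qed (simp add: ip_app outer_sum_def)

lemma sum_delta_mult:
  fixes f :: "nat \<Rightarrow> real"
  assumes "b < n"
  shows "(\<Sum>c<n. f c * (if c = b then 1 else 0)) = f b" "(\<Sum>c<n. (if c = b then 1 else 0) * f c) = f b"
    "(\<Sum>c<n. f c * (if b = c then 1 else 0)) = f b" "(\<Sum>c<n. (if b = c then 1 else 0) * f c) = f b"
proof -
  have e: "f c * (if c = b then 1 else 0) = (if c = b then f c else 0)" for c by simp
  show 1: "(\<Sum>c<n. f c * (if c = b then 1 else 0)) = f b" unfolding e using assms by simp
  then show "(\<Sum>c<n. (if c = b then 1 else 0) * f c) = f b" by (simp add: mult.commute)
  show 2: "(\<Sum>c<n. f c * (if b = c then 1 else 0)) = f b" using 1 by (simp add: eq_commute[of b])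
  then show "(\<Sum>c<n. (if b = c then 1 else 0) * f c) = f b" by (simp add: mult.commute)
qed

lemma is_resolvent_app:
  assumes "is_resolvent n s W r" "i < n"
  shows "app n W (app n r u) i + s * app n r u i = u i"
proof -
  have "app n W (app n r u) i = (\<Sum>a<n. \<Sum>b<n. W i a * r a b * u b)"
    by (simp add: app_def sum_distrib_left mult.assoc)
  also have "\<dots> = (\<Sum>b<n. (\<Sum>a<n. W i a * r a b) * u b)"
    by (subst sum.swap) (simp add: sum_distrib_right)
  finally have "app n W (app n r u) i + s * app n r u i = (\<Sum>b<n. ((\<Sum>a<n. W i a * r a b) + s * r i b) * u b)"
    by (simp add: app_def sum_distrib_left algebra_simps sum.distrib)
  also have "\<dots> = (\<Sum>b<n. (if i = b then 1 else 0) * u b)"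
    using assms by (intro sum.cong) (auto simp: is_resolvent_def)
  also have "\<dots> = u i" using assms(2) by (rule sum_delta_mult)
  finally show ?thesis .
qed

lemma ip_resolvent:
  assumes "is_resolvent n s W r"
  shows "ip n y u = ip n y (app n W (app n r u)) + s * ip n y (app n r u)"
proof -
  have "ip n y u = ip n y (\<lambda>i. app n W (app n r u) i + s * app n r u i)"
    using is_resolvent_app[OF assms] by (intro ip_cong) auto
  then show ?thesis by (simp add: ip_add_right ip_scale_right)
qed

text \<open>Testing the resolvent equation against \<open>r u\<close> gives
  \<open>u \<bullet> r u = r u \<bullet> W r u + s |r u|^2\<close>, and the \<open>W\<close> term is
  a sum of squares.\<close>

lemma contractive_resolvent:
  assumes "is_resolvent n s (outer_sum zs) r" "sym_ker r"
  shows "contractive_ker n s r"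
proof -
  have "s * ip n (app n r u) (app n r u) \<le> ip n u (app n r u)" for u
  proof -
    have "ip n (app n r u) (app n (outer_sum zs) (app n r u)) \<ge> 0"
      unfolding ip_app_outer_sum by (intro sum_list_nonneg) auto
    then show ?thesis using ip_resolvent[OF assms(1), of "app n r u" u] by (simp add: ip_commute)
  qed
  then show ?thesis using assms(2) by (simp add: contractive_ker_def)
qed

lemma contractive_nonneg:
  assumes "contractive_ker n s r" "s > 0" shows "0 \<le> ip n u (app n r u)"
proof -
  have "0 \<le> s * ip n (app n r u) (app n r u)" using assms by (simp add: ip_self_nonneg)
  then show ?thesis using assms by (auto simp: contractive_ker_def intro: order_trans)
qed

text \<open>With \<open>y = r u\<close>, Cauchy-Schwarz turns
  \<open>s |y|^2 \<le> u \<bullet> y\<close> into \<open>s |y| \<le> |u|\<close>; the case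
  \<open>y = 0\<close> is separate because a factor \<open>|y|^2\<close> is cancelled.\<close>

lemma contractive_norm:
  assumes "contractive_ker n s r" "s > 0" shows "s\<^sup>2 * ip n (app n r u) (app n r u) \<le> ip n u u"
proof -
  let ?y = "app n r u"
  have "(s * ip n ?y ?y)\<^sup>2 \<le> (ip n u ?y)\<^sup>2"
    using assms by (intro power_mono mult_nonneg_nonneg) (auto simp: contractive_ker_def ip_self_nonneg)
  also have "\<dots> \<le> ip n u u * ip n ?y ?y" by (rule ip_Cauchy_Schwarz)
  finally have "(s\<^sup>2 * ip n ?y ?y) * ip n ?y ?y \<le> ip n u u * ip n ?y ?y"
    by (simp add: power2_eq_square mult_ac)
  then show ?thesis
    using ip_self_nonneg[of n ?y] ip_self_nonneg[of n u]
    by (cases "ip n ?y ?y = 0") (auto dest: mult_right_le_imp_le)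
qed

lemma contractive_form:
  assumes "contractive_ker n s r" "s > 0" shows "s * ip n u (app n r u) \<le> ip n u u"
proof -
  have "(s * ip n u (app n r u))\<^sup>2 \<le> s\<^sup>2 * (ip n u u * ip n (app n r u) (app n r u))"
    using ip_Cauchy_Schwarz[of n u "app n r u"] assms by (simp add: power_mult_distrib mult_left_mono)
  also have "\<dots> = ip n u u * (s\<^sup>2 * ip n (app n r u) (app n r u))" by simp
  also have "\<dots> \<le> ip n u u * ip n u u"
    by (intro mult_left_mono contractive_norm assms ip_self_nonneg)
  finally show ?thesis using ip_self_nonneg[of n u] by (auto simp: power2_eq_square[symmetric] intro: power2_le_imp_le)
qed

lemma app_rank1_update:
  "app n (rank1_update n r z) u i = app n r u i - app n r z i * ip n (app n r z) u / (1 + ip n z (app n r z))"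
proof -
  have "app n (rank1_update n r z) u i =
      (\<Sum>a<n. r i a * u a - app n r z i / (1 + ip n z (app n r z)) * (app n r z a * u a))"
    unfolding app_def[of n "rank1_update n r z" u] by (intro sum.cong) (simp_all add: rank1_update_def algebra_simps)
  also have "\<dots> = app n r u i - app n r z i / (1 + ip n z (app n r z)) * ip n (app n r z) u"
    by (simp only: sum_subtractf sum_distrib_left[symmetric] app_def[of n r u] ip_def[of n "app n r z" u])
  finally show ?thesis by simp
qed

lemma sym_rank1_update: "sym_ker r \<Longrightarrow> sym_ker (rank1_update n r z)"
  by (simp add: sym_ker_def rank1_update_def mult.commute)

lemma sym_resolvent: "sym_ker (resolvent n s zs)"
  by (induction zs) (auto simp: sym_rank1_update, simp add: sym_ker_def)

lemma ip_app_rank1_update: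
  assumes "sym_ker r"
  shows "ip n u (app n (rank1_update n r z) w) =
    ip n u (app n r w) - ip n z (app n r u) * ip n z (app n r w) / (1 + ip n z (app n r z))"
proof -
  have "ip n u (app n (rank1_update n r z) w) = ip n u (\<lambda>i. app n r w i + (- ip n (app n r z) w / (1 + ip n z (app n r z))) * app n r z i)"
    by (intro ip_cong) (auto simp: app_rank1_update)
  also have "\<dots> = ip n u (app n r w) - ip n u (app n r z) * ip n w (app n r z) / (1 + ip n z (app n r z))"
    by (simp only: ip_add_right ip_scale_right) (simp add: ip_commute[of n w])
  finally show ?thesis using ip_app_sym[OF assms, of n u z] ip_app_sym[OF assms, of n w z] by simp
qed

text \<open>This scalar form of the update is what isolates a column: tested on its own column, the
  updated resolvent is the old one divided by a scalar.\<close>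

lemma ip_app_rank1_update_self:
  assumes "sym_ker r" "0 \<le> ip n z (app n r z)"
  shows "ip n z (app n (rank1_update n r z) w) = ip n z (app n r w) / (1 + ip n z (app n r z))"
  unfolding ip_app_rank1_update[OF assms(1)] using assms(2) by (simp add: field_simps)

lemma trc_rank1_update:
  "trc n (rank1_update n r z) = trc n r - ip n (app n r z) (app n r z) / (1 + ip n z (app n r z))"
  by (simp add: trc_def rank1_update_def sum_subtractf ip_def[of n "app n r z"] sum_divide_distrib)

text \<open>Let \<open>y = r z\<close> and \<open>c = z \<bullet> y\<close>, so that
  \<open>W y = z - s y\<close>. The correction contributes \<open>- z y\<^sup>T / (1 + c)\<close>
  through \<open>W + s\<close>, the new matrix \<open>z z\<^sup>T\<close> contributes
  \<open>z y\<^sup>T (1 - c / (1 + c))\<close>, and these cancel.\<close>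

lemma is_resolvent_rank1_update:
  assumes r: "is_resolvent n s (outer_sum zs) r" "sym_ker r" and c: "0 \<le> ip n z (app n r z)"
  shows "is_resolvent n s (outer_sum (z # zs)) (rank1_update n r z)"
  unfolding is_resolvent_def
proof (intro allI impI)
  fix i b assume i: "i < n" and b: "b < n"
  let ?W = "outer_sum zs" and ?y = "app n r z" and ?c = "ip n z (app n r z)"
  let ?d = "(if i = b then 1 else 0) :: real"
  have zb: "(\<Sum>a<n. z a * r a b) = ?y b"
    using r(2) by (simp add: app_def sym_ker_def mult.commute)
  have "(\<Sum>a<n. outer_sum (z # zs) i a * rank1_update n r z a b) =
     (\<Sum>a<n. ?W i a * r a b - (?W i a * ?y a) * (?y b / (1 + ?c)) + z i * (z a * r a b)
        - (z a * ?y a) * (z i * (?y b / (1 + ?c))))"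
    by (intro sum.cong) (simp_all add: outer_sum_def rank1_update_def algebra_simps add_divide_distrib)
  also have "\<dots> = (\<Sum>a<n. ?W i a * r a b) - app n ?W ?y i * (?y b / (1 + ?c)) + z i * (\<Sum>a<n. z a * r a b)
      - ?c * (z i * (?y b / (1 + ?c)))"
    by (simp only: sum_subtractf sum.distrib sum_distrib_left[symmetric] sum_distrib_right[symmetric]
        app_def[of n ?W ?y] ip_def[of n z ?y])
  finally have "(\<Sum>a<n. outer_sum (z # zs) i a * rank1_update n r z a b) =
     (\<Sum>a<n. ?W i a * r a b) - app n ?W ?y i * (?y b / (1 + ?c)) + z i * (\<Sum>a<n. z a * r a b) - z i * ?c * (?y b / (1 + ?c))"
    by simp
  moreover have "app n ?W ?y i = z i - s * ?y i"
    using is_resolvent_app[OF r(1) i, of z] by simp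
  moreover have "(\<Sum>a<n. ?W i a * r a b) = ?d - s * r i b"
  proof -
    have "(\<Sum>a<n. ?W i a * r a b) + s * r i b = ?d"
      using r(1) i b unfolding is_resolvent_def by blast
    then show ?thesis by linarith
  qed
  ultimately have "(\<Sum>a<n. outer_sum (z # zs) i a * rank1_update n r z a b) + s * rank1_update n r z i b =
     ?d - s * r i b - (z i - s * ?y i) * (?y b / (1 + ?c)) + z i * ?y b - z i * ?c * (?y b / (1 + ?c))
      + s * (r i b - ?y i * ?y b / (1 + ?c))"
    unfolding zb by (simp add: rank1_update_def)
  also have "\<dots> = ?d - z i * (?y b / (1 + ?c)) * (1 + ?c) + z i * ?y b"
    by (simp add: algebra_simps add_divide_distrib diff_divide_distrib)
  also have "\<dots> = ?d" using c by simp
  finally show "(\<Sum>a<n. outer_sum (z # zs) i a * rank1_update n r z a b) + s * rank1_update n r z i b = ?d" .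
qed

lemma is_resolvent_resolvent:
  assumes "s > 0"
  shows "is_resolvent n s (outer_sum zs) (resolvent n s zs)"
proof (induction zs)
  case Nil
  then show ?case using assms by (auto simp: is_resolvent_def outer_sum_def)
next
  case (Cons z zs)
  have "0 \<le> ip n z (app n (resolvent n s zs) z)"
    by (intro contractive_nonneg[where s=s] contractive_resolvent[OF Cons] sym_resolvent assms)
  then show ?case using is_resolvent_rank1_update[OF Cons sym_resolvent] by simp
qed

lemma contractive_ker_resolvent: "s > 0 \<Longrightarrow> contractive_ker n s (resolvent n s zs)"
  by (rule contractive_resolvent[OF is_resolvent_resolvent sym_resolvent])

text \<open>The computation is \<open>r = r (W r' + s r') = (r W + s r) r' = r'\<close>, where
  symmetry of \<open>r\<close> and \<open>W\<close> makes the right inverse \<open>r\<close> a left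
  inverse.\<close>

lemma is_resolvent_unique:
  assumes r: "is_resolvent n s W r" "sym_ker r" and r': "is_resolvent n s W r'" and W: "sym_ker W"
    and ab: "a < n" "b < n"
  shows "r a b = r' a b"
proof -
  have "r a b = (\<Sum>c<n. r a c * (if c = b then 1 else 0))" using ab by (simp only: sum_delta_mult)
  also have "\<dots> = (\<Sum>c<n. r a c * ((\<Sum>d<n. W c d * r' d b) + s * r' c b))"
    using r' ab by (intro sum.cong) (auto simp: is_resolvent_def)
  also have "\<dots> = (\<Sum>c<n. \<Sum>d<n. r a c * W c d * r' d b) + (\<Sum>c<n. s * r a c * r' c b)"
    by (simp add: algebra_simps sum.distrib sum_distrib_left)
  also have "(\<Sum>c<n. \<Sum>d<n. r a c * W c d * r' d b) = (\<Sum>d<n. \<Sum>c<n. r a c * W c d * r' d b)"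
    by (rule sum.swap)
  also have "\<dots> = (\<Sum>d<n. (\<Sum>c<n. W d c * r c a) * r' d b)"
  proof (intro sum.cong refl)
    fix d
    have "r a c * W c d * r' d b = W d c * r c a * r' d b" for c
      using r(2) W by (simp add: sym_ker_def)
    then show "(\<Sum>c<n. r a c * W c d * r' d b) = (\<Sum>c<n. W d c * r c a) * r' d b"
      unfolding sum_distrib_right by (intro sum.cong) simp_all
  qed
  also have "\<dots> + (\<Sum>c<n. s * r a c * r' c b) = (\<Sum>d<n. ((\<Sum>c<n. W d c * r c a) + s * r d a) * r' d b)"
    using r(2) by (simp add: algebra_simps sum.distrib sym_ker_def)
  also have "\<dots> = (\<Sum>d<n. (if d = a then 1 else 0) * r' d b)"
    using r(1) ab by (intro sum.cong) (auto simp: is_resolvent_def)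
  also have "\<dots> = r' a b" using ab(1) by (rule sum_delta_mult)
  finally show ?thesis .
qed

lemma outer_sum_mset: "mset zs = mset zs' \<Longrightarrow> outer_sum zs = outer_sum zs'"
proof -
  assume m: "mset zs = mset zs'"
  have "sum_mset (image_mset f (mset zs)) = sum_mset (image_mset f (mset zs'))" for f :: "(nat \<Rightarrow> real) \<Rightarrow> real"
    using m by simp
  then show ?thesis by (simp add: outer_sum_def fun_eq_iff flip: sum_mset_sum_list)
qed

text \<open>The recursion treats the head of the list specially, the sum of rank-one matrices does
  not. Uniqueness therefore allows any chosen column to be moved to the front.\<close>

lemma resolvent_permute:
  assumes "mset zs = mset zs'" "s > 0" "a < n" "b < n"
  shows "resolvent n s zs a b = resolvent n s zs' a b"
proof (rule is_resolvent_unique[where W = "outer_sum zs"])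
  show "is_resolvent n s (outer_sum zs) (resolvent n s zs')"
    using is_resolvent_resolvent[OF assms(2), of n zs'] outer_sum_mset[OF assms(1)] by simp
  show "sym_ker (outer_sum zs)" by (simp add: sym_ker_def outer_sum_def mult.commute)
qed (use assms is_resolvent_resolvent sym_resolvent in auto)

text \<open>On coordinate vectors the norm bound says that each column of \<open>r\<close> has
  squared norm at most \<open>1 / s^2\<close>.\<close>

lemma hs_contractive:
  assumes "contractive_ker n s r" "s > 0"
  shows "s\<^sup>2 * (\<Sum>a<n. \<Sum>b<n. (r a b)\<^sup>2) \<le> real n"
proof -
  have "s\<^sup>2 * (\<Sum>a<n. (r a b)\<^sup>2) \<le> 1" if "b < n" for b
  proof -
    let ?e = "\<lambda>i. if i = b then 1 else (0::real)"
    have "app n r ?e i = r i b" for i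
    proof -
      have "app n r ?e i = (\<Sum>a<n. if a = b then r i a else 0)" unfolding app_def by (intro sum.cong) auto
      then show ?thesis using that by simp
    qed
    moreover have "ip n ?e ?e = 1"
    proof -
      have "ip n ?e ?e = (\<Sum>i<n. if i = b then 1 else 0)" unfolding ip_def by (intro sum.cong) auto
      then show ?thesis using that by simp
    qed
    ultimately show ?thesis using contractive_norm[OF assms, of ?e] by (simp add: ip_def power2_eq_square)
  qed
  then have "(\<Sum>b<n. s\<^sup>2 * (\<Sum>a<n. (r a b)\<^sup>2)) \<le> (\<Sum>b<n. 1)" by (intro sum_mono) auto
  then show ?thesis by (subst sum.swap) (simp add: sum_distrib_left)
qed

section \<open>Adding one column\<close>

text \<open>The centred quadratic form \<open>x \<bullet> A x - tr A\<close>. With the identity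
  subtracted entry by entry, each summand has mean zero for independent standardized entries of
  \<open>x\<close>.\<close>

definition noise :: "nat \<Rightarrow> (nat \<Rightarrow> nat \<Rightarrow> real) \<Rightarrow> (nat \<Rightarrow> real) \<Rightarrow> real" where
  "noise n A x = (\<Sum>a<n. \<Sum>b<n. A a b * (x a * x b - (if a = b then 1 else 0)))"

definition quad :: "nat \<Rightarrow> (nat \<Rightarrow> nat \<Rightarrow> real) \<Rightarrow> (nat \<Rightarrow> real) \<Rightarrow> real" where
  "quad n r v = ip n v (app n r v)"

definition ntrace :: "nat \<Rightarrow> (nat \<Rightarrow> nat \<Rightarrow> real) \<Rightarrow> real" where
  "ntrace n r = trc n r / real n"

text \<open>The error of the quadratic form of the resolvent in the fixed point equation \<open>1 = s h + k h / (1 + g)\<close>.\<close>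

definition defect :: "nat \<Rightarrow> real \<Rightarrow> real \<Rightarrow> (nat \<Rightarrow> nat \<Rightarrow> real) \<Rightarrow> (nat \<Rightarrow> real) \<Rightarrow> real" where
  "defect n s k r v = 1 - s * quad n r v - k * (quad n r v / (1 + ntrace n r))"

definition scaled :: "nat \<Rightarrow> (nat \<Rightarrow> real) \<Rightarrow> nat \<Rightarrow> real" where
  "scaled n x = (\<lambda>a. x a / sqrt (real n))"

text \<open>The first quotient is \<open>n\<close> times the contribution of the column
  \<open>x\<close> to \<open>1 - s h\<close>, expressed through the resolvent \<open>r\<close>
  without that column; the second is \<open>h / (1 + g)\<close> for the resolvent with it. Summed
  over the columns and divided by \<open>n\<close>, the differences give the defect.\<close>

definition col_term :: "nat \<Rightarrow> (nat \<Rightarrow> nat \<Rightarrow> real) \<Rightarrow> (nat \<Rightarrow> real) \<Rightarrow> (nat \<Rightarrow> real) \<Rightarrow> real" where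
  "col_term n r v x = (ip n v x * ip n x (app n r v) / (1 + quad n r x / real n)
     - quad n (rank1_update n r (scaled n x)) v / (1 + ntrace n (rank1_update n r (scaled n x))))"

lemma noise_ip: "noise n (\<lambda>a b. u a * w b) x = ip n u x * ip n x w - ip n u w"
proof -
  have "noise n (\<lambda>a b. u a * w b) x = (\<Sum>a<n. \<Sum>b<n. (u a * x a) * (x b * w b)) - (\<Sum>a<n. \<Sum>b<n. u a * w b * (if a = b then 1 else 0))"
    by (simp add: noise_def algebra_simps sum_subtractf)
  also have "(\<Sum>a<n. \<Sum>b<n. u a * w b * (if a = b then 1 else 0)) = (\<Sum>a<n. u a * w a)"
    by (intro sum.cong refl) (simp add: sum_delta_mult)
  finally show ?thesis by (simp add: ip_def sum_product)
qed

lemma noise_quad: "noise n r x = quad n r x - trc n r"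
proof -
  have "noise n r x = (\<Sum>a<n. \<Sum>b<n. x a * r a b * x b) - (\<Sum>a<n. \<Sum>b<n. r a b * (if a = b then 1 else 0))"
    by (simp add: noise_def algebra_simps sum_subtractf)
  also have "(\<Sum>a<n. \<Sum>b<n. r a b * (if a = b then 1 else 0)) = (\<Sum>a<n. r a a)"
    by (intro sum.cong refl) (simp add: sum_delta_mult)
  finally show ?thesis by (simp add: quad_def ip_app trc_def)
qed

lemma ip_scaled: "ip n (scaled n x) w = ip n x w / sqrt (real n)" "ip n w (scaled n x) = ip n w x / sqrt (real n)"
  by (simp_all add: ip_def scaled_def sum_divide_distrib)

lemma app_scaled: "app n r (scaled n x) = (\<lambda>i. app n r x i / sqrt (real n))"
  by (simp add: app_def scaled_def sum_divide_distrib)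

lemma quad_scaled: "quad n r (scaled n x) = quad n r x / real n"
proof -
  have "ip n (\<lambda>a. x a / sqrt (real n)) (\<lambda>i. app n r x i / sqrt (real n)) = ip n x (app n r x) / real n"
    by (simp add: ip_def sum_divide_distrib)
  then show ?thesis by (simp add: quad_def app_scaled) (simp add: scaled_def)
qed

lemma trc_nonneg:
  assumes "contractive_ker n s r" "s > 0" shows "0 \<le> trc n r"
  unfolding trc_def
proof (intro sum_nonneg)
  fix a assume a: "a \<in> {..<n}"
  let ?e = "\<lambda>i. if i = a then 1 else (0::real)"
  have "ip n ?e (app n r ?e) = r a a"
    using a by (simp add: ip_def app_def sum_delta_mult)
  then show "0 \<le> r a a" using contractive_nonneg[OF assms, of ?e] by simp
qed

lemma abs_div_diff_le:
  fixes h h' g g' :: real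
  assumes "0 \<le> h" "0 \<le> g" "0 \<le> g'" "0 \<le> h'" "h \<le> 1"
  shows "\<bar>h / (1 + g) - h' / (1 + g')\<bar> \<le> \<bar>h - h'\<bar> + \<bar>g - g'\<bar>"
proof -
  have "h / (1 + g) - h' / (1 + g') = (h - h') / (1 + g') + h * (g' - g) / ((1 + g) * (1 + g'))"
    using assms by (simp add: divide_simps) (simp add: algebra_simps)
  also have "\<bar>\<dots>\<bar> \<le> \<bar>(h - h') / (1 + g')\<bar> + \<bar>h * (g' - g) / ((1 + g) * (1 + g'))\<bar>" by (rule abs_triangle_ineq)
  also have "\<bar>(h - h') / (1 + g')\<bar> \<le> \<bar>h - h'\<bar> / 1"
    unfolding abs_divide using assms by (intro divide_left_mono) auto
  also have "\<bar>h * (g' - g) / ((1 + g) * (1 + g'))\<bar> \<le> \<bar>h * (g' - g)\<bar> / 1"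
  proof -
    have "1 * 1 \<le> (1 + g) * (1 + g')" using assms by (intro mult_mono) auto
    then show ?thesis unfolding abs_divide by (intro divide_left_mono) auto
  qed
  also have "\<bar>h * (g' - g)\<bar> \<le> 1 * \<bar>g' - g\<bar>" unfolding abs_mult using assms by (intro mult_right_mono) auto
  finally show ?thesis by (simp add: abs_minus_commute)
qed

text \<open>The product of the defect with the column term is \<open>F\<^sub>0 T\<^sub>1 / (1 + g\<^sub>0)\<close>, where
  \<open>F\<^sub>0\<close>, \<open>g\<^sub>0\<close> do not depend on the new column and \<open>T\<^sub>1\<close> is centred, up to an error of order \<open>n\<^sup>-\<^sup>1\<^sup>/\<^sup>2\<close>.\<close>

lemma col_term_bound:
  fixes x v :: "nat \<Rightarrow> real"
  assumes c: "contractive_ker n s r" and s: "s \<ge> 1" and n: "n \<ge> 1" and v: "ip n v v = 1" and k: "k \<ge> 0"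
    and c': "contractive_ker n s (rank1_update n r (scaled n x))"
  defines "w \<equiv> app n r v"
  defines "T1 \<equiv> noise n (\<lambda>a b. v a * w b) x" and "T2 \<equiv> noise n (\<lambda>a b. w a * w b) x" and "Tq \<equiv> noise n r x"
  defines "F \<equiv> defect n s k (rank1_update n r (scaled n x)) v"
  shows "\<bar>F * col_term n r v x - defect n s k r v / (1 + ntrace n r) * T1\<bar>
      \<le> ((s + 2 * k) * (T2\<^sup>2 + 1 + T1\<^sup>2) + (1 + k) * (1 + T1\<^sup>2 + Tq\<^sup>2 / n) + (1 + k) * (T2\<^sup>2 + 3)) / sqrt n"
    and "\<bar>F\<bar> \<le> 1 + k"
    and "\<bar>col_term n r v x\<bar> \<le> ip n x x + 1"
    and "ip n w w \<le> 1"
proof -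
  define r' where "r' = rank1_update n r (scaled n x)"
  define h h' g g' q \<zeta> where "h = quad n r v" and "h' = quad n r' v" and "g = ntrace n r" and "g' = ntrace n r'"
    and "q = quad n r x / n" and "\<zeta> = (ip n x w)\<^sup>2"
  have s0: "s > 0" using s by simp
  have sym: "sym_ker r" using c by (simp add: contractive_ker_def)
  have bound1: "0 \<le> quad n \<rho> v" "s * quad n \<rho> v \<le> 1" "quad n \<rho> v \<le> 1" "0 \<le> ntrace n \<rho>"
    if "contractive_ker n s \<rho>" for \<rho>
  proof -
    show 1: "0 \<le> quad n \<rho> v" unfolding quad_def by (rule contractive_nonneg[OF that s0])
    show 2: "s * quad n \<rho> v \<le> 1" unfolding quad_def using contractive_form[OF that s0, of v] v by simp
    have "1 * quad n \<rho> v \<le> s * quad n \<rho> v" using 1 s by (intro mult_right_mono) auto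
    then show "quad n \<rho> v \<le> 1" using 2 by linarith
    show "0 \<le> ntrace n \<rho>" unfolding ntrace_def using trc_nonneg[OF that s0] by simp
  qed
  note b = bound1[OF c, folded h_def g_def] and b' = bound1[OF c'[folded r'_def], folded h'_def g'_def]
  have q0: "0 \<le> q" unfolding q_def quad_def using contractive_nonneg[OF c s0, of x] by simp
  have ww: "ip n w w \<le> 1"
  proof -
    have "1 * ip n w w \<le> s\<^sup>2 * ip n w w" using s ip_self_nonneg[of n w] by (intro mult_right_mono) auto
    also have "\<dots> \<le> ip n v v" unfolding w_def by (rule contractive_norm[OF c s0])
    finally show ?thesis using v by simp
  qed
  then show "ip n w w \<le> 1" .
  have n0: "real n \<ge> 1" using n by simp
  have qs: "ip n (scaled n x) (app n r (scaled n x)) = q"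
    using quad_scaled[of n r x] by (simp add: quad_def q_def)
  have hh: "h - h' = \<zeta> / n / (1 + q)"
  proof -
    have "h' = h - (ip n x w / sqrt n) * (ip n x w / sqrt n) / (1 + q)"
      unfolding h'_def h_def r'_def quad_def ip_app_rank1_update[OF sym] qs
      by (simp add: ip_scaled w_def)
    then show ?thesis using n by (simp add: \<zeta>_def power2_eq_square)
  qed
  have \<zeta>0: "0 \<le> \<zeta>" by (simp add: \<zeta>_def)
  have hd: "\<bar>h - h'\<bar> \<le> \<zeta> / n"
  proof -
    have "\<zeta> / n / (1 + q) \<le> \<zeta> / n / 1" using q0 \<zeta>0 n0 by (intro divide_left_mono divide_nonneg_nonneg) auto
    then show ?thesis unfolding hh using q0 \<zeta>0 by simp
  qed
  \<comment> \<open>One column changes the trace by a bounded amount: the update subtracts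
    \<open>|r z|^2 / (1 + q)\<close>, and \<open>|r z|^2 \<le> s |r z|^2 \<le> q\<close>.\<close>
  have gd: "\<bar>g - g'\<bar> \<le> 1 / n"
  proof -
    let ?y = "app n r (scaled n x)"
    have e: "g - g' = ip n ?y ?y / (1 + q) / n"
      unfolding g_def g'_def ntrace_def r'_def trc_rank1_update qs by (simp add: diff_divide_distrib)
    have "1 * ip n ?y ?y \<le> s * ip n ?y ?y" using s ip_self_nonneg[of n ?y] by (intro mult_right_mono) auto
    also have "\<dots> \<le> q" using c unfolding contractive_ker_def qs[symmetric] by blast
    finally have "ip n ?y ?y / (1 + q) \<le> 1" using q0 by simp
    moreover have "0 \<le> ip n ?y ?y / (1 + q)" using q0 ip_self_nonneg[of n ?y] by simp
    ultimately have "ip n ?y ?y / (1 + q) / n \<le> 1 / n" "0 \<le> ip n ?y ?y / (1 + q) / n"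
      using n0 divide_right_mono[of "ip n ?y ?y / (1 + q)" 1 "real n"] divide_nonneg_nonneg[of "ip n ?y ?y / (1 + q)" "real n"]
      by linarith+
    then show ?thesis unfolding e by linarith
  qed
  have T1: "ip n v x * ip n x w = h + T1"
    unfolding T1_def noise_ip h_def quad_def w_def by simp
  have T2: "\<zeta> = ip n w w + T2"
    unfolding T2_def noise_ip \<zeta>_def by (simp add: power2_eq_square ip_commute)
  have \<zeta>T: "\<zeta> \<le> 1 + \<bar>T2\<bar>" using T2 ww by linarith
  have Tq: "q - g = Tq / n"
    unfolding Tq_def noise_quad q_def g_def ntrace_def by (simp add: diff_divide_distrib)
  define E1 where "E1 = (h + T1) * (g - q) / ((1 + q) * (1 + g))"
  define E2 where "E2 = h / (1 + g) - h' / (1 + g')"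
  \<comment> \<open>\<open>E1\<close> is the error of replacing the random \<open>q\<close> by the
    normalized trace \<open>g\<close>, \<open>E2\<close> that of replacing the updated resolvent by
    \<open>r\<close>. What remains is linear in the centred \<open>T1\<close>.\<close>
  have col: "col_term n r v x = T1 / (1 + g) + E1 + E2"
  proof -
    have "col_term n r v x = (h + T1) / (1 + q) - h' / (1 + g')"
      unfolding col_term_def T1[symmetric] by (simp add: w_def q_def h'_def g'_def r'_def)
    moreover have "(h + T1) / (1 + q) = (h + T1) / (1 + g) + E1"
      unfolding E1_def using q0 b(4) by (simp add: divide_simps) (simp add: algebra_simps)
    moreover have "(h + T1) / (1 + g) = h / (1 + g) + T1 / (1 + g)" by (simp add: add_divide_distrib)
    ultimately show ?thesis by (simp add: E2_def)
  qed
  have F: "F = 1 - s * h' - k * (h' / (1 + g'))" "defect n s k r v = 1 - s * h - k * (h / (1 + g))"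
    by (simp_all add: F_def defect_def r'_def[symmetric] h_def h'_def g_def g'_def)
  have Fb: "\<bar>F\<bar> \<le> 1 + k"
  proof -
    have d: "0 \<le> h' / (1 + g')" "h' / (1 + g') \<le> 1" using b' by (auto simp: divide_le_eq)
    have "0 \<le> k * (h' / (1 + g'))" using k d by (intro mult_nonneg_nonneg) auto
    moreover have "k * (h' / (1 + g')) \<le> k * 1" using k d by (intro mult_left_mono) auto
    moreover have "0 \<le> s * h'" using s b' by (intro mult_nonneg_nonneg) auto
    ultimately show ?thesis unfolding F using b' by linarith
  qed
  then show "\<bar>F\<bar> \<le> 1 + k" .
  have E2b: "\<bar>E2\<bar> \<le> (\<zeta> + 1) / n"
  proof -
    have "\<bar>E2\<bar> \<le> \<bar>h - h'\<bar> + \<bar>g - g'\<bar>" unfolding E2_def using b b' by (intro abs_div_diff_le) auto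
    also have "\<dots> \<le> \<zeta> / n + 1 / n" by (intro add_mono hd gd)
    finally show ?thesis by (simp add: add_divide_distrib)
  qed
  have Fd: "\<bar>F - defect n s k r v\<bar> \<le> (s * \<zeta> + k * (\<zeta> + 1)) / n"
  proof -
    have "F - defect n s k r v = s * (h - h') + k * E2" unfolding F E2_def by (simp add: algebra_simps)
    also have "\<bar>\<dots>\<bar> \<le> s * \<bar>h - h'\<bar> + k * \<bar>E2\<bar>"
      using abs_triangle_ineq[of "s * (h - h')" "k * E2"] s0 k by (simp add: abs_mult)
    also have "\<dots> \<le> s * (\<zeta> / n) + k * ((\<zeta> + 1) / n)" using s0 k by (intro add_mono mult_left_mono hd E2b) auto
    also have "\<dots> = (s * \<zeta> + k * (\<zeta> + 1)) / n"
      by (simp only: times_divide_eq_right add_divide_distrib[symmetric])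
    finally show ?thesis .
  qed
  \<comment> \<open>Products of two noise terms are reduced to squares, so that the expectation of
    the error involves only variances.\<close>
  have gen: "(1 + t) * p \<le> t\<^sup>2 + 1 + p\<^sup>2" for t p :: real
  proof -
    have "t\<^sup>2 + 1 + p\<^sup>2 - (1 + t) * p = ((1 + t - p)\<^sup>2 + (1 - t)\<^sup>2 + p\<^sup>2) / 2"
      by (simp add: power2_eq_square field_simps)
    moreover have "0 \<le> ((1 + t - p)\<^sup>2 + (1 - t)\<^sup>2 + p\<^sup>2) / 2" by simp
    ultimately show ?thesis by linarith
  qed
  have n1: "1 / real n \<le> 1 / sqrt n"
  proof -
    have "sqrt n * 1 \<le> sqrt n * sqrt n" using n0 by (intro mult_left_mono) auto
    then have "sqrt n \<le> n" by simp
    then show ?thesis using n0 by (intro divide_left_mono) auto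
  qed
  have S1: "\<bar>(F - defect n s k r v) * (T1 / (1 + g))\<bar> \<le> (s + 2 * k) * (T2\<^sup>2 + 1 + T1\<^sup>2) / n"
  proof -
    have "\<bar>T1\<bar> / \<bar>1 + g\<bar> \<le> \<bar>T1\<bar> / 1" using b by (intro divide_left_mono) auto
    then have "\<bar>T1 / (1 + g)\<bar> \<le> \<bar>T1\<bar>" unfolding abs_divide by simp
    moreover have "(s * \<zeta> + k * (\<zeta> + 1)) / n \<le> (s + 2 * k) * (1 + \<bar>T2\<bar>) / n"
    proof (intro divide_right_mono)
      have "s * \<zeta> \<le> s * (1 + \<bar>T2\<bar>)" using \<zeta>T s0 by (intro mult_left_mono) auto
      moreover have "k * (\<zeta> + 1) \<le> k * (2 * (1 + \<bar>T2\<bar>))" using \<zeta>T k by (intro mult_left_mono) auto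
      ultimately show "s * \<zeta> + k * (\<zeta> + 1) \<le> (s + 2 * k) * (1 + \<bar>T2\<bar>)" by (simp add: algebra_simps)
    qed simp
    ultimately have "\<bar>(F - defect n s k r v) * (T1 / (1 + g))\<bar> \<le> (s + 2 * k) * (1 + \<bar>T2\<bar>) / n * \<bar>T1\<bar>"
      unfolding abs_mult using Fd by (intro mult_mono) (auto intro!: divide_nonneg_nonneg mult_nonneg_nonneg simp: s0 k less_imp_le)
    also have "\<dots> = (s + 2 * k) * ((1 + \<bar>T2\<bar>) * \<bar>T1\<bar>) / n" by simp
    also have "\<dots> \<le> (s + 2 * k) * (T2\<^sup>2 + 1 + T1\<^sup>2) / n"
    proof (intro divide_right_mono mult_left_mono)
      show "(1 + \<bar>T2\<bar>) * \<bar>T1\<bar> \<le> T2\<^sup>2 + 1 + T1\<^sup>2" using gen[of "\<bar>T2\<bar>" "\<bar>T1\<bar>"] by simp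
    qed (use s0 k in auto)
    finally show ?thesis .
  qed
  \<comment> \<open>Of the factor \<open>1 / n\<close> in \<open>q - g = Tq / n\<close>, one half
    power normalizes \<open>Tq\<close>, whose variance is of order \<open>n\<close>; the other half
    power is the rate.\<close>
  have S2: "\<bar>E1\<bar> \<le> (1 + T1\<^sup>2 + Tq\<^sup>2 / n) / sqrt n"
  proof -
    have "1 * 1 \<le> (1 + q) * (1 + g)" using q0 b by (intro mult_mono) auto
    then have "\<bar>E1\<bar> \<le> \<bar>(h + T1) * (g - q)\<bar> / 1"
      unfolding E1_def abs_divide by (intro divide_left_mono) auto
    also have "\<dots> = \<bar>h + T1\<bar> * \<bar>Tq\<bar> / n" using Tq n0 by (simp add: abs_mult abs_minus_commute[of g] abs_divide)
    also have "\<dots> \<le> (1 + \<bar>T1\<bar>) * \<bar>Tq\<bar> / n" using b by (intro divide_right_mono mult_right_mono) auto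
    also have "\<dots> = (1 + \<bar>T1\<bar>) * (\<bar>Tq\<bar> / sqrt n) / sqrt n" using n0 by simp
    also have "\<dots> \<le> (1 + T1\<^sup>2 + Tq\<^sup>2 / n) / sqrt n"
    proof (intro divide_right_mono)
      have e: "Tq\<^sup>2 / n = (\<bar>Tq\<bar> / sqrt n)\<^sup>2" using n0 by (simp add: power_divide)
      show "(1 + \<bar>T1\<bar>) * (\<bar>Tq\<bar> / sqrt n) \<le> 1 + T1\<^sup>2 + Tq\<^sup>2 / n"
        unfolding e using gen[of "\<bar>T1\<bar>" "\<bar>Tq\<bar> / sqrt n"] by simp
    qed simp
    finally show ?thesis .
  qed
  have S3: "\<bar>E2\<bar> \<le> (T2\<^sup>2 + 3) / n"
  proof -
    have "0 \<le> (1 - \<bar>T2\<bar>)\<^sup>2" by simp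
    then have "2 * \<bar>T2\<bar> \<le> 1 + T2\<^sup>2" by (simp add: power2_eq_square algebra_simps abs_mult_self_eq)
    then have "\<zeta> + 1 \<le> T2\<^sup>2 + 3" using \<zeta>T zero_le_power2[of T2] by linarith
    then have "(\<zeta> + 1) / n \<le> (T2\<^sup>2 + 3) / n" by (intro divide_right_mono) auto
    then show ?thesis using E2b by linarith
  qed
  have tosqrt: "y / n \<le> y / sqrt n" if "0 \<le> y" for y
    using mult_left_mono[OF n1 that] by simp
  \<comment> \<open>\<open>F\<close> itself contains the new column. It is replaced by the defect of
    \<open>r\<close> in front of the leading term; in front of \<open>E1\<close> and
    \<open>E2\<close> its boundedness suffices.\<close>
  have "F * col_term n r v x - defect n s k r v / (1 + g) * T1 = (F - defect n s k r v) * (T1 / (1 + g)) + F * E1 + F * E2"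
    unfolding col by (simp add: algebra_simps)
  also have "\<bar>\<dots>\<bar> \<le> \<bar>(F - defect n s k r v) * (T1 / (1 + g))\<bar> + \<bar>F\<bar> * \<bar>E1\<bar> + \<bar>F\<bar> * \<bar>E2\<bar>"
    unfolding abs_mult[of F, symmetric] by (intro order_trans[OF abs_triangle_ineq] add_right_mono abs_triangle_ineq)
  also have "\<dots> \<le> (s + 2 * k) * (T2\<^sup>2 + 1 + T1\<^sup>2) / sqrt n + (1 + k) * ((1 + T1\<^sup>2 + Tq\<^sup>2 / n) / sqrt n) + (1 + k) * ((T2\<^sup>2 + 3) / sqrt n)"
  proof (intro add_mono)
    show "\<bar>(F - defect n s k r v) * (T1 / (1 + g))\<bar> \<le> (s + 2 * k) * (T2\<^sup>2 + 1 + T1\<^sup>2) / sqrt n"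
      by (rule order_trans[OF S1 tosqrt]) (use s0 k in \<open>auto intro!: mult_nonneg_nonneg add_nonneg_nonneg\<close>)
    show "\<bar>F\<bar> * \<bar>E1\<bar> \<le> (1 + k) * ((1 + T1\<^sup>2 + Tq\<^sup>2 / n) / sqrt n)" using k by (intro mult_mono Fb S2) auto
    show "\<bar>F\<bar> * \<bar>E2\<bar> \<le> (1 + k) * ((T2\<^sup>2 + 3) / sqrt n)"
      using k by (intro mult_mono Fb order_trans[OF S3 tosqrt]) auto
  qed
  also have "\<dots> = ((s + 2 * k) * (T2\<^sup>2 + 1 + T1\<^sup>2) + (1 + k) * (1 + T1\<^sup>2 + Tq\<^sup>2 / n) + (1 + k) * (T2\<^sup>2 + 3)) / sqrt n"
    by (simp only: times_divide_eq_right add_divide_distrib[symmetric])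
  finally show "\<bar>F * col_term n r v x - defect n s k r v / (1 + ntrace n r) * T1\<bar>
      \<le> ((s + 2 * k) * (T2\<^sup>2 + 1 + T1\<^sup>2) + (1 + k) * (1 + T1\<^sup>2 + Tq\<^sup>2 / n) + (1 + k) * (T2\<^sup>2 + 3)) / sqrt n"
    unfolding g_def .
  show "\<bar>col_term n r v x\<bar> \<le> ip n x x + 1"
  proof -
    have "(ip n v x * ip n x w)\<^sup>2 \<le> (ip n x x)\<^sup>2"
    proof -
      have "(ip n v x)\<^sup>2 \<le> ip n x x" using ip_Cauchy_Schwarz[of n v x] v by simp
      moreover have "(ip n x w)\<^sup>2 \<le> ip n x x * 1"
        by (rule order_trans[OF ip_Cauchy_Schwarz]) (intro mult_left_mono ww ip_self_nonneg)
      ultimately have "(ip n v x)\<^sup>2 * (ip n x w)\<^sup>2 \<le> ip n x x * (ip n x x * 1)"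
        by (intro mult_mono) (auto simp: ip_self_nonneg)
      then show ?thesis by (simp add: power_mult_distrib power2_eq_square[of "ip n x x"])
    qed
    then have "\<bar>ip n v x * ip n x w\<bar> \<le> ip n x x"
      using abs_le_square_iff[of "ip n v x * ip n x w" "ip n x x"] ip_self_nonneg[of n x] by simp
    moreover have "\<bar>ip n v x * ip n x w / (1 + q)\<bar> \<le> \<bar>ip n v x * ip n x w\<bar> / 1"
      unfolding abs_divide[of _ "1 + q"] using q0 by (intro divide_left_mono) auto
    moreover have "0 \<le> h' / (1 + g')" "h' / (1 + g') \<le> 1" using b' by (auto simp: divide_le_eq)
    moreover have "col_term n r v x = ip n v x * ip n x w / (1 + q) - h' / (1 + g')"
      unfolding col_term_def by (simp add: w_def q_def h'_def g'_def r'_def)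
    ultimately show ?thesis by linarith
  qed
qed

section \<open>Measurability of the resolvent expressions\<close>

lemma measurable_ip:
  assumes "\<And>i. i < n \<Longrightarrow> (\<lambda>x. u x i) \<in> borel_measurable M" "\<And>i. i < n \<Longrightarrow> (\<lambda>x. w x i) \<in> borel_measurable M"
  shows "(\<lambda>x. ip n (u x) (w x)) \<in> borel_measurable M"
  unfolding ip_def using assms by (intro borel_measurable_sum borel_measurable_times) auto

lemma measurable_app:
  assumes "\<And>a b. a < n \<Longrightarrow> b < n \<Longrightarrow> (\<lambda>x. r x a b) \<in> borel_measurable M" "\<And>i. i < n \<Longrightarrow> (\<lambda>x. u x i) \<in> borel_measurable M"
    "i < n"
  shows "(\<lambda>x. app n (r x) (u x) i) \<in> borel_measurable M"
  unfolding app_def using assms by (intro borel_measurable_sum borel_measurable_times) auto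

lemma measurable_quad:
  assumes "\<And>a b. a < n \<Longrightarrow> b < n \<Longrightarrow> (\<lambda>x. r x a b) \<in> borel_measurable M" "\<And>i. i < n \<Longrightarrow> (\<lambda>x. u x i) \<in> borel_measurable M"
  shows "(\<lambda>x. quad n (r x) (u x)) \<in> borel_measurable M"
  unfolding quad_def by (intro measurable_ip measurable_app assms)

lemma measurable_ntrace:
  assumes "\<And>a b. a < n \<Longrightarrow> b < n \<Longrightarrow> (\<lambda>x. r x a b) \<in> borel_measurable M"
  shows "(\<lambda>x. ntrace n (r x)) \<in> borel_measurable M"
  unfolding ntrace_def trc_def using assms by (intro borel_measurable_divide borel_measurable_sum) auto

lemma measurable_defect:
  assumes "\<And>a b. a < n \<Longrightarrow> b < n \<Longrightarrow> (\<lambda>x. r x a b) \<in> borel_measurable M" "\<And>i. i < n \<Longrightarrow> (\<lambda>x. u x i) \<in> borel_measurable M"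
  shows "(\<lambda>x. defect n s k (r x) (u x)) \<in> borel_measurable M"
  unfolding defect_def
  by (intro borel_measurable_diff borel_measurable_times borel_measurable_divide borel_measurable_add
      measurable_quad measurable_ntrace assms borel_measurable_const)

lemma measurable_rank1_update:
  assumes "\<And>a b. a < n \<Longrightarrow> b < n \<Longrightarrow> (\<lambda>x. r x a b) \<in> borel_measurable M" "\<And>i. i < n \<Longrightarrow> (\<lambda>x. z x i) \<in> borel_measurable M"
    "a < n" "b < n"
  shows "(\<lambda>x. rank1_update n (r x) (z x) a b) \<in> borel_measurable M"
  unfolding rank1_update_def
  by (intro borel_measurable_diff borel_measurable_times borel_measurable_divide borel_measurable_add
      measurable_ip measurable_app assms borel_measurable_const)

lemma measurable_scaled:
  "(\<lambda>x. z x i) \<in> borel_measurable M \<Longrightarrow> (\<lambda>x. scaled n (z x) i) \<in> borel_measurable M"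
  unfolding scaled_def by (intro borel_measurable_divide) auto

lemma measurable_col_term:
  assumes "\<And>a b. a < n \<Longrightarrow> b < n \<Longrightarrow> (\<lambda>x. r x a b) \<in> borel_measurable M" "\<And>i. i < n \<Longrightarrow> (\<lambda>x. z x i) \<in> borel_measurable M"
    "\<And>i. i < n \<Longrightarrow> (\<lambda>x. v x i) \<in> borel_measurable M"
  shows "(\<lambda>x. col_term n (r x) (v x) (z x)) \<in> borel_measurable M"
  unfolding col_term_def
  by (intro borel_measurable_diff borel_measurable_times borel_measurable_divide borel_measurable_add
      measurable_ip measurable_app measurable_quad measurable_ntrace measurable_rank1_update measurable_scaled assms borel_measurable_const)

section \<open>Moments of independent entries\<close>

locale iid_entries = prob_space D for D :: "real measure" +
  assumes sets_D: "sets D = sets borel"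
    and moments: "\<And>k. integrable D (\<lambda>x. x ^ k)"
    and mean: "(\<integral>x. x \<partial>D) = 0" and var: "(\<integral>x. x\<^sup>2 \<partial>D) = 1"
begin

sublocale P: product_prob_space "\<lambda>_ :: nat \<times> nat. D" by unfold_locales

abbreviation Pi_D :: "(nat \<times> nat) set \<Rightarrow> (nat \<times> nat \<Rightarrow> real) measure" where
  "Pi_D I \<equiv> Pi\<^sub>M I (\<lambda>_. D)"

definition m4 :: real where "m4 = (\<integral>x. x ^ 4 \<partial>D)"

lemma prob_space_Pi_D: "prob_space (Pi_D I)"
  by (rule P.prob_space_axioms)

lemma coord_measurable: "i \<in> I \<Longrightarrow> (\<lambda>X. X i) \<in> borel_measurable (Pi_D I)"
  using measurable_component_singleton[of i I "\<lambda>_. D"] by (simp add: measurable_cong_sets[OF refl sets_D])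

text \<open>The variance of \<open>x^2\<close> is \<open>m4 - 1\<close>. The inequality lets
  \<open>m4\<close> dominate also those covariances that are equal to 1.\<close>

lemma m4_ge: "1 \<le> m4"
proof -
  have i: "integrable D (\<lambda>x. x ^ 4)" "integrable D (\<lambda>x. x\<^sup>2)" using moments by auto
  have "0 \<le> (\<integral>x. (x\<^sup>2 - 1)\<^sup>2 \<partial>D)" by simp
  also have "(\<integral>x. (x\<^sup>2 - 1)\<^sup>2 \<partial>D) = (\<integral>x. x ^ 4 - 2 * x\<^sup>2 + 1 \<partial>D)"
    by (intro Bochner_Integration.integral_cong refl) (simp add: power2_eq_square power4_eq_xxxx algebra_simps)
  also have "\<dots> = m4 - 1" using i by (simp add: m4_def var prob_space)
  finally show ?thesis by simp
qed

text \<open>Grouping equal factors turns a word in the coordinates into a product over distinct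
  coordinates, the form in which independence factorizes the expectation.\<close>

lemma prod_list_coords:
  fixes X :: "nat \<times> nat \<Rightarrow> real"
  assumes "finite I" "set ds \<subseteq> I"
  shows "prod_list (map X ds) = (\<Prod>i\<in>I. X i ^ count_list ds i)"
  using assms(2)
proof (induction ds)
  case (Cons d ds)
  have "(\<Prod>i\<in>I. X i ^ count_list (d # ds) i) = (\<Prod>i\<in>I. (if i = d then X i else 1) * X i ^ count_list ds i)"
    by (intro prod.cong) auto
  also have "\<dots> = (\<Prod>i\<in>I. if i = d then X i else 1) * (\<Prod>i\<in>I. X i ^ count_list ds i)" by (rule prod.distrib)
  also have "(\<Prod>i\<in>I. if i = d then X i else 1) = X d" using Cons assms(1) by (simp add: prod.delta)
  finally show ?case using Cons by simp
qed simp

lemma mixed_moment: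
  assumes "finite I" "set ds \<subseteq> I"
  shows "integrable (Pi_D I) (\<lambda>X. prod_list (map X ds))"
    and "(\<integral>X. prod_list (map X ds) \<partial>Pi_D I) = (\<Prod>i\<in>I. \<integral>x. x ^ count_list ds i \<partial>D)"
  unfolding prod_list_coords[OF assms]
  using assms(1) moments by (auto intro!: P.product_integrable_prod P.product_integral_prod)

lemma mixed_moment_zero:
  assumes "finite I" "set ds \<subseteq> I" "count_list ds i = 1"
  shows "(\<integral>X. prod_list (map X ds) \<partial>Pi_D I) = 0"
proof -
  have "i \<in> set ds" using assms(3) by (metis count_notin zero_neq_one)
  then have "i \<in> I" using assms(2) by auto
  moreover have "(\<integral>x. x ^ count_list ds i \<partial>D) = 0" using assms(3) mean by simp
  ultimately show ?thesis unfolding mixed_moment(2)[OF assms(1,2)] using assms(1) by (auto intro!: prod_zero)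
qed

lemma mixed_moment_pair:
  assumes "finite I" "set ds \<subseteq> I" "\<And>i. count_list ds i \<in> {0, 2}"
  shows "(\<integral>X. prod_list (map X ds) \<partial>Pi_D I) = 1"
  unfolding mixed_moment(2)[OF assms(1,2)]
proof (rule prod.neutral, intro ballI)
  fix i
  show "(\<integral>x. x ^ count_list ds i \<partial>D) = 1" using assms(3)[of i] var by (auto simp: prob_space)
qed

lemma moment_2:
  assumes "finite I" "p \<in> I" "q \<in> I"
  shows "integrable (Pi_D I) (\<lambda>X. X p * X q)" "(\<integral>X. X p * X q \<partial>Pi_D I) = (if p = q then 1 else 0)"
proof -
  have s: "set [p, q] \<subseteq> I" using assms by auto
  show "integrable (Pi_D I) (\<lambda>X. X p * X q)" using mixed_moment(1)[OF assms(1) s] by simp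
  show "(\<integral>X. X p * X q \<partial>Pi_D I) = (if p = q then 1 else 0)"
  proof (cases "p = q")
    case True
    then have "\<And>i. count_list [p, q] i \<in> {0, 2}" by auto
    then show ?thesis using mixed_moment_pair[OF assms(1) s] True by simp
  next
    case False
    then have "count_list [p, q] p = 1" by auto
    from mixed_moment_zero[OF assms(1) s this] show ?thesis using False by simp
  qed
qed

text \<open>A coordinate that occurs exactly once makes the moment vanish, and for two different
  squares the subtracted means cancel it. What survives are the two pairings of
  \<open>(p, q)\<close> with \<open>(p', q')\<close>: the covariance is \<open>m4 - 1\<close> if all
  four indices agree and 1 otherwise.\<close>

lemma moment_4:
  assumes "finite I" "p \<in> I" "q \<in> I" "p' \<in> I" "q' \<in> I"
  defines "C \<equiv> (\<integral>X. (X p * X q - (if p = q then 1 else 0)) * (X p' * X q' - (if p' = q' then 1 else 0)) \<partial>Pi_D I)"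
  shows "integrable (Pi_D I) (\<lambda>X. (X p * X q - (if p = q then 1 else 0)) * (X p' * X q' - (if p' = q' then 1 else 0)))"
    and "\<bar>C\<bar> \<le> m4 * ((if p = p' \<and> q = q' then 1 else 0) + (if p = q' \<and> q = p' then 1 else 0))"
proof -
  note prob_1 = prob_space.prob_space[OF prob_space_Pi_D, of I]
  let ?ds = "[p, q, p', q']"
  let ?e = "if p = q then 1 else (0::real)" and ?e' = "if p' = q' then 1 else (0::real)"
  let ?b = "m4 * ((if p = p' \<and> q = q' then 1 else 0) + (if p = q' \<and> q = p' then 1 else 0))"
  have s: "set ?ds \<subseteq> I" using assms by auto
  define E where "E = (\<integral>X. prod_list (map X ?ds) \<partial>Pi_D I)"
  have i4: "integrable (Pi_D I) (\<lambda>X. X p * X q * (X p' * X q'))"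
    using mixed_moment(1)[OF assms(1) s] by (simp add: mult.assoc)
  have E: "E = (\<integral>X. X p * X q * (X p' * X q') \<partial>Pi_D I)" unfolding E_def by (simp add: mult.assoc)
  note i2 = moment_2(1)[OF assms(1) assms(2,3)] moment_2(1)[OF assms(1) assms(4,5)]
  note v2 = moment_2(2)[OF assms(1) assms(2,3)] moment_2(2)[OF assms(1) assms(4,5)]
  have ex: "(X p * X q - ?e) * (X p' * X q' - ?e') = X p * X q * (X p' * X q') - ?e * (X p' * X q') - ?e' * (X p * X q) + ?e * ?e'" for X :: "nat \<times> nat \<Rightarrow> real"
    by (simp only: left_diff_distrib right_diff_distrib) (simp add: mult.commute)
  show "integrable (Pi_D I) (\<lambda>X. (X p * X q - ?e) * (X p' * X q' - ?e'))"
    unfolding ex by (intro Bochner_Integration.integrable_add Bochner_Integration.integrable_diff integrable_mult_right i4 i2) simp_all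
  have "C = (\<integral>X. X p * X q * (X p' * X q') - ?e * (X p' * X q') - ?e' * (X p * X q) + ?e * ?e' \<partial>Pi_D I)"
    unfolding C_def ex ..
  also have "\<dots> = E - ?e * ?e' - ?e' * ?e + ?e * ?e'"
    using i4 i2 unfolding E by (simp add: v2 prob_1)
  finally have C: "C = E - ?e * ?e'" by simp
  have z: "E = 0" if "count_list ?ds i = 1" for i
    unfolding E_def by (rule mixed_moment_zero[OF assms(1) s that])
  have o: "E = 1" if "\<And>i. count_list ?ds i \<in> {0, 2}"
    unfolding E_def by (rule mixed_moment_pair[OF assms(1) s that])
  have bnn: "0 \<le> ?b" using m4_ge by (intro mult_nonneg_nonneg add_nonneg_nonneg) simp_all
  have count_q: "count_list ?ds q = 1" if "p \<noteq> q" "p' \<noteq> q" "q' \<noteq> q" using that by simp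
  have count_p: "count_list ?ds p = 1" if "q \<noteq> p" "p' \<noteq> p" "q' \<noteq> p" using that by simp
  show "\<bar>C\<bar> \<le> ?b"
  proof (cases "p = q")
    case pq: True
    show ?thesis
    proof (cases "p' = q'")
      case p'q': True
      show ?thesis
      proof (cases "p = p'")
        case True
        have "E = (\<Prod>i\<in>I. if i = p then m4 else 1)"
          unfolding E_def mixed_moment(2)[OF assms(1) s] using pq p'q' True
          by (intro prod.cong refl) (auto simp: m4_def prob_space power4_eq_xxxx mult.assoc)
        also have "\<dots> = m4" using assms by simp
        finally show ?thesis using C pq p'q' True m4_ge by simp
      next
        case False
        then have "\<And>i. count_list ?ds i \<in> {0, 2}" using pq p'q' by auto
        then show ?thesis using o C pq p'q' m4_ge by simp
      qed
    next
      case False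
      have "\<exists>i. count_list ?ds i = 1"
      proof (cases "p = p'")
        case True then show ?thesis using False pq by (intro exI[of _ q']) auto
      next
        case F: False then show ?thesis using False pq by (intro exI[of _ p']) auto
      qed
      then have "E = 0" using z by blast
      then show ?thesis using C False m4_ge by simp
    qed
  next
    case pq: False
    show ?thesis
    proof (cases "p = p' \<and> q = q' \<or> p = q' \<and> q = p'")
      case True
      then have "\<And>i. count_list ?ds i \<in> {0, 2}" using pq by auto
      then have "E = 1" by (rule o)
      then have "C = 1" using C pq by simp
      moreover have "1 \<le> (if p = p' \<and> q = q' then 1 else 0) + (if p = q' \<and> q = p' then 1 else (0::real))"
        using True by (elim disjE) simp_all
      then have "m4 * 1 \<le> ?b" using m4_ge by (intro mult_left_mono) simp_all
      moreover have "\<bar>1 :: real\<bar> \<le> m4 * 1" using m4_ge by simp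
      ultimately show ?thesis by (metis order_trans)
    next
      case False
      have "\<exists>i. count_list ?ds i = 1"
      proof (cases "p = p' \<or> p = q'")
        case True then show ?thesis using False pq count_q by metis
      next
        case F: False then show ?thesis using pq count_p by metis
      qed
      then have "E = 0" using z by blast
      then have "\<bar>C\<bar> = 0" using C pq by simp
      then show ?thesis using bnn by linarith
    qed
  qed
qed

section \<open>Mean and variance of centred quadratic forms\<close>

definition col :: "nat \<Rightarrow> (nat \<times> nat \<Rightarrow> real) \<Rightarrow> nat \<Rightarrow> real" where
  "col j X = (\<lambda>a. X (a, j))"

lemma integral_double_sum:
  fixes f :: "nat \<Rightarrow> nat \<Rightarrow> 'z \<Rightarrow> real"
  assumes "\<And>a b. a < n \<Longrightarrow> b < n \<Longrightarrow> integrable Q (f a b)"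
  shows "integrable Q (\<lambda>x. \<Sum>a<n. \<Sum>b<n. f a b x)"
    and "(\<integral>x. (\<Sum>a<n. \<Sum>b<n. f a b x) \<partial>Q) = (\<Sum>a<n. \<Sum>b<n. \<integral>x. f a b x \<partial>Q)"
proof -
  have i: "integrable Q (\<lambda>x. \<Sum>b<n. f a b x)" if "a < n" for a
    using assms that by (intro Bochner_Integration.integrable_sum) auto
  then show "integrable Q (\<lambda>x. \<Sum>a<n. \<Sum>b<n. f a b x)"
    by (intro Bochner_Integration.integrable_sum[of "{..<n}" Q "\<lambda>a x. \<Sum>b<n. f a b x"]) simp
  have "(\<integral>x. (\<Sum>a<n. \<Sum>b<n. f a b x) \<partial>Q) = (\<Sum>a<n. \<integral>x. (\<Sum>b<n. f a b x) \<partial>Q)"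
    using i by (intro Bochner_Integration.integral_sum) auto
  also have "\<dots> = (\<Sum>a<n. \<Sum>b<n. \<integral>x. f a b x \<partial>Q)"
    using assms by (intro sum.cong refl Bochner_Integration.integral_sum) auto
  finally show "(\<integral>x. (\<Sum>a<n. \<Sum>b<n. f a b x) \<partial>Q) = (\<Sum>a<n. \<Sum>b<n. \<integral>x. f a b x \<partial>Q)" .
qed

lemma noise_mean:
  assumes "finite I" "{..<n} \<times> {j} \<subseteq> I"
  shows "integrable (Pi_D I) (\<lambda>X. noise n A (col j X))" "(\<integral>X. noise n A (col j X) \<partial>Pi_D I) = 0"
proof -
  note prob_1 = prob_space.prob_space[OF prob_space_Pi_D, of I]
  have m: "integrable (Pi_D I) (\<lambda>X. A a b * (X (a, j) * X (b, j) - (if a = b then 1 else 0))) \<and>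
      (\<integral>X. A a b * (X (a, j) * X (b, j) - (if a = b then 1 else 0)) \<partial>Pi_D I) = 0" if "a < n" "b < n" for a b
  proof -
    have ab: "(a, j) \<in> I" "(b, j) \<in> I" using assms(2) that by auto
    show ?thesis using moment_2[OF assms(1) ab] by (simp add: prob_1)
  qed
  show "integrable (Pi_D I) (\<lambda>X. noise n A (col j X))"
    unfolding noise_def col_def by (rule integral_double_sum(1)) (use m in blast)
  have "(\<integral>X. noise n A (col j X) \<partial>Pi_D I) =
      (\<Sum>a<n. \<Sum>b<n. \<integral>X. A a b * (X (a, j) * X (b, j) - (if a = b then 1 else 0)) \<partial>Pi_D I)"
    unfolding noise_def col_def by (rule integral_double_sum(2)) (use m in blast)
  also have "\<dots> = (\<Sum>a<n. \<Sum>b<n. 0)" using m by (intro sum.cong refl) (simp only: lessThan_iff)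
  finally show "(\<integral>X. noise n A (col j X) \<partial>Pi_D I) = 0" by simp
qed

text \<open>Expanding the square gives a fourfold sum of covariances, of which only the pairings
  \<open>(c, d) = (a, b)\<close> and \<open>(c, d) = (b, a)\<close> remain. \<open>A\<close> is
  arbitrary, to cover rank-one kernels such as \<open>v a * w b\<close>, so the second pairing
  leaves the cross term \<open>A a b * A b a\<close>.\<close>

lemma noise_variance:
  assumes "finite I" "{..<n} \<times> {j} \<subseteq> I"
  shows "integrable (Pi_D I) (\<lambda>X. (noise n A (col j X))\<^sup>2)"
    and "(\<integral>X. (noise n A (col j X))\<^sup>2 \<partial>Pi_D I) \<le> 2 * m4 * (\<Sum>a<n. \<Sum>b<n. (A a b)\<^sup>2)"
proof -
  let ?u = "\<lambda>a b X. X (a, j) * X (b, j) - (if a = b then 1 else (0::real))"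
  let ?C = "\<lambda>a b c d. \<integral>X. ?u a b X * ?u c d X \<partial>Pi_D I"
  have m: "integrable (Pi_D I) (\<lambda>X. ?u a b X * ?u c d X)"
    "\<bar>?C a b c d\<bar> \<le> m4 * ((if a = c \<and> b = d then 1 else 0) + (if a = d \<and> b = c then 1 else 0))"
    if "a < n" "b < n" "c < n" "d < n" for a b c d
  proof -
    have ab: "(a, j) \<in> I" "(b, j) \<in> I" "(c, j) \<in> I" "(d, j) \<in> I" using assms(2) that by auto
    show "integrable (Pi_D I) (\<lambda>X. ?u a b X * ?u c d X)" using moment_4(1)[OF assms(1) ab] by simp
    show "\<bar>?C a b c d\<bar> \<le> m4 * ((if a = c \<and> b = d then 1 else 0) + (if a = d \<and> b = c then 1 else 0))"
      using moment_4(2)[OF assms(1) ab] by simp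
  qed
  have dist: "K * (m4 * ((if U then 1 else 0) + (if V then 1 else 0))) = m4 * (if U then K else 0) + m4 * (if V then K else 0)"
    for K and U V :: bool
    by (cases U; cases V) (simp_all add: algebra_simps)
  have ex: "(noise n A (col j X))\<^sup>2 = (\<Sum>a<n. \<Sum>b<n. \<Sum>c<n. \<Sum>d<n. (A a b * A c d) * (?u a b X * ?u c d X))" for X
  proof -
    define K where "K a b = A a b * ?u a b X" for a b
    define S where "S = (\<Sum>a<n. \<Sum>b<n. K a b)"
    have "S * S = (\<Sum>a<n. \<Sum>b<n. K a b * S)"
      by (subst (1) S_def) (simp only: sum_distrib_right)
    also have "\<dots> = (\<Sum>a<n. \<Sum>b<n. \<Sum>c<n. \<Sum>d<n. K a b * K c d)"
      by (simp only: S_def sum_distrib_left)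
    also have "\<dots> = (\<Sum>a<n. \<Sum>b<n. \<Sum>c<n. \<Sum>d<n. (A a b * A c d) * (?u a b X * ?u c d X))"
      unfolding K_def by (simp only: mult.assoc mult.left_commute)
    finally show ?thesis by (simp add: S_def K_def noise_def col_def power2_eq_square)
  qed
  have i1: "integrable (Pi_D I) (\<lambda>X. (A a b * A c d) * (?u a b X * ?u c d X))"
    if "a < n" "b < n" "c < n" "d < n" for a b c d
    by (rule integrable_mult_right) (rule m(1)[OF that])
  have i2: "integrable (Pi_D I) (\<lambda>X. \<Sum>c<n. \<Sum>d<n. (A a b * A c d) * (?u a b X * ?u c d X))"
    if "a < n" "b < n" for a b
    by (rule integral_double_sum(1)) (rule i1[OF that])
  show "integrable (Pi_D I) (\<lambda>X. (noise n A (col j X))\<^sup>2)"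
    unfolding ex by (rule integral_double_sum(1)) (rule i2)
  have "(\<integral>X. (noise n A (col j X))\<^sup>2 \<partial>Pi_D I) =
      (\<Sum>a<n. \<Sum>b<n. \<integral>X. (\<Sum>c<n. \<Sum>d<n. (A a b * A c d) * (?u a b X * ?u c d X)) \<partial>Pi_D I)"
    unfolding ex by (rule integral_double_sum(2)) (rule i2)
  also have "\<dots> = (\<Sum>a<n. \<Sum>b<n. \<Sum>c<n. \<Sum>d<n. \<integral>X. (A a b * A c d) * (?u a b X * ?u c d X) \<partial>Pi_D I)"
    by (intro sum.cong refl integral_double_sum(2) i1) simp_all
  also have "\<dots> = (\<Sum>a<n. \<Sum>b<n. \<Sum>c<n. \<Sum>d<n. (A a b * A c d) * ?C a b c d)"
    by (simp only: integral_mult_right_zero)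
  also have "\<dots> \<le> (\<Sum>a<n. \<Sum>b<n. \<Sum>c<n. \<Sum>d<n. m4 * (if a = c \<and> b = d then \<bar>A a b * A c d\<bar> else 0) + m4 * (if a = d \<and> b = c then \<bar>A a b * A c d\<bar> else 0))"
  proof (intro sum_mono)
    fix a b c d assume abcd: "a \<in> {..<n}" "b \<in> {..<n}" "c \<in> {..<n}" "d \<in> {..<n}"
    have "(A a b * A c d) * ?C a b c d \<le> \<bar>A a b * A c d\<bar> * \<bar>?C a b c d\<bar>"
      unfolding abs_mult[symmetric, of "A a b * A c d"] by simp
    also have "\<dots> \<le> \<bar>A a b * A c d\<bar> * (m4 * ((if a = c \<and> b = d then 1 else 0) + (if a = d \<and> b = c then 1 else 0)))"
      using m(2) abcd by (intro mult_left_mono) auto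
    finally show "(A a b * A c d) * ?C a b c d \<le> m4 * (if a = c \<and> b = d then \<bar>A a b * A c d\<bar> else 0) + m4 * (if a = d \<and> b = c then \<bar>A a b * A c d\<bar> else 0)"
      by (simp only: dist)
  qed
  also have "\<dots> = (\<Sum>a<n. \<Sum>b<n. m4 * \<bar>A a b * A a b\<bar> + m4 * \<bar>A a b * A b a\<bar>)"
  proof (intro sum.cong refl)
    fix a b assume ab: "a \<in> {..<n}" "b \<in> {..<n}"
    have 1: "(\<Sum>c<n. \<Sum>d<n. if a = c \<and> b = d then \<bar>A a b * A c d\<bar> else 0) = \<bar>A a b * A a b\<bar>"
    proof -
      have "(\<Sum>c<n. \<Sum>d<n. if a = c \<and> b = d then \<bar>A a b * A c d\<bar> else 0) = (\<Sum>c<n. if c = a then \<bar>A a b * A a b\<bar> else 0)"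
        using ab by (intro sum.cong refl) (auto simp: sum.delta)
      then show ?thesis using ab by simp
    qed
    have 2: "(\<Sum>c<n. \<Sum>d<n. if a = d \<and> b = c then \<bar>A a b * A c d\<bar> else 0) = \<bar>A a b * A b a\<bar>"
    proof -
      have "(\<Sum>c<n. \<Sum>d<n. if a = d \<and> b = c then \<bar>A a b * A c d\<bar> else 0) = (\<Sum>c<n. if c = b then \<bar>A a b * A b a\<bar> else 0)"
        using ab by (intro sum.cong refl) (auto simp: sum.delta)
      then show ?thesis using ab by simp
    qed
    show "(\<Sum>c<n. \<Sum>d<n. m4 * (if a = c \<and> b = d then \<bar>A a b * A c d\<bar> else 0) + m4 * (if a = d \<and> b = c then \<bar>A a b * A c d\<bar> else 0))
       = m4 * \<bar>A a b * A a b\<bar> + m4 * \<bar>A a b * A b a\<bar>"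
      by (simp only: sum.distrib sum_distrib_left[symmetric] 1 2)
  qed
  \<comment> \<open>The cross term is split by the arithmetic-geometric mean inequality; after
    exchanging the summation indices, the weights 3/2 and 1/2 add up to 2.\<close>
  also have "\<dots> \<le> (\<Sum>a<n. \<Sum>b<n. m4 * (3 / 2 * (A a b)\<^sup>2) + m4 * (1 / 2 * (A b a)\<^sup>2))"
  proof (intro sum_mono)
    fix a b
    have "0 \<le> (\<bar>A a b\<bar> - \<bar>A b a\<bar>)\<^sup>2" by simp
    then have "2 * \<bar>A a b * A b a\<bar> \<le> (A a b)\<^sup>2 + (A b a)\<^sup>2"
      by (simp add: power2_diff abs_mult)
    then have "\<bar>A a b * A a b\<bar> + \<bar>A a b * A b a\<bar> \<le> 3 / 2 * (A a b)\<^sup>2 + 1 / 2 * (A b a)\<^sup>2"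
      by (simp add: power2_eq_square abs_mult_self_eq abs_mult)
    then have "m4 * (\<bar>A a b * A a b\<bar> + \<bar>A a b * A b a\<bar>) \<le> m4 * (3 / 2 * (A a b)\<^sup>2 + 1 / 2 * (A b a)\<^sup>2)"
      using m4_ge by (intro mult_left_mono) auto
    then show "m4 * \<bar>A a b * A a b\<bar> + m4 * \<bar>A a b * A b a\<bar> \<le> m4 * (3 / 2 * (A a b)\<^sup>2) + m4 * (1 / 2 * (A b a)\<^sup>2)"
      by (simp only: distrib_left)
  qed
  also have "\<dots> = m4 * (3 / 2) * (\<Sum>a<n. \<Sum>b<n. (A a b)\<^sup>2) + m4 * (1 / 2) * (\<Sum>a<n. \<Sum>b<n. (A b a)\<^sup>2)"
    by (simp only: sum.distrib sum_distrib_left mult.assoc)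
  also have "(\<Sum>a<n. \<Sum>b<n. (A b a)\<^sup>2) = (\<Sum>a<n. \<Sum>b<n. (A a b)\<^sup>2)" by (rule sum.swap)
  finally show "(\<integral>X. (noise n A (col j X))\<^sup>2 \<partial>Pi_D I) \<le> 2 * m4 * (\<Sum>a<n. \<Sum>b<n. (A a b)\<^sup>2)"
    by (simp add: algebra_simps)
qed

text \<open>The numerator of the error in \<open>col_term_bound\<close> with \<open>T1^2\<close>,
  \<open>T2^2\<close> and \<open>Tq^2 / n\<close> each replaced by \<open>2 * m4\<close>, the bound
  on its mean.\<close>

definition rate :: "real \<Rightarrow> real \<Rightarrow> real" where
  "rate s k = (s + 2 * k) * (1 + 4 * m4) + (1 + k) * (1 + 4 * m4) + (1 + k) * (2 * m4 + 3)"

text \<open>Only the new column is integrated. The kernel \<open>r\<close> is fixed, so the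
  coefficient \<open>c0\<close> of \<open>T1\<close> is a constant and the leading term has mean
  zero; the expectation is then bounded by that of the error.\<close>

lemma column_expectation:
  assumes c: "contractive_ker n s r" and s: "s \<ge> 1" and n: "n \<ge> 1" and v: "ip n v v = 1" and k: "k \<ge> 0"
    and c': "\<And>x. contractive_ker n s (rank1_update n r (scaled n x))"
  shows "\<bar>\<integral>X. defect n s k (rank1_update n r (scaled n (col j X))) v * col_term n r v (col j X) \<partial>Pi_D ({..<n} \<times> {j})\<bar>
      \<le> rate s k / sqrt n" (is "\<bar>\<integral>X. ?\<Phi> X \<partial>?P\<bar> \<le> _")
proof -
  let ?I = "{..<n} \<times> {j}"
  note prob_1 = prob_space.prob_space[OF prob_space_Pi_D, of ?I]
  have I: "finite ?I" "?I \<subseteq> ?I" by auto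
  have ic: "integrable ?P (\<lambda>X. d)" for d :: real
    using prob_space.finite_measure[OF prob_space_Pi_D] by (rule finite_measure.integrable_const)
  define w where "w = app n r v"
  define T1 where "T1 X = noise n (\<lambda>a b. v a * w b) (col j X)" for X
  define T2 where "T2 X = noise n (\<lambda>a b. w a * w b) (col j X)" for X
  define Tq where "Tq X = noise n r (col j X)" for X
  define Vq where "Vq X = (Tq X)\<^sup>2 / n" for X
  define c0 where "c0 = defect n s k r v / (1 + ntrace n r)"
  define B where "B X = ((s + 2 * k) * ((T2 X)\<^sup>2 + 1 + (T1 X)\<^sup>2) + (1 + k) * (1 + (T1 X)\<^sup>2 + Vq X) + (1 + k) * ((T2 X)\<^sup>2 + 3)) / sqrt n" for X
  note bnd = col_term_bound[OF c s n v k c', folded w_def]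
  have ptw: "\<bar>?\<Phi> X - c0 * T1 X\<bar> \<le> B X" for X
    using bnd(1)[of "col j X"] unfolding B_def T1_def T2_def Vq_def Tq_def c0_def by simp
  have ww: "ip n w w \<le> 1" by (rule bnd(4))
  have hs: "(\<Sum>a<n. \<Sum>b<n. (p a * q b)\<^sup>2) = ip n p p * ip n q q" for p q
    by (simp add: ip_def sum_product power2_eq_square mult_ac)
  have v1: "integrable ?P (\<lambda>X. (T1 X)\<^sup>2)" "(\<integral>X. (T1 X)\<^sup>2 \<partial>?P) \<le> 2 * m4"
  proof -
    show "integrable ?P (\<lambda>X. (T1 X)\<^sup>2)" unfolding T1_def by (rule noise_variance(1)[OF I])
    have "(\<integral>X. (T1 X)\<^sup>2 \<partial>?P) \<le> 2 * m4 * (ip n v v * ip n w w)"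
      unfolding T1_def hs[symmetric] by (rule noise_variance(2)[OF I])
    also have "\<dots> \<le> 2 * m4 * 1" using ww v m4_ge by (intro mult_left_mono) auto
    finally show "(\<integral>X. (T1 X)\<^sup>2 \<partial>?P) \<le> 2 * m4" by simp
  qed
  have v2: "integrable ?P (\<lambda>X. (T2 X)\<^sup>2)" "(\<integral>X. (T2 X)\<^sup>2 \<partial>?P) \<le> 2 * m4"
  proof -
    show "integrable ?P (\<lambda>X. (T2 X)\<^sup>2)" unfolding T2_def by (rule noise_variance(1)[OF I])
    have "(\<integral>X. (T2 X)\<^sup>2 \<partial>?P) \<le> 2 * m4 * (ip n w w * ip n w w)"
      unfolding T2_def hs[symmetric] by (rule noise_variance(2)[OF I])
    also have "\<dots> \<le> 2 * m4 * (1 * 1)" using ww m4_ge ip_self_nonneg[of n w] by (intro mult_left_mono mult_mono) auto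
    finally show "(\<integral>X. (T2 X)\<^sup>2 \<partial>?P) \<le> 2 * m4" by simp
  qed
  \<comment> \<open>The squared Hilbert-Schmidt norm of \<open>r\<close> is at most
    \<open>n\<close>, and dividing by \<open>n\<close> compensates it. This is why \<open>Tq\<close>
    enters the error only through \<open>Tq^2 / n\<close>.\<close>
  have vq: "integrable ?P Vq" "(\<integral>X. Vq X \<partial>?P) \<le> 2 * m4"
  proof -
    have "integrable ?P (\<lambda>X. (Tq X)\<^sup>2)" unfolding Tq_def by (rule noise_variance(1)[OF I])
    then show "integrable ?P Vq" unfolding Vq_def[abs_def] by simp
    have "1 * (\<Sum>a<n. \<Sum>b<n. (r a b)\<^sup>2) \<le> s\<^sup>2 * (\<Sum>a<n. \<Sum>b<n. (r a b)\<^sup>2)"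
      using s by (intro mult_right_mono) (auto intro!: sum_nonneg)
    also have "\<dots> \<le> n" using s by (intro hs_contractive[OF c]) auto
    finally have "2 * m4 * (\<Sum>a<n. \<Sum>b<n. (r a b)\<^sup>2) \<le> 2 * m4 * n" using m4_ge by (intro mult_left_mono) auto
    then have "(\<integral>X. (Tq X)\<^sup>2 \<partial>?P) \<le> 2 * m4 * n"
      unfolding Tq_def using noise_variance(2)[OF I, of r] by linarith
    then show "(\<integral>X. Vq X \<partial>?P) \<le> 2 * m4" unfolding Vq_def[abs_def] using n by (simp add: divide_le_eq)
  qed
  have iB: "integrable ?P B"
    unfolding B_def[abs_def] using v1 v2 vq ic by (intro integrable_divide Bochner_Integration.integrable_add integrable_mult_right) auto
  have "(\<integral>X. B X \<partial>?P) = ((s + 2 * k) * ((\<integral>X. (T2 X)\<^sup>2 \<partial>?P) + 1 + (\<integral>X. (T1 X)\<^sup>2 \<partial>?P))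
      + (1 + k) * (1 + (\<integral>X. (T1 X)\<^sup>2 \<partial>?P) + (\<integral>X. Vq X \<partial>?P)) + (1 + k) * ((\<integral>X. (T2 X)\<^sup>2 \<partial>?P) + 3)) / sqrt n"
    unfolding B_def[abs_def] using v1(1) v2(1) vq(1) ic
    by (subst Bochner_Integration.integral_divide_zero) (simp add: prob_1)
  also have "\<dots> \<le> ((s + 2 * k) * (2 * m4 + 1 + 2 * m4) + (1 + k) * (1 + 2 * m4 + 2 * m4) + (1 + k) * (2 * m4 + 3)) / sqrt n"
    using v1(2) v2(2) vq(2) s k by (intro divide_right_mono add_mono mult_left_mono) auto
  also have "\<dots> = rate s k / sqrt n" by (simp add: rate_def algebra_simps)
  finally have EB: "(\<integral>X. B X \<partial>?P) \<le> rate s k / sqrt n" .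
  have iT: "integrable ?P T1" "(\<integral>X. T1 X \<partial>?P) = 0"
    unfolding T1_def[abs_def] by (rule noise_mean[OF I])+
  have meas: "?\<Phi> \<in> borel_measurable ?P"
    by (intro borel_measurable_times measurable_defect measurable_col_term measurable_rank1_update measurable_scaled borel_measurable_const)
       (auto simp: col_def intro!: coord_measurable)
  have iD: "integrable ?P (\<lambda>X. ?\<Phi> X - c0 * T1 X)"
    by (rule Bochner_Integration.integrable_bound[OF iB]) (use meas iT ptw in \<open>auto intro!: AE_I2 intro: order_trans[OF _ abs_ge_self]\<close>)
  have "(\<integral>X. ?\<Phi> X \<partial>?P) = (\<integral>X. (?\<Phi> X - c0 * T1 X) + c0 * T1 X \<partial>?P)" by simp
  also have "\<dots> = (\<integral>X. ?\<Phi> X - c0 * T1 X \<partial>?P) + c0 * 0"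
    using iD iT by (subst Bochner_Integration.integral_add) auto
  finally have "\<bar>\<integral>X. ?\<Phi> X \<partial>?P\<bar> = \<bar>\<integral>X. ?\<Phi> X - c0 * T1 X \<partial>?P\<bar>" by simp
  also have "\<dots> \<le> (\<integral>X. \<bar>?\<Phi> X - c0 * T1 X\<bar> \<partial>?P)" by (rule integral_abs_bound)
  also have "\<dots> \<le> (\<integral>X. B X \<partial>?P)" using iD iB ptw by (intro integral_mono) auto
  finally show ?thesis using EB by linarith
qed

end

section \<open>Convergence of quadratic forms of the resolvent\<close>

lemma app_cong: "(\<And>a b. a < n \<Longrightarrow> b < n \<Longrightarrow> r a b = r' a b) \<Longrightarrow> (\<And>a. a < n \<Longrightarrow> u a = u' a) \<Longrightarrow> i < n \<Longrightarrow>
    app n r u i = app n r' u' i"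
  by (simp add: app_def)

lemma quad_cong:
  assumes "\<And>a b. a < n \<Longrightarrow> b < n \<Longrightarrow> r a b = r' a b" "\<And>a. a < n \<Longrightarrow> u a = u' a"
  shows "quad n r u = quad n r' u'"
  unfolding quad_def using assms by (intro ip_cong app_cong) auto

lemma ntrace_cong: "(\<And>a b. a < n \<Longrightarrow> b < n \<Longrightarrow> r a b = r' a b) \<Longrightarrow> ntrace n r = ntrace n r'"
  by (simp add: ntrace_def trc_def)

lemma defect_cong:
  assumes "\<And>a b. a < n \<Longrightarrow> b < n \<Longrightarrow> r a b = r' a b"
  shows "defect n s k r u = defect n s k r' u"
  unfolding defect_def using quad_cong[of n r r' u u] ntrace_cong[of n r r'] assms by simp

lemma rank1_update_cong:
  assumes "\<And>a b. a < n \<Longrightarrow> b < n \<Longrightarrow> r a b = r' a b" "\<And>a. a < n \<Longrightarrow> z a = z' a" "a < n" "b < n"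
  shows "rank1_update n r z a b = rank1_update n r' z' a b"
proof -
  have "app n r z i = app n r' z' i" if "i < n" for i using assms(1,2) that by (rule app_cong)
  moreover have "ip n z (app n r z) = ip n z' (app n r' z')" using quad_cong[of n r r' z z'] assms(1,2) by (simp add: quad_def)
  ultimately show ?thesis using assms by (simp add: rank1_update_def)
qed

lemma col_term_cong:
  assumes r: "\<And>a b. a < n \<Longrightarrow> b < n \<Longrightarrow> r a b = r' a b" and x: "\<And>a. a < n \<Longrightarrow> x a = x' a"
  shows "col_term n r v x = col_term n r' v x'"
proof -
  have sc: "scaled n x a = scaled n x' a" if "a < n" for a using x that by (simp add: scaled_def)
  have u: "rank1_update n r (scaled n x) a b = rank1_update n r' (scaled n x') a b" if "a < n" "b < n" for a b
    using r sc that by (rule rank1_update_cong)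
  have "ip n v x = ip n v x'" using x by (intro ip_cong) auto
  moreover have "ip n x (app n r v) = ip n x' (app n r' v)" using x r by (intro ip_cong app_cong) auto
  moreover have "quad n r x = quad n r' x'" using r x by (rule quad_cong)
  moreover have "quad n (rank1_update n r (scaled n x)) v = quad n (rank1_update n r' (scaled n x')) v" using u by (intro quad_cong) auto
  moreover have "ntrace n (rank1_update n r (scaled n x)) = ntrace n (rank1_update n r' (scaled n x'))" using u by (rule ntrace_cong)
  ultimately show ?thesis by (simp add: col_term_def)
qed

text \<open>A non-integrable function has integral 0 and \<open>c\<close> is nonnegative, so the
  bound holds in every case. This suits the outer integral after Fubini, whose integrand is itself
  an integral.\<close>

lemma (in prob_space) abs_integral_le_const:
  fixes f :: "'a \<Rightarrow> real"
  assumes "\<And>x. x \<in> space M \<Longrightarrow> \<bar>f x\<bar> \<le> c"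
  shows "\<bar>\<integral>x. f x \<partial>M\<bar> \<le> c"
proof (cases "integrable M f")
  case True
  have "\<bar>\<integral>x. f x \<partial>M\<bar> \<le> (\<integral>x. \<bar>f x\<bar> \<partial>M)" by (rule integral_abs_bound)
  also have "\<dots> \<le> (\<integral>x. c \<partial>M)" using True assms by (intro integral_mono) auto
  finally show ?thesis by (simp add: prob_space)
next
  case False
  obtain x where "x \<in> space M" using not_empty by auto
  then have "0 \<le> c" using assms[of x] by (auto intro: order_trans[OF abs_ge_zero])
  then show ?thesis using False by (simp add: not_integrable_integral_eq)
qed

text \<open>The variance of \<open>|f|\<close> is nonnegative: if \<open>e\<close> is its mean, then
  \<open>E (|f| - e)^2 = E f^2 - e^2\<close>.\<close>

lemma (in prob_space) abs_mean_le_sqrt: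
  fixes f :: "'a \<Rightarrow> real"
  assumes i: "integrable M f" "integrable M (\<lambda>x. (f x)\<^sup>2)" and le: "(\<integral>x. (f x)\<^sup>2 \<partial>M) \<le> c"
  shows "(\<integral>x. \<bar>f x\<bar> \<partial>M) \<le> sqrt c"
proof -
  define e where "e = (\<integral>x. \<bar>f x\<bar> \<partial>M)"
  have "0 \<le> (\<integral>x. (\<bar>f x\<bar> - e)\<^sup>2 \<partial>M)" by simp
  also have "(\<integral>x. (\<bar>f x\<bar> - e)\<^sup>2 \<partial>M) = (\<integral>x. (f x)\<^sup>2 - 2 * e * \<bar>f x\<bar> + e\<^sup>2 \<partial>M)"
    by (intro Bochner_Integration.integral_cong refl) (simp add: power2_diff)
  also have "\<dots> = (\<integral>x. (f x)\<^sup>2 \<partial>M) - 2 * e * e + e\<^sup>2"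
    using i by (simp add: prob_space e_def)
  finally have "e\<^sup>2 \<le> c" using le by (simp add: power2_eq_square)
  then show ?thesis unfolding e_def by (rule real_le_rsqrt)
qed

section \<open>The resolvent of a list of columns and its defect\<close>

definition columns :: "nat \<Rightarrow> nat list \<Rightarrow> (nat \<times> nat \<Rightarrow> real) \<Rightarrow> (nat \<Rightarrow> real) list" where
  "columns n js X = map (\<lambda>j. scaled n (\<lambda>a. X (a, j))) js"

text \<open>Indexing by a list of column numbers makes omission of a column expressible as
  \<open>remove1 j\<close>.\<close>

definition cov_resolvent :: "nat \<Rightarrow> real \<Rightarrow> nat list \<Rightarrow> (nat \<times> nat \<Rightarrow> real) \<Rightarrow> nat \<Rightarrow> nat \<Rightarrow> real" where
  "cov_resolvent n s js X = resolvent n s (columns n js X)"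

lemma cov_resolvent_cong:
  assumes "\<And>a j. a < n \<Longrightarrow> j \<in> set js \<Longrightarrow> X (a, j) = X' (a, j)" "a < n" "b < n"
  shows "cov_resolvent n s js X a b = cov_resolvent n s js X' a b"
  using assms
proof (induction js arbitrary: a b)
  case (Cons j js)
  have "rank1_update n (cov_resolvent n s js X) (scaled n (\<lambda>a. X (a, j))) a b = rank1_update n (cov_resolvent n s js X') (scaled n (\<lambda>a. X' (a, j))) a b"
    using Cons by (intro rank1_update_cong Cons.IH) (auto simp: scaled_def)
  then show ?case by (simp add: cov_resolvent_def columns_def)
qed (simp add: cov_resolvent_def columns_def)

lemma measurable_cov_resolvent:
  assumes "\<And>a j. a < n \<Longrightarrow> j \<in> set js \<Longrightarrow> (\<lambda>x. Y x (a, j)) \<in> borel_measurable M" "a < n" "b < n"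
  shows "(\<lambda>x. cov_resolvent n s js (Y x) a b) \<in> borel_measurable M"
  using assms
proof (induction js arbitrary: a b)
  case (Cons j js)
  have "(\<lambda>x. rank1_update n (cov_resolvent n s js (Y x)) (scaled n (\<lambda>a. Y x (a, j))) a b) \<in> borel_measurable M"
    using Cons by (intro measurable_rank1_update measurable_scaled Cons.IH) auto
  then show ?case by (simp add: cov_resolvent_def columns_def)
qed (simp add: cov_resolvent_def columns_def)

lemma contractive_cov_resolvent: "s > 0 \<Longrightarrow> contractive_ker n s (cov_resolvent n s js X)"
  unfolding cov_resolvent_def by (rule contractive_ker_resolvent)

lemma cov_resolvent_remove:
  assumes "j \<in> set js" "s > 0" "a < n" "b < n"
  shows "cov_resolvent n s js X a b = rank1_update n (cov_resolvent n s (remove1 j js) X) (scaled n (\<lambda>a. X (a, j))) a b"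
proof -
  have "mset js = mset (j # remove1 j js)" using assms(1) by simp
  then have "mset (columns n js X) = mset (columns n (j # remove1 j js) X)"
    unfolding columns_def mset_map by simp
  then have "resolvent n s (columns n js X) a b = resolvent n s (columns n (j # remove1 j js) X) a b"
    by (rule resolvent_permute) fact+
  then show ?thesis by (simp add: cov_resolvent_def columns_def)
qed

text \<open>Pairing the resolvent equation with \<open>v\<close> writes \<open>1 - s h\<close> as
  the sum of \<open>(z \<bullet> v) (z \<bullet> R v)\<close> over the scaled columns
  \<open>z\<close>. Each summand is rewritten through the resolvent without \<open>z\<close>; taking
  \<open>h / (1 + g)\<close> out of each of the \<open>m\<close> terms accounts for the coefficient
  \<open>m / n\<close>.\<close>

lemma defect_decomposition:
  assumes s: "s > 0" and n: "n \<ge> 1" and v: "ip n v v = 1"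
  shows "defect n s (real m / real n) (cov_resolvent n s [0..<m] X) v =
    (\<Sum>j<m. col_term n (cov_resolvent n s (remove1 j [0..<m]) X) v (\<lambda>a. X (a, j))) / real n"
proof -
  let ?R = "cov_resolvent n s [0..<m] X"
  have "ip n v v = ip n v (app n (outer_sum (columns n [0..<m] X)) (app n ?R v)) + s * ip n v (app n ?R v)"
    unfolding cov_resolvent_def by (rule ip_resolvent[OF is_resolvent_resolvent[OF s]])
  then have "1 - s * quad n ?R v = (\<Sum>z\<leftarrow>columns n [0..<m] X. ip n z v * ip n z (app n ?R v))"
    using v by (simp add: quad_def ip_app_outer_sum)
  also have "\<dots> = (\<Sum>j<m. ip n (scaled n (\<lambda>a. X (a, j))) v * ip n (scaled n (\<lambda>a. X (a, j))) (app n ?R v))"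
    by (simp add: columns_def interv_sum_list_conv_sum_set_nat atLeast0LessThan comp_def)
  finally have 1: "1 - s * quad n ?R v = (\<Sum>j<m. ip n (scaled n (\<lambda>a. X (a, j))) v * ip n (scaled n (\<lambda>a. X (a, j))) (app n ?R v))" .
  have 2: "ip n (scaled n (\<lambda>a. X (a, j))) v * ip n (scaled n (\<lambda>a. X (a, j))) (app n ?R v) =
      (col_term n (cov_resolvent n s (remove1 j [0..<m]) X) v (\<lambda>a. X (a, j)) + quad n ?R v / (1 + ntrace n ?R)) / n" if j: "j < m" for j
  proof -
    let ?r = "cov_resolvent n s (remove1 j [0..<m]) X" and ?x = "\<lambda>a. X (a, j)"
    let ?z = "scaled n ?x"
    have R: "?R a b = rank1_update n ?r ?z a b" if "a < n" "b < n" for a b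
      using j s that by (intro cov_resolvent_remove) auto
    have q: "quad n ?R v = quad n (rank1_update n ?r ?z) v" "ntrace n ?R = ntrace n (rank1_update n ?r ?z)"
      using R by (intro quad_cong ntrace_cong; simp)+
    have sym: "sym_ker ?r" and nn: "0 \<le> ip n ?z (app n ?r ?z)"
      using contractive_cov_resolvent[OF s] contractive_nonneg[OF _ s] by (auto simp: contractive_ker_def)
    have "ip n ?z (app n ?R v) = ip n ?z (app n (rank1_update n ?r ?z) v)"
      using R by (intro ip_cong app_cong) auto
    also have "\<dots> = ip n ?z (app n ?r v) / (1 + ip n ?z (app n ?r ?z))"
      by (rule ip_app_rank1_update_self[OF sym nn])
    also have "ip n ?z (app n ?r ?z) = quad n ?r ?x / n" using quad_scaled[of n ?r ?x] by (simp add: quad_def)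
    finally have "ip n ?z v * ip n ?z (app n ?R v) = (ip n ?x v / sqrt n) * (ip n ?x (app n ?r v) / sqrt n) / (1 + quad n ?r ?x / n)"
      by (simp add: ip_scaled)
    also have "\<dots> = (ip n v ?x * ip n ?x (app n ?r v) / (1 + quad n ?r ?x / n)) / n"
      using n by (simp add: ip_commute[of n v])
    also have "ip n v ?x * ip n ?x (app n ?r v) / (1 + quad n ?r ?x / n) = col_term n ?r v ?x + quad n ?R v / (1 + ntrace n ?R)"
      unfolding col_term_def q by simp
    finally show ?thesis .
  qed
  have "1 - s * quad n ?R v = (\<Sum>j<m. (col_term n (cov_resolvent n s (remove1 j [0..<m]) X) v (\<lambda>a. X (a, j)) + quad n ?R v / (1 + ntrace n ?R)) / n)"
    unfolding 1 using 2 by (intro sum.cong) auto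
  also have "\<dots> = (\<Sum>j<m. col_term n (cov_resolvent n s (remove1 j [0..<m]) X) v (\<lambda>a. X (a, j))) / n + real m * (quad n ?R v / (1 + ntrace n ?R)) / n"
    by (simp add: sum_divide_distrib[symmetric] sum.distrib add_divide_distrib)
  finally show ?thesis unfolding defect_def by simp
qed

text \<open>Subtracting the equations for \<open>g\<close> and \<open>gh\<close> produces
  \<open>(g - gh) (s + \<alpha> z w)\<close>, whose second factor is at least
  \<open>s \<ge> 1\<close>, so an error in the equation bounds the error of the solution directly.
  The normalized trace \<open>gh\<close>, which solves a nonlinear equation, is compared first; with
  \<open>gh\<close> frozen, the equation for \<open>h\<close> is linear.\<close>

lemma fixed_point_stability:
  fixes g h gh k \<alpha> s :: real
  assumes s: "s \<ge> 1" and nn: "g > 0" "gh \<ge> 0" "k \<ge> 0" "\<alpha> \<ge> 0" and g: "s * g + \<alpha> * g / (1 + g) = 1"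
    and a: "\<bar>1 - s * gh - k * (gh / (1 + gh))\<bar> \<le> A" and b: "\<bar>1 - s * h - k * (h / (1 + gh))\<bar> \<le> B"
  shows "\<bar>h - g\<bar> \<le> B + \<bar>k - \<alpha>\<bar> + \<alpha> * (A + \<bar>k - \<alpha>\<bar>)"
proof -
  define z w where "z = 1 / (1 + g)" and "w = 1 / (1 + gh)"
  have p: "1 + g > 0" "1 + gh > 0" using nn by auto
  have zw: "0 \<le> z" "z \<le> 1" "0 \<le> w" "w \<le> 1" "0 \<le> gh * w" "gh * w \<le> 1"
    using nn p by (auto simp: z_def w_def divide_le_eq)
  have zmw: "z - w = (gh - g) * (z * w)" using p by (simp add: z_def w_def divide_simps)
  have xu: "g * z - gh * w = (g - gh) * (z * w)" using p by (simp add: z_def w_def divide_simps) (simp add: algebra_simps)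
  have g': "s * g + \<alpha> * (g * z) = 1" using g by (simp add: z_def)
  have a': "\<bar>1 - s * gh - k * (gh * w)\<bar> \<le> A" and b': "\<bar>1 - s * h - k * (h * w)\<bar> \<le> B"
    using a b by (simp_all add: w_def)
  have abs_add: "\<bar>X\<bar> \<le> C + E" if "X = Y + Z" "\<bar>Y\<bar> \<le> C" "\<bar>Z\<bar> \<le> E" for X Y Z C E :: real
    using that by linarith
  have shrink: "\<bar>d\<bar> \<le> C" if "\<bar>d * (s + q)\<bar> \<le> C" "0 \<le> q" for d q C :: real
  proof -
    have "\<bar>d\<bar> * 1 \<le> \<bar>d\<bar> * \<bar>s + q\<bar>" using s that by (intro mult_left_mono) auto
    then show ?thesis using that by (simp add: abs_mult)
  qed
  have zw1: "z * w \<le> 1" using zw by (simp add: mult_le_one)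
  have gle: "g \<le> 1"
  proof -
    have "1 * g \<le> s * g" using s nn by (intro mult_right_mono) auto
    moreover have "0 \<le> \<alpha> * (g * z)" using nn zw by simp
    ultimately show ?thesis using g' by linarith
  qed
  have 1: "\<bar>g - gh\<bar> \<le> A + \<bar>k - \<alpha>\<bar>"
  proof (rule shrink[OF abs_add[OF _ a']])
    have "(g - gh) * (s + \<alpha> * (z * w)) = s * g - s * gh + \<alpha> * ((g - gh) * (z * w))"
      by (simp add: algebra_simps)
    also have "\<dots> = (s * g + \<alpha> * (g * z)) - s * gh - \<alpha> * (gh * w)"
      unfolding xu[symmetric] by (simp add: algebra_simps)
    finally show "(g - gh) * (s + \<alpha> * (z * w)) = (1 - s * gh - k * (gh * w)) + (k - \<alpha>) * (gh * w)"
      unfolding g' by (simp add: algebra_simps)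
    have "\<bar>k - \<alpha>\<bar> * \<bar>gh * w\<bar> \<le> \<bar>k - \<alpha>\<bar> * 1" using zw by (intro mult_left_mono) auto
    then show "\<bar>(k - \<alpha>) * (gh * w)\<bar> \<le> \<bar>k - \<alpha>\<bar>" by (simp add: abs_mult)
    show "0 \<le> \<alpha> * (z * w)" using nn zw by simp
  qed
  have 2: "\<bar>\<alpha> * z - k * w\<bar> \<le> \<bar>k - \<alpha>\<bar> + \<alpha> * \<bar>g - gh\<bar>"
  proof (rule abs_add)
    have "\<alpha> * z - k * w = \<alpha> * (z - w) + (\<alpha> - k) * w" by (simp add: algebra_simps)
    then show "\<alpha> * z - k * w = (\<alpha> - k) * w + \<alpha> * ((gh - g) * (z * w))" unfolding zmw by simp
    have "\<bar>\<alpha> - k\<bar> * \<bar>w\<bar> \<le> \<bar>\<alpha> - k\<bar> * 1" using zw by (intro mult_left_mono) auto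
    then show "\<bar>(\<alpha> - k) * w\<bar> \<le> \<bar>k - \<alpha>\<bar>" by (simp add: abs_mult abs_minus_commute)
    have "\<bar>gh - g\<bar> * \<bar>z * w\<bar> \<le> \<bar>gh - g\<bar> * 1" using zw zw1 by (intro mult_left_mono) auto
    then have "\<bar>(gh - g) * (z * w)\<bar> \<le> \<bar>g - gh\<bar>" by (simp add: abs_mult abs_minus_commute)
    then have "\<alpha> * \<bar>(gh - g) * (z * w)\<bar> \<le> \<alpha> * \<bar>g - gh\<bar>" using nn by (intro mult_left_mono) auto
    then show "\<bar>\<alpha> * ((gh - g) * (z * w))\<bar> \<le> \<alpha> * \<bar>g - gh\<bar>" using nn by (simp only: abs_mult[of \<alpha>] abs_of_nonneg)
  qed
  have 3: "\<bar>g - h\<bar> \<le> B + (\<bar>k - \<alpha>\<bar> + \<alpha> * \<bar>g - gh\<bar>)"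
  proof (rule shrink[OF abs_add[OF _ b']])
    have "(g - h) * (s + k * w) = s * g - s * h + k * (g * w) - k * (h * w)" by (simp add: algebra_simps)
    also have "s * g = 1 - \<alpha> * (g * z)" using g' by linarith
    finally show "(g - h) * (s + k * w) = (1 - s * h - k * (h * w)) + (- g * (\<alpha> * z - k * w))"
      by (simp add: algebra_simps)
    have "\<bar>g\<bar> * \<bar>\<alpha> * z - k * w\<bar> \<le> 1 * (\<bar>k - \<alpha>\<bar> + \<alpha> * \<bar>g - gh\<bar>)"
      using nn gle by (intro mult_mono 2) auto
    then show "\<bar>- g * (\<alpha> * z - k * w)\<bar> \<le> \<bar>k - \<alpha>\<bar> + \<alpha> * \<bar>g - gh\<bar>" by (simp add: abs_mult)
    show "0 \<le> k * w" using nn zw by simp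
  qed
  have "\<alpha> * \<bar>g - gh\<bar> \<le> \<alpha> * (A + \<bar>k - \<alpha>\<bar>)" using 1 nn by (intro mult_left_mono) auto
  moreover have "\<bar>h - g\<bar> = \<bar>g - h\<bar>" by (rule abs_minus_commute)
  ultimately show ?thesis using 3 by linarith
qed

context iid_entries
begin

text \<open>The bound of \<open>fixed_point_stability\<close> with both errors equal to
  \<open>A\<close>, the square root of the bound on the second moment of the defect.\<close>

definition deviation :: "real \<Rightarrow> real \<Rightarrow> nat \<Rightarrow> nat \<Rightarrow> real" where
  "deviation s \<alpha> n m = (let k = real m / real n; A = sqrt (k * (rate s k / sqrt n)) in
     A + \<bar>k - \<alpha>\<bar> + \<alpha> * (A + \<bar>k - \<alpha>\<bar>))"

lemma deviation_tendsto:
  assumes "(\<lambda>n. real (m n) / real n) \<longlonglongrightarrow> \<alpha>"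
  shows "(\<lambda>n. deviation s \<alpha> n (m n)) \<longlonglongrightarrow> 0"
proof -
  have "(\<lambda>n. inverse (sqrt (real n))) \<longlonglongrightarrow> 0"
    by (intro tendsto_inverse_0_at_top filterlim_compose[OF sqrt_at_top] filterlim_real_sequentially)
  then have "(\<lambda>n. (let k = real (m n) / real n; A = sqrt (k * (rate s k * inverse (sqrt n))) in
     A + \<bar>k - \<alpha>\<bar> + \<alpha> * (A + \<bar>k - \<alpha>\<bar>))) \<longlonglongrightarrow>
     sqrt (\<alpha> * (rate s \<alpha> * 0)) + \<bar>\<alpha> - \<alpha>\<bar> + \<alpha> * (sqrt (\<alpha> * (rate s \<alpha> * 0)) + \<bar>\<alpha> - \<alpha>\<bar>)"
    unfolding Let_def rate_def by (intro tendsto_intros assms)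
  then show ?thesis unfolding deviation_def by (simp add: divide_inverse)
qed

lemma measurable_defect_cov:
  assumes "{..<n} \<times> {..<m} \<subseteq> I" "set js \<subseteq> {..<m}"
  shows "(\<lambda>X. defect n s k (cov_resolvent n s js X) v) \<in> borel_measurable (Pi_D I)"
  by (intro measurable_defect measurable_cov_resolvent borel_measurable_const) (use assms in \<open>auto intro!: coord_measurable\<close>)

lemma defect_bound:
  assumes "s \<ge> 1" "n \<ge> 1" "ip n v v = 1" "k \<ge> 0"
  shows "\<bar>defect n s k (cov_resolvent n s js X) v\<bar> \<le> 1 + k"
proof -
  have s0: "s > 0" using assms by simp
  let ?r = "cov_resolvent n s js X"
  note c = contractive_cov_resolvent[OF s0, of n js X]
  have h: "0 \<le> quad n ?r v" "s * quad n ?r v \<le> 1" "0 \<le> ntrace n ?r"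
    using contractive_nonneg[OF c s0, of v] contractive_form[OF c s0, of v] trc_nonneg[OF c s0] assms
    by (auto simp: quad_def ntrace_def)
  have "1 * quad n ?r v \<le> s * quad n ?r v" using h assms by (intro mult_right_mono) auto
  then have "quad n ?r v \<le> 1" using h by simp
  then have d: "0 \<le> quad n ?r v / (1 + ntrace n ?r)" "quad n ?r v / (1 + ntrace n ?r) \<le> 1" using h by (auto simp: divide_le_eq)
  have "0 \<le> k * (quad n ?r v / (1 + ntrace n ?r))" using assms d by (intro mult_nonneg_nonneg) auto
  moreover have "k * (quad n ?r v / (1 + ntrace n ?r)) \<le> k * 1" using assms d by (intro mult_left_mono) auto
  moreover have "0 \<le> s * quad n ?r v" using s0 h by simp
  ultimately show ?thesis unfolding defect_def using h by linarith
qed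

text \<open>One factor of the square is kept as \<open>F\<close>, the other is expanded over the
  columns. In the summand of column \<open>j\<close>, Fubini puts the integral over that column
  innermost, where the one-column estimate applies with all other columns fixed.\<close>

lemma defect_L2:
  assumes s: "s \<ge> 1" and n: "n \<ge> 1" and v: "ip n v v = 1"
  shows "(\<integral>X. (defect n s (real m / real n) (cov_resolvent n s [0..<m] X) v)\<^sup>2 \<partial>Pi_D ({..<n} \<times> {..<m}))
    \<le> real m / real n * (rate s (real m / real n) / sqrt n)"
proof -
  let ?I = "{..<n} \<times> {..<m}" and ?k = "real m / real n"
  let ?F = "\<lambda>X. defect n s ?k (cov_resolvent n s [0..<m] X) v"
  let ?T = "\<lambda>j X. col_term n (cov_resolvent n s (remove1 j [0..<m]) X) v (\<lambda>a. X (a, j))"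
  have s0: "s > 0" and k0: "?k \<ge> 0" using s by auto
  have Fm: "?F \<in> borel_measurable (Pi_D ?I)" by (rule measurable_defect_cov) auto
  have Tm: "?T j \<in> borel_measurable (Pi_D ?I)" if "j < m" for j
    by (intro measurable_col_term measurable_cov_resolvent borel_measurable_const)
       (use that in \<open>auto intro!: coord_measurable dest: set_remove1_subset[THEN subsetD]\<close>)
  have cc: "contractive_ker n s (rank1_update n (cov_resolvent n s js X) (scaled n x))" for js X x
    using contractive_ker_resolvent[OF s0, of n "scaled n x # columns n js X"] by (simp add: cov_resolvent_def)
  note ctb = col_term_bound(3)[OF contractive_cov_resolvent[OF s0] s n v k0 cc]
  \<comment> \<open>Fubini needs integrability of the product: \<open>F\<close> is bounded and the
    column term is at most the squared norm of the column plus 1.\<close>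
  have int: "integrable (Pi_D ?I) (\<lambda>X. ?F X * ?T j X)" if j: "j < m" for j
  proof (rule Bochner_Integration.integrable_bound)
    have "integrable (Pi_D ?I) (\<lambda>X. \<Sum>a<n. X (a, j) * X (a, j))"
      using j by (intro Bochner_Integration.integrable_sum moment_2) auto
    then show "integrable (Pi_D ?I) (\<lambda>X. (1 + ?k) * (ip n (\<lambda>a. X (a, j)) (\<lambda>a. X (a, j)) + 1))"
      unfolding ip_def using prob_space.finite_measure[OF prob_space_Pi_D, of ?I]
      by (intro integrable_mult_right Bochner_Integration.integrable_add finite_measure.integrable_const)
    show "AE X in Pi_D ?I. norm (?F X * ?T j X) \<le> norm ((1 + ?k) * (ip n (\<lambda>a. X (a, j)) (\<lambda>a. X (a, j)) + 1))"
    proof (intro AE_I2)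
      fix X
      have "\<bar>?F X * ?T j X\<bar> \<le> (1 + ?k) * (ip n (\<lambda>a. X (a, j)) (\<lambda>a. X (a, j)) + 1)"
        unfolding abs_mult using k0 by (intro mult_mono defect_bound s n v ctb) auto
      then show "norm (?F X * ?T j X) \<le> norm ((1 + ?k) * (ip n (\<lambda>a. X (a, j)) (\<lambda>a. X (a, j)) + 1))"
        unfolding real_norm_def by (rule order_trans[OF _ abs_ge_self])
    qed
  qed (use Fm Tm[OF j] in auto)
  have bound: "\<bar>\<integral>X. ?F X * ?T j X \<partial>Pi_D ?I\<bar> \<le> rate s ?k / sqrt n" if j: "j < m" for j
  proof -
    let ?J = "{..<n} \<times> {j}" and ?K = "{..<n} \<times> ({..<m} - {j})"
    let ?js = "remove1 j [0..<m]"
    have un: "?K \<union> ?J = ?I" and dj: "?K \<inter> ?J = {}" using j by auto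
    have "(\<integral>X. ?F X * ?T j X \<partial>Pi_D ?I) = (\<integral>Y. (\<integral>x. ?F (merge ?K ?J (Y, x)) * ?T j (merge ?K ?J (Y, x)) \<partial>Pi_D ?J) \<partial>Pi_D ?K)"
      using P.product_integral_fold[of ?K ?J "\<lambda>X. ?F X * ?T j X"] int[OF j] dj unfolding un by simp
    also have "\<bar>\<dots>\<bar> \<le> rate s ?k / sqrt n"
    proof (rule prob_space.abs_integral_le_const[OF prob_space_Pi_D])
      fix Y
      let ?r = "cov_resolvent n s ?js Y"
      have r: "cov_resolvent n s ?js (merge ?K ?J (Y, x)) a b = ?r a b" if "a < n" "b < n" for x a b
      proof (rule cov_resolvent_cong[OF _ that])
        fix a i assume "a < n" "i \<in> set ?js"
        then show "merge ?K ?J (Y, x) (a, i) = Y (a, i)" by (auto simp: merge_def)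
      qed
      have x: "merge ?K ?J (Y, x) (a, j) = x (a, j)" if "a < n" for x a using that by (simp add: merge_def)
      have T: "?T j (merge ?K ?J (Y, x)) = col_term n ?r v (col j x)" for x
        by (rule col_term_cong) (auto simp: r x col_def)
      \<comment> \<open>Column \<open>j\<close> is moved to the front of the list, so that
        \<open>F\<close> depends on it through a single update of a resolvent that is constant in
        the inner integral.\<close>
      have F: "?F (merge ?K ?J (Y, x)) = defect n s ?k (rank1_update n ?r (scaled n (col j x))) v" for x
      proof (rule defect_cong)
        fix a b assume ab: "a < n" "b < n"
        have "cov_resolvent n s [0..<m] (merge ?K ?J (Y, x)) a b =
            rank1_update n (cov_resolvent n s ?js (merge ?K ?J (Y, x))) (scaled n (\<lambda>a. merge ?K ?J (Y, x) (a, j))) a b"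
          using j s0 ab by (intro cov_resolvent_remove) auto
        also have "\<dots> = rank1_update n ?r (scaled n (col j x)) a b"
          using ab by (intro rank1_update_cong r) (auto simp: scaled_def x col_def)
        finally show "cov_resolvent n s [0..<m] (merge ?K ?J (Y, x)) a b = rank1_update n ?r (scaled n (col j x)) a b" .
      qed
      show "\<bar>\<integral>x. ?F (merge ?K ?J (Y, x)) * ?T j (merge ?K ?J (Y, x)) \<partial>Pi_D ?J\<bar> \<le> rate s ?k / sqrt n"
        unfolding F T by (rule column_expectation[OF contractive_cov_resolvent[OF s0] s n v k0 cc])
    qed
    finally show ?thesis .
  qed
  have "(\<integral>X. (?F X)\<^sup>2 \<partial>Pi_D ?I) = (\<integral>X. (\<Sum>j<m. ?F X * ?T j X) / n \<partial>Pi_D ?I)"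
  proof (intro Bochner_Integration.integral_cong refl)
    fix X
    have "(?F X)\<^sup>2 = ?F X * ((\<Sum>j<m. ?T j X) / n)"
      unfolding power2_eq_square by (subst (2) defect_decomposition[OF s0 n v]) simp
    then show "(?F X)\<^sup>2 = (\<Sum>j<m. ?F X * ?T j X) / n" by (simp add: sum_distrib_left)
  qed
  also have "\<dots> = (\<Sum>j<m. \<integral>X. ?F X * ?T j X \<partial>Pi_D ?I) / n"
    using int by (simp add: Bochner_Integration.integral_sum)
  also have "\<dots> \<le> (\<Sum>j<m. rate s ?k / sqrt n) / n"
    using bound by (intro divide_right_mono sum_mono) (auto simp: abs_le_iff)
  also have "\<dots> = ?k * (rate s ?k / sqrt n)" by simp
  finally show ?thesis .
qed

text \<open>The defects of all vectors share the denominator \<open>1 + g\<close>. Averaging them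
  over the coordinate vectors therefore gives the defect of the normalized trace, which closes the
  system of equations for \<open>h\<close> and \<open>g\<close>.\<close>

lemma quad_L1:
  assumes s: "s \<ge> 1" and n: "n \<ge> 1" and v: "ip n v v = 1" and a: "\<alpha> \<ge> 0"
    and g: "g > 0" "s * g + \<alpha> * g / (1 + g) = 1"
  shows "(\<integral>X. \<bar>quad n (cov_resolvent n s [0..<m] X) v - g\<bar> \<partial>Pi_D ({..<n} \<times> {..<m})) \<le> deviation s \<alpha> n m"
    and "\<And>X. \<bar>quad n (cov_resolvent n s [0..<m] X) v\<bar> \<le> 1"
proof -
  let ?I = "{..<n} \<times> {..<m}"
  define k where "k = real m / real n"
  let ?R = "\<lambda>X. cov_resolvent n s [0..<m] X"
  interpret PI: prob_space "Pi_D ?I" by (rule prob_space_Pi_D)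
  have s0: "s > 0" and k0: "k \<ge> 0" using s by (auto simp: k_def)
  define A where "A = sqrt (k * (rate s k / sqrt n))"
  define e where "e i = (\<lambda>a. if a = i then 1 else (0::real))" for i :: nat
  have e1: "ip n (e i) (e i) = 1" if "i < n" for i
    using sum_delta_mult(1)[OF that, of "\<lambda>a. if a = i then 1 else 0"] by (simp add: ip_def e_def)
  have qe: "quad n r (e i) = r i i" if "i < n" for r i
    using that by (simp add: quad_def ip_def app_def e_def sum_delta_mult)
  have Fm: "(\<lambda>X. defect n s k (?R X) u) \<in> borel_measurable (Pi_D ?I)" for u by (rule measurable_defect_cov) auto
  have Fi: "integrable (Pi_D ?I) (\<lambda>X. defect n s k (?R X) u)" "integrable (Pi_D ?I) (\<lambda>X. (defect n s k (?R X) u)\<^sup>2)"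
    "integrable (Pi_D ?I) (\<lambda>X. \<bar>defect n s k (?R X) u\<bar>)"
    "(\<integral>X. \<bar>defect n s k (?R X) u\<bar> \<partial>Pi_D ?I) \<le> A" if u: "ip n u u = 1" for u
  proof -
    have b: "\<bar>defect n s k (?R X) u\<bar> \<le> 1 + k" for X by (rule defect_bound[OF s n u k0])
    show i: "integrable (Pi_D ?I) (\<lambda>X. defect n s k (?R X) u)"
      by (rule PI.integrable_const_bound[where B = "1 + k"]) (use b Fm in auto)
    then show "integrable (Pi_D ?I) (\<lambda>X. \<bar>defect n s k (?R X) u\<bar>)" by simp
    show i2: "integrable (Pi_D ?I) (\<lambda>X. (defect n s k (?R X) u)\<^sup>2)"
    proof (rule PI.integrable_const_bound[where B = "(1 + k)\<^sup>2"])
      show "AE X in Pi_D ?I. norm ((defect n s k (?R X) u)\<^sup>2) \<le> (1 + k)\<^sup>2"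
        using b power_mono[OF b, of _ 2] by (intro AE_I2) simp
    qed (use Fm in auto)
    show "(\<integral>X. \<bar>defect n s k (?R X) u\<bar> \<partial>Pi_D ?I) \<le> A"
      unfolding A_def by (rule PI.abs_mean_le_sqrt[OF i i2]) (use defect_L2[OF s n u] in \<open>simp add: k_def\<close>)
  qed
  define H where "H X = (\<Sum>i<n. \<bar>defect n s k (?R X) (e i)\<bar>) / n" for X
  have Hi: "integrable (Pi_D ?I) H" unfolding H_def[abs_def] using Fi(3)[OF e1] by (intro integrable_divide Bochner_Integration.integrable_sum) auto
  have HA: "(\<integral>X. H X \<partial>Pi_D ?I) \<le> A"
  proof -
    have "(\<integral>X. H X \<partial>Pi_D ?I) = (\<Sum>i<n. \<integral>X. \<bar>defect n s k (?R X) (e i)\<bar> \<partial>Pi_D ?I) / n"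
      unfolding H_def using Fi(3)[OF e1] by (simp add: Bochner_Integration.integral_sum)
    also have "\<dots> \<le> (\<Sum>i<n. A) / n" using Fi(4)[OF e1] by (intro divide_right_mono sum_mono) auto
    also have "\<dots> = A" using n by simp
    finally show ?thesis .
  qed
  have gn: "0 \<le> ntrace n (?R X)" for X
    unfolding ntrace_def using trc_nonneg[OF contractive_cov_resolvent[OF s0] s0] by simp
  have ptw: "\<bar>quad n (?R X) v - g\<bar> \<le> \<bar>defect n s k (?R X) v\<bar> + \<bar>k - \<alpha>\<bar> + \<alpha> * (H X + \<bar>k - \<alpha>\<bar>)" for X
  proof (rule fixed_point_stability[OF s g(1) gn k0 a g(2)])
    have "(\<Sum>i<n. defect n s k (?R X) (e i)) = (\<Sum>i<n. 1 - s * ?R X i i - k / (1 + ntrace n (?R X)) * ?R X i i)"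
      using qe by (intro sum.cong) (auto simp: defect_def)
    also have "\<dots> = n - s * trc n (?R X) - k / (1 + ntrace n (?R X)) * trc n (?R X)"
      by (simp only: sum_subtractf sum_distrib_left[symmetric] trc_def) simp
    finally have "(\<Sum>i<n. defect n s k (?R X) (e i)) / n = 1 - s * ntrace n (?R X) - k * (ntrace n (?R X) / (1 + ntrace n (?R X)))"
      using n by (simp add: diff_divide_distrib ntrace_def)
    moreover have "\<bar>(\<Sum>i<n. defect n s k (?R X) (e i)) / n\<bar> \<le> H X"
      unfolding H_def abs_divide by (simp add: divide_right_mono sum_abs)
    ultimately show "\<bar>1 - s * ntrace n (?R X) - k * (ntrace n (?R X) / (1 + ntrace n (?R X)))\<bar> \<le> H X" by simp
  qed (simp add: defect_def)
  show qb: "\<bar>quad n (?R X) v\<bar> \<le> 1" for X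
  proof -
    note c = contractive_cov_resolvent[OF s0, of n "[0..<m]" X]
    have h: "0 \<le> quad n (?R X) v" "s * quad n (?R X) v \<le> 1"
      using contractive_nonneg[OF c s0, of v] contractive_form[OF c s0, of v] v by (auto simp: quad_def)
    have "1 * quad n (?R X) v \<le> s * quad n (?R X) v" using h s by (intro mult_right_mono) auto
    then show ?thesis using h by simp
  qed
  have qm: "(\<lambda>X. quad n (?R X) v) \<in> borel_measurable (Pi_D ?I)"
    by (intro measurable_quad measurable_cov_resolvent borel_measurable_const) (auto intro!: coord_measurable)
  have qi: "integrable (Pi_D ?I) (\<lambda>X. quad n (?R X) v)"
    by (rule PI.integrable_const_bound[where B = 1]) (use qb qm in auto)
  have "(\<integral>X. \<bar>quad n (?R X) v - g\<bar> \<partial>Pi_D ?I) \<le> (\<integral>X. \<bar>defect n s k (?R X) v\<bar> + \<bar>k - \<alpha>\<bar> + \<alpha> * (H X + \<bar>k - \<alpha>\<bar>) \<partial>Pi_D ?I)"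
    using qi Fi(3)[OF v] Hi by (intro integral_mono ptw) auto
  also have "\<dots> = (\<integral>X. \<bar>defect n s k (?R X) v\<bar> \<partial>Pi_D ?I) + \<bar>k - \<alpha>\<bar> + \<alpha> * ((\<integral>X. H X \<partial>Pi_D ?I) + \<bar>k - \<alpha>\<bar>)"
    using Fi(3)[OF v] Hi by (simp add: PI.prob_space)
  also have "\<dots> \<le> A + \<bar>k - \<alpha>\<bar> + \<alpha> * (A + \<bar>k - \<alpha>\<bar>)"
    using Fi(4)[OF v] HA a by (intro add_mono mult_left_mono) auto
  also have "\<dots> = deviation s \<alpha> n m" by (simp add: deviation_def Let_def A_def k_def)
  finally show "(\<integral>X. \<bar>quad n (?R X) v - g\<bar> \<partial>Pi_D ?I) \<le> deviation s \<alpha> n m" .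
qed

end

section \<open>The spiked covariance matrix\<close>

lemma index_mult_mat_sum:
  assumes "A \<in> carrier_mat n l" "B \<in> carrier_mat l p" "i < n" "j < p"
  shows "(A * B) $$ (i, j) = (\<Sum>k<l. A $$ (i, k) * B $$ (k, j))"
  using assms by (auto simp: scalar_prod_def atLeast0LessThan intro!: sum.cong)

lemma index_mult_mat_vec_sum:
  assumes "A \<in> carrier_mat n l" "w \<in> carrier_vec l" "i < n"
  shows "(A *\<^sub>v w) $ i = (\<Sum>k<l. A $$ (i, k) * w $ k)"
  using assms by (auto simp: scalar_prod_def atLeast0LessThan intro!: sum.cong)

lemma scalar_prod_ip: "v \<in> carrier_vec n \<Longrightarrow> w \<in> carrier_vec n \<Longrightarrow> scalar_prod v w = ip n (($) v) (($) w)"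
  by (simp add: scalar_prod_def ip_def atLeast0LessThan)

lemma diag_sum_commute:
  fixes A B :: "real mat"
  assumes "A \<in> carrier_mat n n" "B \<in> carrier_mat n n"
  shows "(\<Sum>i<n. (A * B) $$ (i, i)) = (\<Sum>i<n. (B * A) $$ (i, i))"
proof -
  have "(\<Sum>i<n. (A * B) $$ (i, i)) = (\<Sum>i<n. \<Sum>k<n. A $$ (i, k) * B $$ (k, i))"
    using assms by (intro sum.cong refl index_mult_mat_sum) auto
  also have "\<dots> = (\<Sum>k<n. \<Sum>i<n. B $$ (k, i) * A $$ (i, k))"
    by (subst sum.swap) (simp add: mult.commute)
  also have "\<dots> = (\<Sum>k<n. (B * A) $$ (k, k))"
    using assms by (intro sum.cong refl index_mult_mat_sum[symmetric]) auto
  finally show ?thesis .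
qed

text \<open>By Schur decomposition \<open>A - 1\<close> is similar to \<open>T - 1\<close> with
  \<open>T\<close> upper triangular. Cyclicity of the trace removes the change of basis, and the
  diagonal of the square of a triangular matrix consists of the squares of its diagonal.\<close>

lemma trace_shifted_square:
  fixes A :: "real mat"
  assumes A: "A \<in> carrier_mat n n" and c: "char_poly A = (\<Prod>e\<leftarrow>es. [:- e, 1:])" and len: "length es = n"
  shows "(\<Sum>i<n. ((A - 1\<^sub>m n) * (A - 1\<^sub>m n)) $$ (i, i)) = (\<Sum>i<n. (es ! i - 1)\<^sup>2)"
proof -
  obtain T P Q where "schur_decomposition A es = (T, P, Q)" by (metis prod_cases3)
  from schur_decomposition[OF A c this]
  have w: "similar_mat_wit A T P Q" and ut: "upper_triangular T" and dg: "diag_mat T = es" by auto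
  note w = similar_mat_witD2[OF A w]
  define T1 where "T1 = T - 1\<^sub>m n"
  define A1 where "A1 = A - 1\<^sub>m n"
  have cT: "T1 \<in> carrier_mat n n" and cA: "A1 \<in> carrier_mat n n" using w by (auto simp: T1_def A1_def)
  have A1: "A1 = P * T1 * Q"
  proof -
    have "P * T1 * Q = (P * T - P * 1\<^sub>m n) * Q"
      unfolding T1_def using w by (subst mult_minus_distrib_mat[of P n n T n]) auto
    also have "\<dots> = P * T * Q - P * Q" using w by (subst minus_mult_distrib_mat[of _ n n _ _ n]) auto
    finally show ?thesis unfolding A1_def using w by simp
  qed
  have QA: "Q * A1 = T1 * Q"
  proof -
    have "Q * A1 = (Q * P) * (T1 * Q)"
    proof -
      have "A1 = P * (T1 * Q)" unfolding A1 using w cT by (intro assoc_mult_mat) auto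
      moreover have "Q * (P * (T1 * Q)) = (Q * P) * (T1 * Q)"
        using w cT by (intro assoc_mult_mat[symmetric]) auto
      ultimately show ?thesis by simp
    qed
    then show ?thesis using w cT by simp
  qed
  have "A1 * A1 = (P * T1) * (Q * A1)"
    using w cT cA by (subst (1) A1) (simp add: assoc_mult_mat[of _ n n _ n _ n])
  then have "(\<Sum>i<n. (A1 * A1) $$ (i, i)) = (\<Sum>i<n. ((P * T1) * (T1 * Q)) $$ (i, i))" unfolding QA by simp
  also have "\<dots> = (\<Sum>i<n. ((T1 * Q) * (P * T1)) $$ (i, i))" using w cT by (intro diag_sum_commute) auto
  also have "(T1 * Q) * (P * T1) = T1 * ((Q * P) * T1)"
    using w(4-7) cT by (simp add: assoc_mult_mat[of _ n n _ n _ n])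
  also have "\<dots> = T1 * T1" using w cT by simp
  also have "(\<Sum>i<n. (T1 * T1) $$ (i, i)) = (\<Sum>i<n. (es ! i - 1)\<^sup>2)"
  proof (intro sum.cong refl)
    fix i assume i: "i \<in> {..<n}"
    have off: "T1 $$ (i, k) * T1 $$ (k, i) = (if k = i then (T1 $$ (i, i))\<^sup>2 else 0)" if "k < n" for k
    proof (cases k i rule: linorder_cases)
      case less
      then have "T $$ (i, k) = 0" using ut i w by (auto simp: upper_triangular_def)
      then show ?thesis using less i that w by (simp add: T1_def)
    next
      case greater
      then have "T $$ (k, i) = 0" using ut that w by (auto simp: upper_triangular_def)
      then show ?thesis using greater i that w by (simp add: T1_def)
    qed (simp add: power2_eq_square)
    have "(T1 * T1) $$ (i, i) = (\<Sum>k<n. T1 $$ (i, k) * T1 $$ (k, i))" using cT i by (intro index_mult_mat_sum) auto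
    also have "\<dots> = (\<Sum>k<n. if k = i then (T1 $$ (i, i))\<^sup>2 else 0)" using off by (intro sum.cong) auto
    also have "\<dots> = (T1 $$ (i, i))\<^sup>2" using i by simp
    also have "T1 $$ (i, i) = es ! i - 1"
      using i w unfolding dg[symmetric] by (auto simp: T1_def diag_mat_def)
    finally show "(T1 * T1) $$ (i, i) = (es ! i - 1)\<^sup>2" .
  qed
  finally show ?thesis by (simp add: A1_def)
qed

text \<open>The Frobenius norm of \<open>\<Sigma> - I - (\<theta> - 1) v v\<^sup>T\<close> is computed from the traces of \<open>(\<Sigma> - I)\<^sup>2\<close> and \<open>(\<Sigma> - I) v v\<^sup>T\<close>, and
  vanishes.\<close>

lemma spiked_matrix_form:
  fixes \<Sigma> :: "real mat"
  assumes S: "\<Sigma> \<in> carrier_mat n n" "transpose_mat \<Sigma> = \<Sigma>" "has_eigenvalues \<Sigma> (\<theta> # replicate (n - 1) 1)"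
    and n: "n \<ge> 1" and v: "v \<in> carrier_vec n" "scalar_prod v v = 1" "eigenvector \<Sigma> v \<theta>"
    and ij: "i < n" "j < n"
  shows "\<Sigma> $$ (i, j) = (if i = j then 1 else 0) + (\<theta> - 1) * v $ i * v $ j"
proof -
  define E where "E i j = \<Sigma> $$ (i, j) - (if i = j then 1 else 0)" for i j
  define t where "t = \<theta> - 1"
  have Eidx: "(\<Sigma> - 1\<^sub>m n) $$ (i, j) = E i j" if "i < n" "j < n" for i j using S that by (simp add: E_def)
  have sym: "E i j = E j i" if "i < n" "j < n" for i j
  proof -
    have "\<Sigma> $$ (j, i) = transpose_mat \<Sigma> $$ (i, j)" using S(1) that by simp
    then show ?thesis using S(2) by (simp add: E_def)
  qed
  have "(\<Sum>i<n. ((\<Sigma> - 1\<^sub>m n) * (\<Sigma> - 1\<^sub>m n)) $$ (i, i)) = (\<Sum>i<n. ((\<theta> # replicate (n - 1) 1) ! i - 1)\<^sup>2)"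
    using S n by (intro trace_shifted_square) (auto simp: has_eigenvalues_def)
  also have "\<dots> = (\<Sum>i<n. if i = 0 then t\<^sup>2 else 0)"
    by (intro sum.cong refl) (auto simp: t_def nth_Cons')
  also have "\<dots> = t\<^sup>2" using n by simp
  also have "(\<Sum>i<n. ((\<Sigma> - 1\<^sub>m n) * (\<Sigma> - 1\<^sub>m n)) $$ (i, i)) = (\<Sum>i<n. \<Sum>k<n. (E i k)\<^sup>2)"
  proof (intro sum.cong refl)
    fix i assume i: "i \<in> {..<n}"
    have "((\<Sigma> - 1\<^sub>m n) * (\<Sigma> - 1\<^sub>m n)) $$ (i, i) = (\<Sum>k<n. (\<Sigma> - 1\<^sub>m n) $$ (i, k) * (\<Sigma> - 1\<^sub>m n) $$ (k, i))"
      using S i by (intro index_mult_mat_sum) auto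
    also have "\<dots> = (\<Sum>k<n. (E i k)\<^sup>2)"
    proof (intro sum.cong refl)
      fix k assume k: "k \<in> {..<n}"
      show "(\<Sigma> - 1\<^sub>m n) $$ (i, k) * (\<Sigma> - 1\<^sub>m n) $$ (k, i) = (E i k)\<^sup>2"
        using Eidx[of i k] Eidx[of k i] sym[of i k] i k by (simp only: lessThan_iff power2_eq_square)
    qed
    finally show "((\<Sigma> - 1\<^sub>m n) * (\<Sigma> - 1\<^sub>m n)) $$ (i, i) = (\<Sum>k<n. (E i k)\<^sup>2)" .
  qed
  finally have EE: "(\<Sum>i<n. \<Sum>k<n. (E i k)\<^sup>2) = t\<^sup>2" .
  have vv: "(\<Sum>i<n. v $ i * v $ i) = 1" using v by (simp add: scalar_prod_ip[OF v(1) v(1)] ip_def)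
  have Ev: "(\<Sum>k<n. E i k * v $ k) = t * v $ i" if i: "i < n" for i
  proof -
    have "(\<Sigma> *\<^sub>v v) $ i = \<theta> * v $ i" using v(3) S i v(1) by (simp add: eigenvector_def)
    then have "(\<Sum>k<n. \<Sigma> $$ (i, k) * v $ k) = \<theta> * v $ i" using index_mult_mat_vec_sum[OF S(1) v(1) i] by simp
    moreover have "(\<Sum>k<n. (if i = k then 1 else 0) * v $ k) = v $ i" using i by (rule sum_delta_mult)
    ultimately show ?thesis by (simp add: E_def t_def left_diff_distrib sum_subtractf)
  qed
  \<comment> \<open>By the trace of the square, the eigenvector equation and \<open>|v| = 1\<close>,
    the three terms of the expansion are \<open>t^2 - 2 t * t + t^2\<close>.\<close>
  have "(\<Sum>i<n. \<Sum>k<n. (E i k - t * v $ i * v $ k)\<^sup>2) =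
      (\<Sum>i<n. \<Sum>k<n. (E i k)\<^sup>2 - 2 * t * (v $ i * (E i k * v $ k)) + t\<^sup>2 * ((v $ i * v $ i) * (v $ k * v $ k)))"
    by (intro sum.cong refl) (simp add: power2_eq_square algebra_simps)
  also have "\<dots> = (\<Sum>i<n. \<Sum>k<n. (E i k)\<^sup>2) - 2 * t * (\<Sum>i<n. v $ i * (\<Sum>k<n. E i k * v $ k))
      + t\<^sup>2 * (\<Sum>i<n. (v $ i * v $ i) * (\<Sum>k<n. v $ k * v $ k))"
    by (simp only: sum.distrib sum_subtractf sum_distrib_left)
  also have "(\<Sum>i<n. v $ i * (\<Sum>k<n. E i k * v $ k)) = (\<Sum>i<n. t * (v $ i * v $ i))"
    using Ev by (intro sum.cong refl) simp
  also have "\<dots> = t" using vv by (simp add: sum_distrib_left[symmetric])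
  finally have "(\<Sum>i<n. \<Sum>k<n. (E i k - t * v $ i * v $ k)\<^sup>2) = 0"
    unfolding EE vv by (simp add: vv power2_eq_square)
  then have "(E i j - t * v $ i * v $ j)\<^sup>2 = 0"
    using ij by (simp add: sum_nonneg_eq_0_iff sum_nonneg)
  then show ?thesis by (simp add: E_def t_def)
qed

section \<open>The spike as a rank-one operator and its square root\<close>

lemma app_diff: "app n r (\<lambda>i. u i - w i) i = app n r u i - app n r w i"
  by (simp add: app_def algebra_simps sum_subtractf)

lemma app_add: "app n r (\<lambda>i. u i + w i) i = app n r u i + app n r w i"
  by (simp add: app_def algebra_simps sum.distrib)

lemma app_scale: "app n r (\<lambda>i. c * w i) i = c * app n r w i"
  by (simp add: app_def algebra_simps sum_distrib_left)

lemma app_app: "app n r (app n r' w) i = (\<Sum>b<n. (\<Sum>a<n. r i a * r' a b) * w b)"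
proof -
  have "app n r (app n r' w) i = (\<Sum>a<n. \<Sum>b<n. r i a * r' a b * w b)"
    by (simp add: app_def sum_distrib_left mult.assoc)
  then show ?thesis by (subst (asm) sum.swap) (simp add: sum_distrib_right)
qed

text \<open>The operator \<open>1 + c v v\<^sup>T\<close>. For a unit vector \<open>v\<close> it is
  \<Sigma> when \<open>c = \<theta> - 1\<close> and its square root when
  \<open>c = sqrt \<theta> - 1\<close>.\<close>

definition spike_map :: "nat \<Rightarrow> real \<Rightarrow> (nat \<Rightarrow> real) \<Rightarrow> (nat \<Rightarrow> real) \<Rightarrow> nat \<Rightarrow> real" where
  "spike_map n c v w = (\<lambda>i. w i + c * ip n v w * v i)"

lemma app_spike:
  assumes "\<And>j. j < n \<Longrightarrow> r i j = (if i = j then 1 else 0) + c * v i * v j" "i < n"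
  shows "app n r w i = spike_map n c v w i"
proof -
  have "app n r w i = (\<Sum>j<n. (if i = j then 1 else 0) * w j + c * v i * (v j * w j))"
    unfolding app_def using assms by (intro sum.cong) (auto simp: algebra_simps)
  also have "\<dots> = w i + c * v i * ip n v w"
    using assms(2) by (simp only: sum.distrib sum_delta_mult sum_distrib_left[symmetric] ip_def)
  finally show ?thesis by (simp add: spike_map_def)
qed

text \<open>The square root is a definite description, so uniqueness has to be shown as well. An
  admissible \<open>B\<close> must be 1 on the orthogonal complement of \<open>v\<close> and
  \<open>sqrt \<theta>\<close> on \<open>v\<close>: for \<theta> > 0, a deviation would be an
  eigenvector for a negative eigenvalue.\<close>

lemma mat_sqrt_spiked:
  fixes \<Sigma> :: "real mat"
  assumes S: "\<Sigma> \<in> carrier_mat n n" and th: "\<theta> \<ge> 0"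
    and form: "\<And>i j. i < n \<Longrightarrow> j < n \<Longrightarrow> \<Sigma> $$ (i, j) = (if i = j then 1 else 0) + (\<theta> - 1) * v $ i * v $ j"
    and v: "v \<in> carrier_vec n" "ip n (($) v) (($) v) = 1"
  shows "mat_sqrt \<Sigma> = mat n n (\<lambda>(i, j). (if i = j then 1 else 0) + (sqrt \<theta> - 1) * v $ i * v $ j)" (is "_ = ?B")
proof -
  let ?v = "($) v"
  let ?c = "sqrt \<theta> - 1"
  define e where "e B = (\<lambda>i j. B $$ (i, j))" for B :: "real mat"
  have mv: "(B *\<^sub>v vec n w) $ i = app n (e B) w i" if "B \<in> carrier_mat n n" "i < n" for B w i
    using that by (subst index_mult_mat_vec_sum[of B n n]) (auto simp: app_def e_def)
  have eSig: "app n (e \<Sigma>) w i = spike_map n (\<theta> - 1) ?v w i" if "i < n" for w i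
    using form that by (intro app_spike) (auto simp: e_def)
  have sq: "app n (e B) (app n (e B) w) i = spike_map n (\<theta> - 1) ?v w i" if B: "B \<in> carrier_mat n n" "B * B = \<Sigma>" and i: "i < n" for B w i
  proof -
    have "app n (e B) (app n (e B) w) i = (\<Sum>b<n. (B * B) $$ (i, b) * w b)"
      unfolding app_app e_def using B(1) i by (intro sum.cong refl) (simp add: index_mult_mat_sum[OF B(1) B(1)] del: index_mult_mat)
    also have "\<dots> = app n (e \<Sigma>) w i" unfolding B(2) app_def e_def ..
    finally show ?thesis using eSig[OF i] by simp
  qed
  have BB: "?B \<in> carrier_mat n n" by simp
  have eB: "app n (e ?B) w i = spike_map n ?c ?v w i" if "i < n" for w i
    using that by (intro app_spike) (auto simp: e_def)
  show ?thesis
    unfolding mat_sqrt_def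
  proof (rule the_equality)
    have 1: "transpose_mat ?B = ?B" by (rule eq_matI) auto
    have 2: "0 \<le> k" if k: "eigenvalue ?B k" for k
    proof -
      obtain x where x: "x \<in> carrier_vec n" "x \<noteq> 0\<^sub>v n" "?B *\<^sub>v x = k \<cdot>\<^sub>v x"
        using k unfolding eigenvalue_def eigenvector_def by auto
      let ?x = "($) x"
      have comp: "k * x $ i = spike_map n ?c ?v ?x i" if i: "i < n" for i
      proof -
        have "k * x $ i = (?B *\<^sub>v x) $ i" using x i by simp
        also have "\<dots> = app n (e ?B) ?x i" using index_mult_mat_vec_sum[OF BB x(1) i] by (simp add: app_def e_def)
        finally show ?thesis using eB[OF i] by simp
      qed
      have "k * ip n ?x ?x = ip n ?x (\<lambda>i. k * ?x i)" by (simp add: ip_scale_right)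
      also have "\<dots> = ip n ?x (spike_map n ?c ?v ?x)" using comp by (intro ip_cong) auto
      also have "\<dots> = ip n ?x ?x + ?c * (ip n ?v ?x)\<^sup>2"
        unfolding spike_map_def ip_add_right ip_scale_right by (simp add: power2_eq_square ip_commute)
      finally have k: "k * ip n ?x ?x = ip n ?x ?x + ?c * (ip n ?v ?x)\<^sup>2" .
      have "(ip n ?v ?x)\<^sup>2 \<le> ip n ?x ?x" using ip_Cauchy_Schwarz[of n ?v ?x] v by simp
      \<comment> \<open>\<theta> \<ge> 0 enters as \<open>sqrt \<theta> - 1 \<ge> -1\<close>; the
        term \<open>- (v \<bullet> x)^2\<close> is then absorbed by Cauchy-Schwarz.\<close>
      moreover have "(-1) * (ip n ?v ?x)\<^sup>2 \<le> ?c * (ip n ?v ?x)\<^sup>2" using th by (intro mult_right_mono) auto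
      ultimately have "0 \<le> k * ip n ?x ?x" unfolding k by linarith
      moreover have "0 < ip n ?x ?x"
      proof -
        obtain i where i: "i < n" "x $ i \<noteq> 0" using x(1,2) by (metis carrier_vecD eq_vecI index_zero_vec(1) index_zero_vec(2))
        have "0 < (x $ i) * (x $ i)" using i by (simp add: zero_less_mult_iff linorder_neq_iff) linarith
        also have "\<dots> \<le> ip n ?x ?x" unfolding ip_def using i by (intro member_le_sum[of i "{..<n}" "\<lambda>i. x $ i * x $ i"]) auto
        finally show ?thesis .
      qed
      ultimately show ?thesis by (simp add: zero_le_mult_iff)
    qed
    have 3: "?B * ?B = \<Sigma>"
    proof (rule eq_matI)
      fix i j assume "i < dim_row \<Sigma>" "j < dim_col \<Sigma>"
      then have ij: "i < n" "j < n" using S by auto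
      let ?e = "\<lambda>b. if b = j then 1 else (0::real)"
      have col: "app n r ?e a = r a j" for r a unfolding app_def using ij(2) by (rule sum_delta_mult)
      have "(?B * ?B) $$ (i, j) = app n (e ?B) (\<lambda>a. e ?B a j) i"
        using index_mult_mat_sum[OF BB BB ij] by (simp add: app_def e_def del: index_mat)
      also have "\<dots> = spike_map n ?c ?v (\<lambda>a. e ?B a j) i" by (rule eB[OF ij(1)])
      also have "\<dots> = spike_map n ?c ?v (spike_map n ?c ?v ?e) i"
      proof -
        have "e ?B a j = spike_map n ?c ?v ?e a" if "a < n" for a using eB[OF that, of ?e] unfolding col .
        moreover from this have "ip n ?v (\<lambda>a. e ?B a j) = ip n ?v (spike_map n ?c ?v ?e)" by (intro ip_cong) auto
        ultimately show ?thesis unfolding spike_map_def[of n ?c ?v "\<lambda>a. e ?B a j"] spike_map_def[of n ?c ?v "spike_map n ?c ?v ?e"]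
          using ij by simp
      qed
      also have "\<dots> = spike_map n (\<theta> - 1) ?v ?e i"
      proof -
        have "ip n ?v (spike_map n ?c ?v ?e) = sqrt \<theta> * ip n ?v ?e"
          unfolding spike_map_def ip_add_right ip_scale_right v(2) by (simp add: algebra_simps)
        then have "spike_map n ?c ?v (spike_map n ?c ?v ?e) i = ?e i + (?c + ?c * sqrt \<theta>) * (ip n ?v ?e * v $ i)"
          unfolding spike_map_def[of n ?c ?v "spike_map n ?c ?v ?e"] by (simp add: spike_map_def algebra_simps)
        moreover have "?c + ?c * sqrt \<theta> = \<theta> - 1" using th by (simp add: algebra_simps)
        ultimately show ?thesis by (simp add: spike_map_def)
      qed
      also have "\<dots> = \<Sigma> $$ (i, j)" using eSig[OF ij(1), of ?e] unfolding col by (simp add: e_def)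
      finally show "(?B * ?B) $$ (i, j) = \<Sigma> $$ (i, j)" .
    qed (use S in auto)
    show "?B \<in> carrier_mat (dim_row \<Sigma>) (dim_row \<Sigma>) \<and> transpose_mat ?B = ?B \<and> (\<forall>k. eigenvalue ?B k \<longrightarrow> 0 \<le> k) \<and> ?B * ?B = \<Sigma>"
      using 1 2 3 S by auto
  next
    fix B assume "B \<in> carrier_mat (dim_row \<Sigma>) (dim_row \<Sigma>) \<and> transpose_mat B = B \<and> (\<forall>k. eigenvalue B k \<longrightarrow> 0 \<le> k) \<and> B * B = \<Sigma>"
    then have B: "B \<in> carrier_mat n n" "transpose_mat B = B" "\<And>k. eigenvalue B k \<Longrightarrow> 0 \<le> k" "B * B = \<Sigma>" using S by auto
    let ?b = "e B"
    have bsym: "?b i j = ?b j i" if "i < n" "j < n" for i j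
    proof -
      have "B $$ (j, i) = transpose_mat B $$ (i, j)" using B(1) that by simp
      then show ?thesis using B(2) by (simp add: e_def)
    qed
    have neg: "y i = 0" if y: "\<And>i. i < n \<Longrightarrow> app n ?b y i = k * y i" and k: "k < 0" and i: "i < n" for y k i
    proof (rule ccontr)
      assume "y i \<noteq> 0"
      then have "vec n y \<noteq> 0\<^sub>v n" using i by (metis index_vec index_zero_vec(1))
      moreover have "B *\<^sub>v vec n y = k \<cdot>\<^sub>v vec n y"
        using B(1) y by (intro eq_vecI) (auto simp: mv simp del: index_mult_mat_vec)
      ultimately have "eigenvalue B k" using B(1) unfolding eigenvalue_def eigenvector_def by (intro exI[of _ "vec n y"]) auto
      then show False using B(3) k by fastforce
    qed
    have perp: "app n ?b x i = x i" if x: "ip n ?v x = 0" and i: "i < n" for x i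
    proof -
      \<comment> \<open>Orthogonally to \<open>v\<close> one has \<open>B B x = x\<close>, hence
        \<open>B (B x - x) = - (B x - x)\<close>.\<close>
      define y where "y i = app n ?b x i - x i" for i
      have "app n ?b y j = (-1) * y j" if j: "j < n" for j
        unfolding y_def app_diff using sq[OF B(1,4) j, of x] x by (simp add: spike_map_def)
      from neg[OF this _ i] show ?thesis by (simp add: y_def)
    qed
    have along: "app n ?b ?v i = sqrt \<theta> * v $ i" if i: "i < n" for i
    proof -
      have bbv: "app n ?b (app n ?b ?v) j = \<theta> * v $ j" if "j < n" for j
        using sq[OF B(1,4) that, of ?v] v(2) by (simp add: spike_map_def algebra_simps)
      \<comment> \<open>In the same way \<open>B B v = \<theta> v\<close> gives
        \<open>B y = - sqrt \<theta> y\<close>.\<close>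
      define y where "y i = app n ?b ?v i - sqrt \<theta> * v $ i" for i
      have eig: "app n ?b y j = (- sqrt \<theta>) * y j" if j: "j < n" for j
        unfolding y_def app_diff app_scale using bbv[OF j] th by (simp add: algebra_simps)
      show ?thesis
      proof (cases "\<theta> = 0")
        case False
        then have "- sqrt \<theta> < 0" using th by simp
        from neg[OF eig this i] show ?thesis by (simp add: y_def)
      next
        \<comment> \<open>For \<theta> = 0 the eigenvalue \<open>- sqrt \<theta>\<close> is not
          negative and yields no contradiction. Symmetry of \<open>B\<close> helps instead:
          \<open>|B v|^2 = v \<bullet> B B v = 0\<close>.\<close>
        case True
        have "ip n (app n ?b ?v) (app n ?b ?v) = ip n ?v (app n ?b (app n ?b ?v))"
          unfolding ip_app[of n ?v] ip_def[of n "app n ?b ?v" "app n ?b ?v"]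
          unfolding app_def[of n ?b ?v] sum_distrib_right
          by (subst sum.swap, intro sum.cong refl) (simp add: bsym app_def sum_distrib_left mult_ac)
        also have "\<dots> = ip n ?v (\<lambda>j. 0)" using bbv True by (intro ip_cong) auto
        also have "\<dots> = 0" by (simp add: ip_def)
        finally have "(\<Sum>j<n. app n ?b ?v j * app n ?b ?v j) = 0" by (simp add: ip_def)
        then have "app n ?b ?v i * app n ?b ?v i = 0" using i by (subst (asm) sum_nonneg_eq_0_iff) auto
        then show ?thesis using True by simp
      qed
    qed
    show "B = ?B"
    proof (rule eq_matI)
      fix i j assume "i < dim_row ?B" "j < dim_col ?B"
      then have ij: "i < n" "j < n" by auto
      let ?e = "\<lambda>b. if b = j then 1 else (0::real)"
      define x where "x a = ?e a - v $ j * v $ a" for a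
      have ve: "ip n ?v ?e = v $ j" unfolding ip_def using ij(2) by (rule sum_delta_mult)
      have "ip n ?v x = ip n ?v (\<lambda>a. ?e a + (- (v $ j)) * v $ a)" by (simp add: x_def[abs_def])
      also have "\<dots> = 0" unfolding ip_add_right ip_scale_right ve v(2) by simp
      finally have "app n ?b x i = x i" using ij by (intro perp)
      moreover have "app n ?b ?e i = app n ?b (\<lambda>a. x a + v $ j * v $ a) i" by (simp add: x_def)
      ultimately have "app n ?b ?e i = x i + v $ j * (sqrt \<theta> * v $ i)"
        using along[OF ij(1)] by (simp add: app_add app_scale)
      moreover have "app n ?b ?e i = B $$ (i, j)" unfolding app_def e_def using ij(2) by (rule sum_delta_mult)
      ultimately show "B $$ (i, j) = ?B $$ (i, j)" using ij by (simp add: x_def algebra_simps)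
    qed (use B in auto)
  qed
qed

lemma ip_spike: "ip n u (spike_map n c v w) = ip n u w + c * ip n v w * ip n u v"
  unfolding spike_map_def ip_add_right ip_scale_right ..

lemma ip_spike_sym: "ip n u (spike_map n c v w) = ip n (spike_map n c v u) w"
proof -
  have "ip n (spike_map n c v u) w = ip n w (spike_map n c v u)" by (rule ip_commute)
  also have "\<dots> = ip n u w + c * ip n v w * ip n u v"
    unfolding ip_spike using ip_commute[of n w u] ip_commute[of n w v] ip_commute[of n v u] by simp
  finally show ?thesis unfolding ip_spike by simp
qed

text \<open>Let \<open>B\<close> be the square root of \<Sigma> and \<open>S = B W B\<close>. The
  vector \<open>p\<close> of the proof is \<open>sqrt \<theta>\<close> times the inverse of
  \<open>B\<close> applied to \<open>z\<close>, written in a form that makes sense for \<theta> = 0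
  too. It satisfies \<open>(S + s) p = (\<theta> + s (1 - \<theta>) h) v\<close>, the rank-one
  perturbation formula, and the second claim is this equation tested against an eigenvector of
  \<open>S\<close>.\<close>

lemma spiked_eigen_identity:
  fixes v \<phi> :: "nat \<Rightarrow> real"
  assumes s: "s > 0" and th: "\<theta> \<ge> 0" and v: "ip n v v = 1"
    and ev: "\<And>i. i < n \<Longrightarrow> lam * \<phi> i = spike_map n (sqrt \<theta> - 1) v (app n (outer_sum zs) (spike_map n (sqrt \<theta> - 1) v \<phi>)) i"
    and ph: "ip n \<phi> \<phi> = 1"
  defines "z \<equiv> app n (resolvent n s zs) v"
  defines "h \<equiv> ip n v z"
  shows "0 \<le> lam"
    and "sqrt \<theta> * ip n z \<phi> + (1 - sqrt \<theta>) * h * ip n v \<phi> = ip n v \<phi> * (\<theta> + s * (1 - \<theta>) * h) / (lam + s)"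
proof -
  let ?q = "sqrt \<theta>" and ?W = "outer_sum zs"
  let ?B = "spike_map n (?q - 1) v"
  have symW: "sym_ker ?W" by (simp add: sym_ker_def outer_sum_def mult.commute)
  have pair: "lam * ip n p \<phi> = ip n (?B p) (app n ?W (?B \<phi>))" for p
  proof -
    have "lam * ip n p \<phi> = ip n p (\<lambda>i. lam * \<phi> i)" by (simp add: ip_scale_right)
    also have "\<dots> = ip n p (?B (app n ?W (?B \<phi>)))" using ev by (intro ip_cong) auto
    also have "\<dots> = ip n (?B p) (app n ?W (?B \<phi>))" by (rule ip_spike_sym)
    finally show ?thesis .
  qed
  have "0 \<le> ip n (?B \<phi>) (app n ?W (?B \<phi>))"
    unfolding ip_app_outer_sum by (intro sum_list_nonneg) auto
  then show lam: "0 \<le> lam" using pair[of \<phi>] ph by simp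
  define p where "p i = ?q * z i + (1 - ?q) * h * v i" for i
  have pip: "ip n u p = ?q * ip n u z + (1 - ?q) * h * ip n u v" for u
    unfolding p_def[abs_def] ip_add_right ip_scale_right ..
  have vp: "ip n v p = h" unfolding pip v h_def[symmetric] by (simp add: algebra_simps)
  have "?B p i = ?q * z i" for i
    unfolding spike_map_def vp by (simp add: p_def algebra_simps)
  then have "?B p = (\<lambda>i. ?q * z i)" by auto
  then have "lam * ip n p \<phi> = ?q * ip n z (app n ?W (?B \<phi>))"
    unfolding pair[of p] \<open>?B p = (\<lambda>i. ?q * z i)\<close> using ip_commute[of n "\<lambda>i. ?q * z i"] ip_commute[of n z] by (simp add: ip_scale_right)
  also have "ip n z (app n ?W (?B \<phi>)) = ip n (?B \<phi>) (app n ?W z)" by (rule ip_app_sym[OF symW])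
  \<comment> \<open>\<open>W z = v - s z\<close>, since \<open>z\<close> is the resolvent applied to
    \<open>v\<close>.\<close>
  also have "\<dots> = ip n (?B \<phi>) v - s * ip n (?B \<phi>) z"
    using ip_resolvent[OF is_resolvent_resolvent[OF s, of n zs], of "?B \<phi>" v] by (simp add: z_def)
  also have "ip n (?B \<phi>) v = ?q * ip n v \<phi>"
  proof -
    have "ip n (?B \<phi>) v = ip n \<phi> (?B v)" by (rule ip_spike_sym[symmetric])
    also have "\<dots> = ?q * ip n \<phi> v" unfolding ip_spike v by (simp add: algebra_simps)
    finally show ?thesis using ip_commute[of n \<phi> v] by simp
  qed
  also have "ip n (?B \<phi>) z = ip n z \<phi> + (?q - 1) * ip n v \<phi> * h"
  proof -
    have "ip n (?B \<phi>) z = ip n \<phi> (?B z)" by (rule ip_spike_sym[symmetric])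
    also have "\<dots> = ip n \<phi> z + (?q - 1) * h * ip n \<phi> v" unfolding ip_spike h_def ..
    finally show ?thesis using ip_commute[of n \<phi> v] ip_commute[of n \<phi> z] by simp
  qed
  also have "ip n p \<phi> = ?q * ip n z \<phi> + (1 - ?q) * h * ip n v \<phi>"
    using pip[of \<phi>] ip_commute[of n \<phi> v] ip_commute[of n \<phi> z] ip_commute[of n p \<phi>] by simp
  finally have e: "lam * (?q * ip n z \<phi> + (1 - ?q) * h * ip n v \<phi>) =
      ?q * (?q * ip n v \<phi> - s * (ip n z \<phi> + (?q - 1) * ip n v \<phi> * h))" .
  have q2: "?q * ?q = \<theta>" using th by simp
  have expand: "q * (q * c - s * (d + (q - 1) * c * h)) + s * (q * d + (1 - q) * h * c) = (q * q) * c + s * h * c * (1 - q * q)"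
    for q c d :: real
    by (simp add: algebra_simps)
  have "(lam + s) * (?q * ip n z \<phi> + (1 - ?q) * h * ip n v \<phi>) = (?q * ?q) * ip n v \<phi> + s * h * ip n v \<phi> * (1 - ?q * ?q)"
    unfolding distrib_right[of lam] e by (rule expand)
  also have "\<dots> = ip n v \<phi> * (\<theta> + s * (1 - \<theta>) * h)" unfolding q2 by (simp add: algebra_simps)
  finally show "?q * ip n z \<phi> + (1 - ?q) * h * ip n v \<phi> = ip n v \<phi> * (\<theta> + s * (1 - \<theta>) * h) / (lam + s)"
    using s lam by (simp add: field_simps)
qed

definition entries :: "real mat \<Rightarrow> nat \<times> nat \<Rightarrow> real" where
  "entries X = (\<lambda>ij. X $$ ij)"

lemma outer_sum_columns:
  "outer_sum (columns n [0..<m] X) a b = (\<Sum>j<m. X (a, j) * X (b, j)) / real n"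
  by (simp add: outer_sum_def columns_def scaled_def interv_sum_list_conv_sum_set_nat atLeast0LessThan comp_def
      sum_divide_distrib)

lemma app_outer_sum_columns:
  "app n (outer_sum (columns n [0..<m] X)) w a = (\<Sum>j<m. X (a, j) * (\<Sum>b<n. X (b, j) * w b)) / real n"
proof -
  have "app n (outer_sum (columns n [0..<m] X)) w a = (\<Sum>b<n. \<Sum>j<m. X (a, j) * (X (b, j) * w b)) / real n"
    by (simp add: app_def outer_sum_columns sum_divide_distrib sum_distrib_right mult.assoc)
  then show ?thesis by (subst (asm) sum.swap) (simp add: sum_distrib_left)
qed

text \<open>The bridge from matrices to kernels: the square root becomes the explicit
  \<open>spike_map\<close>, and \<open>X X\<^sup>T / n\<close> the sum of the rank-one matrices of
  the scaled columns.\<close>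

lemma sample_cov_eigen:
  fixes \<Sigma> X :: "real mat"
  assumes S: "\<Sigma> \<in> carrier_mat n n" "transpose_mat \<Sigma> = \<Sigma>" "has_eigenvalues \<Sigma> (\<theta> # replicate (n - 1) 1)"
    and n: "n \<ge> 1" and th: "\<theta> \<ge> 0" and v: "v \<in> carrier_vec n" "scalar_prod v v = 1" "eigenvector \<Sigma> v \<theta>"
    and X: "X \<in> carrier_mat n m"
    and ph: "\<phi> \<in> carrier_vec n" "eigenvector (sample_cov n \<Sigma> X) \<phi> lam" and i: "i < n"
  shows "lam * \<phi> $ i = spike_map n (sqrt \<theta> - 1) (($) v)
    (app n (outer_sum (columns n [0..<m] (entries X))) (spike_map n (sqrt \<theta> - 1) (($) v) (($) \<phi>))) i"
proof -
  let ?v = "($) v" and ?c = "sqrt \<theta> - 1"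
  define B where "B = mat n n (\<lambda>(i, j). (if i = j then 1 else 0) + ?c * v $ i * v $ j)"
  have vv: "ip n ?v ?v = 1" using v scalar_prod_ip[OF v(1) v(1)] by simp
  have sqrtS: "mat_sqrt \<Sigma> = B"
    unfolding B_def by (rule mat_sqrt_spiked[OF S(1) th spiked_matrix_form[OF S n v] v(1) vv])
  have B: "B \<in> carrier_mat n n" by (simp add: B_def)
  have Bw: "(B *\<^sub>v w) $ a = spike_map n ?c ?v (($) w) a" if "w \<in> carrier_vec n" "a < n" for w a
  proof -
    have "(B *\<^sub>v w) $ a = app n (\<lambda>i j. B $$ (i, j)) (($) w) a"
      using index_mult_mat_vec_sum[OF B that] by (simp add: app_def)
    also have "\<dots> = spike_map n ?c ?v (($) w) a" using that by (intro app_spike) (auto simp: B_def)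
    finally show ?thesis .
  qed
  define u where "u = B *\<^sub>v \<phi>"
  define x where "x = X *\<^sub>v (transpose_mat X *\<^sub>v u)"
  have cu: "u \<in> carrier_vec n" and cx: "x \<in> carrier_vec n" using B X ph by (auto simp: u_def x_def)
  let ?M = "B * X * transpose_mat X * B"
  have M: "?M \<in> carrier_mat n n" using B X by auto
  have Mphi: "?M *\<^sub>v \<phi> = B *\<^sub>v x"
  proof -
    have "?M *\<^sub>v \<phi> = (B * X * transpose_mat X) *\<^sub>v u"
      unfolding u_def using B X ph by (intro assoc_mult_mat_vec[of _ n n _ n]) auto
    also have "\<dots> = (B * X) *\<^sub>v (transpose_mat X *\<^sub>v u)" using B X cu by (intro assoc_mult_mat_vec[of _ n m _ n]) auto
    also have "\<dots> = B *\<^sub>v x" unfolding x_def using B X cu by (intro assoc_mult_mat_vec[of _ n n _ m]) auto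
    finally show ?thesis .
  qed
  have "lam * \<phi> $ i = (sample_cov n \<Sigma> X *\<^sub>v \<phi>) $ i"
    using ph i by (simp add: eigenvector_def)
  also have "\<dots> = (\<Sum>k<n. sample_cov n \<Sigma> X $$ (i, k) * \<phi> $ k)"
    using M ph i by (intro index_mult_mat_vec_sum) (auto simp: sample_cov_def sqrtS)
  also have "\<dots> = (1 / real n) * (\<Sum>k<n. ?M $$ (i, k) * \<phi> $ k)"
    unfolding sum_distrib_left
  proof (intro sum.cong refl)
    fix k assume "k \<in> {..<n}"
    then have "sample_cov n \<Sigma> X $$ (i, k) = (1 / real n) * ?M $$ (i, k)"
      unfolding sample_cov_def sqrtS using M i by (intro index_smult_mat(1)) (simp_all only: carrier_matD lessThan_iff)
    then show "sample_cov n \<Sigma> X $$ (i, k) * \<phi> $ k = (1 / real n) * (?M $$ (i, k) * \<phi> $ k)" by (simp only: mult.assoc)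
  qed
  also have "(\<Sum>k<n. ?M $$ (i, k) * \<phi> $ k) = (B *\<^sub>v x) $ i"
    using index_mult_mat_vec_sum[OF M ph(1) i] unfolding Mphi by simp
  also have "\<dots> = spike_map n ?c ?v (($) x) i" by (rule Bw[OF cx i])
  also have "(1 / real n) * spike_map n ?c ?v (($) x) i = spike_map n ?c ?v (\<lambda>a. (1 / real n) * x $ a) i"
  proof -
    have "k * (a + c * d * b) = k * a + c * (k * d) * b" for a b c d k :: real by (simp add: algebra_simps)
    then show ?thesis unfolding spike_map_def ip_scale_right .
  qed
  also have "\<dots> = spike_map n ?c ?v (app n (outer_sum (columns n [0..<m] (entries X))) (spike_map n ?c ?v (($) \<phi>))) i"
  proof -
    have e: "(1 / real n) * x $ a = app n (outer_sum (columns n [0..<m] (entries X))) (spike_map n ?c ?v (($) \<phi>)) a" if a: "a < n" for a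
    proof -
      have "x $ a = (\<Sum>j<m. X $$ (a, j) * (transpose_mat X *\<^sub>v u) $ j)"
        unfolding x_def using X cu a by (intro index_mult_mat_vec_sum) auto
      also have "\<dots> = (\<Sum>j<m. X $$ (a, j) * (\<Sum>b<n. X $$ (b, j) * spike_map n ?c ?v (($) \<phi>) b))"
      proof (intro sum.cong refl arg_cong2[where f = "(*)"])
        fix j assume j: "j \<in> {..<m}"
        have "(transpose_mat X *\<^sub>v u) $ j = (\<Sum>b<n. transpose_mat X $$ (j, b) * u $ b)"
          using X cu j by (intro index_mult_mat_vec_sum) auto
        also have "\<dots> = (\<Sum>b<n. X $$ (b, j) * spike_map n ?c ?v (($) \<phi>) b)"
          using X j Bw[OF ph(1)] by (intro sum.cong refl) (auto simp: u_def)
        finally show "(transpose_mat X *\<^sub>v u) $ j = (\<Sum>b<n. X $$ (b, j) * spike_map n ?c ?v (($) \<phi>) b)" .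
      qed
      finally show ?thesis by (simp add: app_outer_sum_columns entries_def)
    qed
    then have "ip n ?v (\<lambda>a. (1 / real n) * x $ a) = ip n ?v (app n (outer_sum (columns n [0..<m] (entries X))) (spike_map n ?c ?v (($) \<phi>)))"
      by (intro ip_cong) auto
    then show ?thesis unfolding spike_map_def[of n ?c ?v "\<lambda>a. (1 / real n) * x $ a"] e[OF i]
      by (simp only: spike_map_def[of n ?c ?v "app n (outer_sum (columns n [0..<m] (entries X))) (spike_map n ?c ?v (($) \<phi>))"])
  qed
  finally show ?thesis .
qed

text \<open>The square matrix with rows \<open>\<phi> i\<close> has its transpose as right inverse,
  hence also as left inverse. So its columns are orthonormal too, which is completeness of the
  basis.\<close>

lemma parseval:
  fixes \<phi> :: "nat \<Rightarrow> real vec"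
  assumes c: "\<And>i. i < n \<Longrightarrow> \<phi> i \<in> carrier_vec n"
    and o: "\<And>i j. i < n \<Longrightarrow> j < n \<Longrightarrow> scalar_prod (\<phi> i) (\<phi> j) = (if i = j then 1 else 0)"
  shows "(\<Sum>i<n. ip n u (($) (\<phi> i)) * ip n w (($) (\<phi> i))) = ip n u w"
proof -
  define U where "U = mat n n (\<lambda>(i, a). \<phi> i $ a)"
  have U: "U \<in> carrier_mat n n" "transpose_mat U \<in> carrier_mat n n" by (auto simp: U_def)
  have "U * transpose_mat U = 1\<^sub>m n"
  proof (rule eq_matI)
    fix i j assume "i < dim_row (1\<^sub>m n :: real mat)" "j < dim_col (1\<^sub>m n :: real mat)"
    then have ij: "i < n" "j < n" by auto
    have "(U * transpose_mat U) $$ (i, j) = (\<Sum>k<n. U $$ (i, k) * transpose_mat U $$ (k, j))"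
      by (rule index_mult_mat_sum[OF U ij])
    also have "\<dots> = ip n (($) (\<phi> i)) (($) (\<phi> j))" unfolding ip_def using ij by (intro sum.cong) (auto simp: U_def)
    also have "\<dots> = 1\<^sub>m n $$ (i, j)" using o[OF ij] scalar_prod_ip[OF c c] ij by simp
    finally show "(U * transpose_mat U) $$ (i, j) = 1\<^sub>m n $$ (i, j)" .
  qed (use U in auto)
  then have UU: "transpose_mat U * U = 1\<^sub>m n" by (rule mat_mult_left_right_inverse[OF U])
  have d: "(\<Sum>i<n. \<phi> i $ a * \<phi> i $ b) = (if a = b then 1 else 0)" if ab: "a < n" "b < n" for a b
  proof -
    have "(transpose_mat U * U) $$ (a, b) = (\<Sum>i<n. transpose_mat U $$ (a, i) * U $$ (i, b))"
      by (rule index_mult_mat_sum[OF U(2,1) ab])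
    also have "\<dots> = (\<Sum>i<n. \<phi> i $ a * \<phi> i $ b)" using ab by (intro sum.cong) (auto simp: U_def)
    finally show ?thesis using UU ab by simp
  qed
  have "(\<Sum>i<n. ip n u (($) (\<phi> i)) * ip n w (($) (\<phi> i))) = (\<Sum>i<n. \<Sum>a<n. \<Sum>b<n. u a * w b * (\<phi> i $ a * \<phi> i $ b))"
    unfolding ip_def sum_product by (intro sum.cong refl) simp
  also have "\<dots> = (\<Sum>a<n. \<Sum>i<n. \<Sum>b<n. u a * w b * (\<phi> i $ a * \<phi> i $ b))" by (rule sum.swap)
  also have "\<dots> = (\<Sum>a<n. \<Sum>b<n. \<Sum>i<n. u a * w b * (\<phi> i $ a * \<phi> i $ b))" by (intro sum.cong refl sum.swap)
  also have "\<dots> = (\<Sum>a<n. \<Sum>b<n. u a * (w b * (if a = b then 1 else 0)))"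
    by (intro sum.cong refl) (simp only: sum_distrib_left[symmetric] d lessThan_iff mult.assoc)
  also have "\<dots> = (\<Sum>a<n. u a * w a)"
    by (intro sum.cong refl) (simp only: sum_distrib_left[symmetric] sum_delta_mult lessThan_iff)
  finally show ?thesis by (simp add: ip_def)
qed

lemma integral_spectral_measure:
  fixes f :: "real \<Rightarrow> real"
  assumes "f \<in> borel_measurable borel"
  shows "(\<integral>x. f x \<partial>spectral_measure n lam \<phi> v) = (\<Sum>i<n. \<bar>scalar_prod (\<phi> i) v\<bar>\<^sup>2 * f (lam i))"
proof -
  have "(\<integral>x. f x \<partial>spectral_measure n lam \<phi> v) =
      (\<integral>i. f (lam i) \<partial>point_measure {..<n} (\<lambda>i. ennreal (\<bar>scalar_prod (\<phi> i) v\<bar>\<^sup>2)))"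
    unfolding spectral_measure_def using assms
    by (intro integral_distr) (auto simp: measurable_def space_point_measure sets_point_measure)
  also have "\<dots> = (\<Sum>i<n. \<bar>scalar_prod (\<phi> i) v\<bar>\<^sup>2 * f (lam i))"
    unfolding point_measure_def
    by (subst integral_density) (auto simp: lebesgue_integral_count_space_finite AE_count_space)
  finally show ?thesis .
qed

text \<open>If \<open>h = 0\<close>, contraction forces \<open>R v = 0\<close>, and the resolvent
  equation then gives \<open>v = 0\<close>. Strict positivity keeps the denominator of the spiked
  transform nonzero also for \<theta> = 0.\<close>

lemma resolvent_quad_pos:
  assumes s: "s > 0" and v: "ip n v v = 1"
  shows "0 < quad n (resolvent n s zs) v"
proof (rule ccontr)
  let ?z = "app n (resolvent n s zs) v"
  assume "\<not> 0 < quad n (resolvent n s zs) v"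
  moreover have "s * ip n ?z ?z \<le> quad n (resolvent n s zs) v"
    using contractive_ker_resolvent[OF s, of n zs] by (auto simp: contractive_ker_def quad_def)
  ultimately have "s * ip n ?z ?z \<le> 0" by linarith
  then have "ip n ?z ?z = 0" using s ip_self_nonneg[of n ?z] by (simp add: mult_le_0_iff)
  then have "\<And>i. i < n \<Longrightarrow> ?z i = 0" unfolding ip_def by (subst (asm) sum_nonneg_eq_0_iff) auto
  moreover from this have "app n (outer_sum zs) ?z i = 0" for i by (simp add: app_def[of n "outer_sum zs"])
  ultimately have "v i = 0" if "i < n" for i
    using is_resolvent_app[OF is_resolvent_resolvent[OF s] that, of zs v] that by simp
  then show False using v by (simp add: ip_def)
qed

section \<open>From deterministic to random directions\<close>

lemma rv_sigma_measurable:
  assumes "rv_sigma M I Y \<subseteq> sets M" "i \<in> I"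
  shows "Y i \<in> borel_measurable M"
proof (rule measurableI)
  fix A :: "real set" assume A: "A \<in> sets borel"
  have "Y i -` A \<inter> space M \<in> rv_sigma M I Y"
    unfolding rv_sigma_def using A assms(2) by (intro sigma_sets.Basic) blast
  then show "Y i -` A \<inter> space M \<in> sets M" using assms(1) by blast
qed simp

text \<open>The family bundled into one function-valued random variable generates no event outside
  \<open>rv_sigma\<close>; independence of the sigma-algebras thus passes to the bundled
  variables.\<close>

lemma sigma_sets_restrict_subset:
  "sigma_sets (space M) {(\<lambda>\<omega>. \<lambda>i\<in>I. Y i \<omega>) -` A \<inter> space M |A. A \<in> sets (Pi\<^sub>M I (\<lambda>_. borel))} \<subseteq> rv_sigma M I Y"
proof -
  let ?G = "\<Union>i\<in>I. {Y i -` A \<inter> space M | A. A \<in> sets borel}"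
  define N where "N = sigma (space M) ?G"
  have sp: "space N = space M" by (simp add: N_def space_measure_of_conv)
  have st: "sets N = rv_sigma M I Y" unfolding N_def rv_sigma_def by (rule sets_measure_of) auto
  have "Y i \<in> borel_measurable N" if "i \<in> I" for i
  proof (rule measurableI)
    fix A :: "real set" assume "A \<in> sets borel"
    then have "Y i -` A \<inter> space M \<in> rv_sigma M I Y"
      unfolding rv_sigma_def using that by (intro sigma_sets.Basic) blast
    then show "Y i -` A \<inter> space N \<in> sets N" by (simp add: sp st)
  qed simp
  then have m: "(\<lambda>\<omega>. \<lambda>i\<in>I. Y i \<omega>) \<in> N \<rightarrow>\<^sub>M Pi\<^sub>M I (\<lambda>_. borel)" by (intro measurable_restrict)
  have "{(\<lambda>\<omega>. \<lambda>i\<in>I. Y i \<omega>) -` A \<inter> space M |A. A \<in> sets (Pi\<^sub>M I (\<lambda>_. borel))} \<subseteq> sets N"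
    using measurable_sets[OF m] by (auto simp: sp)
  then have "sigma_sets (space N) {(\<lambda>\<omega>. \<lambda>i\<in>I. Y i \<omega>) -` A \<inter> space M |A. A \<in> sets (Pi\<^sub>M I (\<lambda>_. borel))} \<subseteq> sets N"
    by (rule sets.sigma_sets_subset)
  then show ?thesis by (simp add: sp st)
qed

lemma (in prob_space) indep_set_subset:
  assumes "indep_set A B" "A' \<subseteq> A" "B' \<subseteq> B"
  shows "indep_set A' B'"
  using assms unfolding indep_set_def
  by (elim indep_sets_mono_sets) (auto split: bool.splits)

lemma (in prob_space) indep_set_events:
  assumes "indep_set A B" shows "A \<subseteq> events" "B \<subseteq> events"
  using assms unfolding indep_set_def indep_sets_def by (auto split: bool.splits)

text \<open>The bound of \<open>quad_L1\<close> is uniform over unit vectors, and by independence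
  the joint law is a product, so Fubini fixes \<open>V\<close> while the entries are integrated.
  \<open>m \<ge> 1\<close> makes the index set of the entries nonempty, as the characterization of
  independence by product laws requires.\<close>

lemma (in iid_entries) quad_L1_random:
  fixes K :: "'w measure" and Y :: "'w \<Rightarrow> nat \<times> nat \<Rightarrow> real" and V :: "'w \<Rightarrow> nat \<Rightarrow> real"
  assumes K: "prob_space K" and nm: "n \<ge> 1" "m \<ge> 1"
    and Yi: "prob_space.indep_vars K (\<lambda>_. borel) (\<lambda>ij \<omega>. Y \<omega> ij) ({..<n} \<times> {..<m})"
    and Yd: "\<And>ij. ij \<in> {..<n} \<times> {..<m} \<Longrightarrow> distr K borel (\<lambda>\<omega>. Y \<omega> ij) = D"
    and V1: "\<And>\<omega>. \<omega> \<in> space K \<Longrightarrow> ip n (V \<omega>) (V \<omega>) = 1"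
    and ind: "prob_space.indep_set K (rv_sigma K ({..<n} \<times> {..<m}) (\<lambda>ij \<omega>. Y \<omega> ij)) (rv_sigma K {..<n} (\<lambda>i \<omega>. V \<omega> i))"
    and s: "s \<ge> 1" and a: "\<alpha> \<ge> 0" and g: "g > 0" "s * g + \<alpha> * g / (1 + g) = 1"
  shows "(\<integral>\<^sup>+\<omega>. ennreal \<bar>quad n (cov_resolvent n s [0..<m] (Y \<omega>)) (V \<omega>) - g\<bar> \<partial>K) \<le> ennreal (deviation s \<alpha> n m)"
proof -
  interpret K: prob_space K by (rule K)
  let ?I = "{..<n} \<times> {..<m}" and ?J = "{..<n} \<times> {0 :: nat}"
  let ?NX = "Pi\<^sub>M ?I (\<lambda>_. borel :: real measure)" and ?NV = "Pi\<^sub>M ?J (\<lambda>_. borel :: real measure)"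
  define X where "X = (\<lambda>\<omega>. \<lambda>ij\<in>?I. Y \<omega> ij)"
  \<comment> \<open>The direction is stored under index pairs \<open>(i, 0)\<close> to give it the
    type of the family of entries, as \<open>indep_var\<close> demands.\<close>
  define U where "U = (\<lambda>\<omega>. \<lambda>ij\<in>?J. V \<omega> (fst ij))"
  have mY: "(\<lambda>\<omega>. Y \<omega> ij) \<in> borel_measurable K" if "ij \<in> ?I" for ij
    by (rule rv_sigma_measurable[OF K.indep_set_events(1)[OF ind] that])
  have mV: "(\<lambda>\<omega>. V \<omega> i) \<in> borel_measurable K" if "i < n" for i
    using that by (intro rv_sigma_measurable[OF K.indep_set_events(2)[OF ind]]) auto
  have mX: "X \<in> K \<rightarrow>\<^sub>M ?NX" unfolding X_def using mY by (intro measurable_restrict)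
  have mU: "U \<in> K \<rightarrow>\<^sub>M ?NV" unfolding U_def using mV by (intro measurable_restrict) auto
  have iv: "K.indep_var ?NX X ?NV U"
    unfolding K.indep_var_eq
  proof (intro conjI mX mU)
    have "sigma_sets (space K) {U -` A \<inter> space K |A. A \<in> sets ?NV} \<subseteq> rv_sigma K ?J (\<lambda>ij \<omega>. V \<omega> (fst ij))"
      unfolding U_def by (rule sigma_sets_restrict_subset)
    also have "\<dots> \<subseteq> rv_sigma K {..<n} (\<lambda>i \<omega>. V \<omega> i)"
      unfolding rv_sigma_def
    proof (intro sigma_sets_mono' UN_least)
      fix ij assume "ij \<in> ?J"
      then have "fst ij \<in> {..<n}" by auto
      then show "{(\<lambda>\<omega>. V \<omega> (fst ij)) -` A \<inter> space K |A. A \<in> sets borel} \<subseteq> (\<Union>i\<in>{..<n}. {(\<lambda>\<omega>. V \<omega> i) -` A \<inter> space K |A. A \<in> sets borel})"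
        by blast
    qed
    finally have u: "sigma_sets (space K) {U -` A \<inter> space K |A. A \<in> sets ?NV} \<subseteq> rv_sigma K {..<n} (\<lambda>i \<omega>. V \<omega> i)" .
    have x: "sigma_sets (space K) {X -` A \<inter> space K |A. A \<in> sets ?NX} \<subseteq> rv_sigma K ?I (\<lambda>ij \<omega>. Y \<omega> ij)"
      unfolding X_def by (rule sigma_sets_restrict_subset)
    show "K.indep_set (sigma_sets (space K) {X -` A \<inter> space K |A. A \<in> sets ?NX}) (sigma_sets (space K) {U -` A \<inter> space K |A. A \<in> sets ?NV})"
      by (rule K.indep_set_subset[OF ind x u])
  qed
  have LX: "distr K ?NX X = Pi_D ?I"
  proof -
    have "(0, 0) \<in> ?I" using nm by auto
    then have ne: "?I \<noteq> {}" by blast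
    have "distr K ?NX X = Pi\<^sub>M ?I (\<lambda>ij. distr K borel (\<lambda>\<omega>. Y \<omega> ij))"
    proof -
      have "K.indep_vars (\<lambda>_. borel) (\<lambda>ij \<omega>. Y \<omega> ij) ?I \<longleftrightarrow>
          distr K ?NX (\<lambda>\<omega>. \<lambda>ij\<in>?I. Y \<omega> ij) = Pi\<^sub>M ?I (\<lambda>ij. distr K borel (\<lambda>\<omega>. Y \<omega> ij))"
        by (rule K.indep_vars_iff_distr_eq_PiM'[OF ne]) (erule mY)
      then show ?thesis unfolding X_def using Yi by blast
    qed
    also have "\<dots> = Pi_D ?I" using Yd by (intro PiM_cong) auto
    finally show ?thesis .
  qed
  let ?LV = "distr K ?NV U"
  interpret LV: prob_space ?LV by (rule K.prob_space_distr[OF mU])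
  have joint: "Pi_D ?I \<Otimes>\<^sub>M ?LV = distr K (?NX \<Otimes>\<^sub>M ?NV) (\<lambda>\<omega>. (X \<omega>, U \<omega>))"
    using iv unfolding K.indep_var_distribution_eq LX by auto
  \<comment> \<open>The iterated integral ranges over all \<open>u\<close>, not just over unit
    vectors; the integrand is set to 0 off the unit sphere, where \<open>quad_L1\<close> says
    nothing.\<close>
  define F where "F = (\<lambda>p :: (nat \<times> nat \<Rightarrow> real) \<times> (nat \<times> nat \<Rightarrow> real).
     (if ip n (\<lambda>i. snd p (i, 0)) (\<lambda>i. snd p (i, 0)) = 1
      then ennreal \<bar>quad n (cov_resolvent n s [0..<m] (fst p)) (\<lambda>i. snd p (i, 0)) - g\<bar> else 0))"
  have c1: "(\<lambda>p. fst p ij) \<in> borel_measurable (?NX \<Otimes>\<^sub>M ?NV)" if "ij \<in> ?I" for ij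
    by (rule measurable_compose[OF measurable_fst measurable_component_singleton[OF that]])
  have c2: "(\<lambda>p. snd p ij) \<in> borel_measurable (?NX \<Otimes>\<^sub>M ?NV)" if "ij \<in> ?J" for ij
    by (rule measurable_compose[OF measurable_snd measurable_component_singleton[OF that]])
  have mF: "F \<in> borel_measurable (?NX \<Otimes>\<^sub>M ?NV)"
  proof -
    have [measurable]: "(\<lambda>p. quad n (cov_resolvent n s [0..<m] (fst p)) (\<lambda>i. snd p (i, 0))) \<in> borel_measurable (?NX \<Otimes>\<^sub>M ?NV)"
      by (intro measurable_quad measurable_cov_resolvent) (auto intro!: c1 c2)
    have [measurable]: "(\<lambda>p. ip n (\<lambda>i. snd p (i, 0)) (\<lambda>i. snd p (i, 0))) \<in> borel_measurable (?NX \<Otimes>\<^sub>M ?NV)"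
      by (intro measurable_ip) (auto intro!: c2)
    show ?thesis unfolding F_def by measurable
  qed
  have "(\<integral>\<^sup>+\<omega>. ennreal \<bar>quad n (cov_resolvent n s [0..<m] (Y \<omega>)) (V \<omega>) - g\<bar> \<partial>K) = (\<integral>\<^sup>+\<omega>. F (X \<omega>, U \<omega>) \<partial>K)"
  proof (rule nn_integral_cong)
    fix \<omega> assume w: "\<omega> \<in> space K"
    have "ip n (\<lambda>i. U \<omega> (i, 0)) (\<lambda>i. U \<omega> (i, 0)) = ip n (V \<omega>) (V \<omega>)" by (intro ip_cong) (auto simp: U_def)
    moreover have "quad n (cov_resolvent n s [0..<m] (X \<omega>)) (\<lambda>i. U \<omega> (i, 0)) = quad n (cov_resolvent n s [0..<m] (Y \<omega>)) (V \<omega>)"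
      by (intro quad_cong cov_resolvent_cong) (auto simp: U_def X_def)
    ultimately show "ennreal \<bar>quad n (cov_resolvent n s [0..<m] (Y \<omega>)) (V \<omega>) - g\<bar> = F (X \<omega>, U \<omega>)"
      using V1[OF w] by (simp add: F_def)
  qed
  also have "\<dots> = (\<integral>\<^sup>+p. F p \<partial>distr K (?NX \<Otimes>\<^sub>M ?NV) (\<lambda>\<omega>. (X \<omega>, U \<omega>)))"
    using mX mU mF by (subst nn_integral_distr) auto
  also have "\<dots> = (\<integral>\<^sup>+p. F p \<partial>(Pi_D ?I \<Otimes>\<^sub>M ?LV))" unfolding joint ..
  also have "\<dots> = (\<integral>\<^sup>+u. (\<integral>\<^sup>+x. F (x, u) \<partial>Pi_D ?I) \<partial>?LV)"
  proof -
    interpret XP: prob_space "Pi_D ?I" by (rule prob_space_Pi_D)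
    interpret PS: pair_sigma_finite "Pi_D ?I" ?LV ..
    have "sets (Pi_D ?I \<Otimes>\<^sub>M ?LV) = sets (?NX \<Otimes>\<^sub>M ?NV)" unfolding joint by simp
    then have "F \<in> borel_measurable (Pi_D ?I \<Otimes>\<^sub>M ?LV)" using mF measurable_cong_sets by blast
    then show ?thesis by (rule PS.nn_integral_snd[symmetric])
  qed
  also have "\<dots> \<le> (\<integral>\<^sup>+u. ennreal (deviation s \<alpha> n m) \<partial>?LV)"
  proof (rule nn_integral_mono)
    fix u :: "nat \<times> nat \<Rightarrow> real"
    show "(\<integral>\<^sup>+x. F (x, u) \<partial>Pi_D ?I) \<le> ennreal (deviation s \<alpha> n m)"
    proof (cases "ip n (\<lambda>i. u (i, 0)) (\<lambda>i. u (i, 0)) = 1")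
      case True
      let ?f = "\<lambda>x. quad n (cov_resolvent n s [0..<m] x) (\<lambda>i. u (i, 0))"
      note q = quad_L1[OF s nm(1) True a g]
      have "?f \<in> borel_measurable (Pi_D ?I)"
        by (intro measurable_quad measurable_cov_resolvent borel_measurable_const) (auto intro!: coord_measurable)
      then have "integrable (Pi_D ?I) ?f"
        using q(2) by (intro finite_measure.integrable_const_bound[OF prob_space.finite_measure[OF prob_space_Pi_D], where B = 1]) auto
      then have "integrable (Pi_D ?I) (\<lambda>x. \<bar>?f x - g\<bar>)"
        using finite_measure.integrable_const[OF prob_space.finite_measure[OF prob_space_Pi_D]] by (intro integrable_abs Bochner_Integration.integrable_diff)
      then have "(\<integral>\<^sup>+x. F (x, u) \<partial>Pi_D ?I) = ennreal (\<integral>x. \<bar>?f x - g\<bar> \<partial>Pi_D ?I)"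
        using True by (simp add: F_def nn_integral_eq_integral)
      then show ?thesis using q(1) by (simp add: ennreal_leI)
    qed (simp add: F_def)
  qed
  also have "\<dots> = ennreal (deviation s \<alpha> n m)" by (subst nn_integral_const) (simp only: LV.emeasure_space_1 mult_1_right)
  finally show ?thesis .
qed

text \<open>The denominator is \<open>\<theta> (1 - s x) + s x\<close>, a convex combination of
  \<theta> and 1, and the numerator of the difference collapses to \<open>\<theta> (h - g)\<close>.
  For \<theta> = 0 both quotients equal \<open>1 / s\<close>, and the constant, a division by zero,
  is 0.\<close>

lemma spiked_transform_lipschitz:
  fixes \<theta> s h g :: real
  assumes th: "\<theta> \<ge> 0" and h: "0 < h" "s * h \<le> 1" and g: "0 < g" "s * g \<le> 1" and s: "s > 0"
  shows "\<bar>h / (\<theta> + s * (1 - \<theta>) * h) - g / (\<theta> + s * (1 - \<theta>) * g)\<bar> \<le> \<theta> / (min \<theta> 1)\<^sup>2 * \<bar>h - g\<bar>"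
    and "0 < \<theta> + s * (1 - \<theta>) * h"
proof -
  have den: "0 < \<theta> + s * (1 - \<theta>) * x \<and> min \<theta> 1 \<le> \<theta> + s * (1 - \<theta>) * x" if x: "0 < x" "s * x \<le> 1" for x
  proof -
    have e: "\<theta> + s * (1 - \<theta>) * x = \<theta> * (1 - s * x) + s * x" by (simp add: algebra_simps)
    have sx: "0 < s * x" using s x by simp
    have "0 \<le> \<theta> * (1 - s * x)" using th x by (intro mult_nonneg_nonneg) auto
    then have 1: "0 < \<theta> * (1 - s * x) + s * x" using sx by linarith
    have "min \<theta> 1 * (1 - s * x) \<le> \<theta> * (1 - s * x)" "min \<theta> 1 * (s * x) \<le> 1 * (s * x)"
      using x sx by (intro mult_right_mono; simp)+
    then have "min \<theta> 1 \<le> \<theta> * (1 - s * x) + s * x" by (simp add: algebra_simps)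
    then show ?thesis using 1 unfolding e by simp
  qed
  show "0 < \<theta> + s * (1 - \<theta>) * h" using den[OF h] by simp
  let ?a = "\<theta> + s * (1 - \<theta>) * h" and ?b = "\<theta> + s * (1 - \<theta>) * g"
  have ab: "?a > 0" "?b > 0" "min \<theta> 1 \<le> ?a" "min \<theta> 1 \<le> ?b" using den[OF h] den[OF g] by auto
  have "h / ?a - g / ?b = (h * ?b - g * ?a) / (?a * ?b)" using ab by (simp add: diff_frac_eq)
  also have "h * ?b - g * ?a = \<theta> * (h - g)" by (simp add: algebra_simps)
  finally have e: "\<bar>h / ?a - g / ?b\<bar> = \<theta> * \<bar>h - g\<bar> / (?a * ?b)" using ab th by (simp add: abs_mult)
  show "\<bar>h / ?a - g / ?b\<bar> \<le> \<theta> / (min \<theta> 1)\<^sup>2 * \<bar>h - g\<bar>"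
  proof (cases "\<theta> = 0")
    case False
    then have m: "0 < min \<theta> 1" using th by auto
    then have "min \<theta> 1 * min \<theta> 1 \<le> ?a * ?b" using ab by (intro mult_mono) auto
    then have "\<theta> * \<bar>h - g\<bar> / (?a * ?b) \<le> \<theta> * \<bar>h - g\<bar> / (min \<theta> 1 * min \<theta> 1)"
      using m ab th by (intro divide_left_mono) auto
    then show ?thesis unfolding e by (simp add: power2_eq_square)
  next
    case True
    then have "\<theta> * \<bar>h - g\<bar> / (?a * ?b) = 0" by simp
    then have "\<bar>h / ?a - g / ?b\<bar> = 0" by (rule trans[OF e])
    moreover have "0 \<le> \<theta> / (min \<theta> 1)\<^sup>2 * \<bar>h - g\<bar>" using th by simp
    ultimately show ?thesis by linarith
  qed
qed

section \<open>Integrals against the spiked Marchenko--Pastur law\<close>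

text \<open>This is \<open>|1 - p e^(i \<phi>)|^2\<close>, the denominator of the Poisson
  kernel.\<close>

definition cden :: "real \<Rightarrow> real \<Rightarrow> real" where
  "cden p \<phi> = 1 - 2 * p * cos \<phi> + p\<^sup>2"

lemma cden_alt: "cden p \<phi> = (p - cos \<phi>)\<^sup>2 + (sin \<phi>)\<^sup>2"
proof -
  have "cden p \<phi> = (p - cos \<phi>)\<^sup>2 + (1 - (cos \<phi>)\<^sup>2)"
    unfolding cden_def by (simp add: power2_eq_square algebra_simps)
  then show ?thesis by (simp add: sin_squared_eq)
qed

lemma sin2_le_cden: "(sin \<phi>)\<^sup>2 \<le> cden p \<phi>"
  by (simp add: cden_alt)

lemma cden_nonneg: "0 \<le> cden p \<phi>"
  by (simp add: cden_alt)

lemma cden_ge: "(1 - \<bar>p\<bar>)\<^sup>2 \<le> cden p \<phi>"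
proof -
  have "p * cos \<phi> \<le> \<bar>p * cos \<phi>\<bar>" by simp
  also have "\<dots> \<le> \<bar>p\<bar> * 1" unfolding abs_mult by (intro mult_left_mono) auto
  finally show ?thesis by (simp add: cden_def power2_eq_square algebra_simps)
qed

lemma cden_pos: "\<bar>p\<bar> < 1 \<Longrightarrow> 0 < cden p \<phi>"
proof -
  assume "\<bar>p\<bar> < 1"
  then have "0 < (1 - \<bar>p\<bar>)\<^sup>2" by simp
  then show ?thesis using cden_ge[of p \<phi>] by linarith
qed

lemma cden_pos': "sin \<phi> \<noteq> 0 \<Longrightarrow> 0 < cden p \<phi>"
proof -
  assume "sin \<phi> \<noteq> 0"
  then have "0 < (sin \<phi>)\<^sup>2" by simp
  then show ?thesis using sin2_le_cden[of \<phi> p] by linarith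
qed

text \<open>For \<open>|p| < 1\<close> the full series is \<open>sin \<phi> / cden p \<phi>\<close>.
  The truncation telescopes by \<open>2 cos \<phi> sin ((K + 1) \<phi>) = sin ((K + 2) \<phi>) + sin
  (K \<phi>)\<close>.\<close>

lemma cden_sin_sum:
  "cden p \<phi> * (\<Sum>k<K. p ^ k * sin (real (Suc k) * \<phi>)) =
     sin \<phi> - p ^ K * sin (real (Suc K) * \<phi>) + p ^ Suc K * sin (real K * \<phi>)"
proof (induction K)
  case 0
  then show ?case by simp
next
  case (Suc K)
  have e: "2 * cos \<phi> * sin (real (Suc K) * \<phi>) = sin (real (Suc (Suc K)) * \<phi>) + sin (real K * \<phi>)"
  proof -
    have 1: "real (Suc (Suc K)) * \<phi> = real (Suc K) * \<phi> + \<phi>" "real K * \<phi> = real (Suc K) * \<phi> - \<phi>"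
      by (simp_all add: algebra_simps)
    show ?thesis unfolding 1 sin_add sin_diff by simp
  qed
  have "cden p \<phi> * (\<Sum>k<Suc K. p ^ k * sin (real (Suc k) * \<phi>)) =
      (sin \<phi> - p ^ K * sin (real (Suc K) * \<phi>) + p ^ Suc K * sin (real K * \<phi>))
      + cden p \<phi> * (p ^ K * sin (real (Suc K) * \<phi>))"
    using Suc by (simp add: algebra_simps)
  also have "\<dots> = sin \<phi> + p ^ Suc K * sin (real K * \<phi>)
      - p ^ Suc K * (2 * cos \<phi> * sin (real (Suc K) * \<phi>)) + p ^ Suc (Suc K) * sin (real (Suc K) * \<phi>)"
    by (simp add: cden_def power2_eq_square algebra_simps)
  finally show ?case unfolding e by (simp add: algebra_simps)
qed

lemma has_integral_sin_sin:
  "((\<lambda>\<phi>. sin \<phi> * sin (real (Suc k) * \<phi>)) has_integral (if k = 0 then pi / 2 else 0)) {0..pi}"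
proof (cases "k = 0")
  case True
  have d: "((\<lambda>\<phi>. \<phi> / 2 - sin \<phi> * cos \<phi> / 2) has_real_derivative (sin x)\<^sup>2) (at x within A)" for x A
  proof -
    have "(1::real) = (sin x)\<^sup>2 + (cos x)\<^sup>2" by simp
    then have 1: "1 / 2 - (cos x * cos x + - sin x * sin x) / 2 = (sin x)\<^sup>2"
      unfolding power2_eq_square by (simp add: field_simps)
    show ?thesis
      by (rule has_field_derivative_at_within, rule DERIV_cong[OF DERIV_diff[OF DERIV_cdivide[OF DERIV_ident] DERIV_cdivide[OF DERIV_mult[OF DERIV_sin DERIV_cos]]] 1])
  qed
  have "((\<lambda>\<phi>. (sin \<phi>)\<^sup>2) has_integral ((pi / 2 - sin pi * cos pi / 2) - (0 / 2 - sin 0 * cos 0 / 2))) {0..pi}"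
    by (rule fundamental_theorem_of_calculus)
       (auto intro!: d simp flip: has_real_derivative_iff_has_vector_derivative)
  then show ?thesis using True by (simp add: power2_eq_square)
next
  case False
  then have k: "real k > 0" by simp
  let ?F = "\<lambda>\<phi>. sin (real k * \<phi>) / (2 * real k) - sin (real (k + 2) * \<phi>) / (2 * real (k + 2))"
  have e: "cos (real k * \<phi>) / 2 - cos (real (k + 2) * \<phi>) / 2 = sin \<phi> * sin (real (Suc k) * \<phi>)" for \<phi>
  proof -
    have 1: "real (k + 2) * \<phi> = real (Suc k) * \<phi> + \<phi>" "real k * \<phi> = real (Suc k) * \<phi> - \<phi>"
      by (simp_all add: algebra_simps)
    show ?thesis unfolding 1 cos_add cos_diff by (simp add: field_simps)
  qed
  have "((\<lambda>\<phi>. cos (real k * \<phi>) / 2 - cos (real (k + 2) * \<phi>) / 2) has_integral (?F pi - ?F 0)) {0..pi}"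
  proof (rule fundamental_theorem_of_calculus)
    have d: "((\<lambda>\<phi>. sin (c * \<phi>) / (2 * c)) has_real_derivative cos (c * x) / 2) (at x within A)"
      if "c \<noteq> 0" for c x A
      using that by (auto intro!: derivative_eq_intros)
    fix x
    have "(?F has_real_derivative (cos (real k * x) / 2 - cos (real (k + 2) * x) / 2)) (at x within {0..pi})"
      using k by (intro DERIV_diff d) auto
    then show "(?F has_vector_derivative (cos (real k * x) / 2 - cos (real (k + 2) * x) / 2)) (at x within {0..pi})"
      by (simp only: has_real_derivative_iff_has_vector_derivative)
  qed simp
  moreover have "?F pi - ?F 0 = 0" using sin_npi[of k] sin_npi[of "k + 2"] by simp
  ultimately show ?thesis using False unfolding e by simp
qed

text \<open>By orthogonality of the sines only the term \<open>k = 0\<close> contributes, so every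
  nonempty truncation of the series integrates to \<open>pi / 2\<close>, while the remainder is
  uniformly of order \<open>|p| ^ K\<close>.\<close>

lemma has_integral_cden1:
  assumes p: "\<bar>p\<bar> < 1"
  shows "((\<lambda>\<phi>. (sin \<phi>)\<^sup>2 / cden p \<phi>) has_integral (pi / 2)) {0..pi}"
proof -
  let ?f = "\<lambda>\<phi>. (sin \<phi>)\<^sup>2 / cden p \<phi>"
  have nz: "cden p \<phi> \<noteq> 0" for \<phi> using cden_pos[OF p, of \<phi>] by simp
  have cont: "continuous_on {0..pi} ?f"
    using nz by (auto intro!: continuous_intros simp: cden_def)
  have int: "(?f has_integral integral {0..pi} ?f) {0..pi}"
    using cont integrable_continuous_interval by blast
  define C where "C = 2 / (1 - \<bar>p\<bar>)\<^sup>2"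
  have bound: "\<bar>integral {0..pi} ?f - pi / 2\<bar> \<le> C * \<bar>p\<bar> ^ K * pi" if K: "K \<ge> 1" for K
  proof -
    let ?S = "\<lambda>\<phi>. \<Sum>k<K. p ^ k * (sin \<phi> * sin (real (Suc k) * \<phi>))"
    have "(?S has_integral (\<Sum>k<K. p ^ k * (if k = 0 then pi / 2 else 0))) {0..pi}"
      by (intro has_integral_sum has_integral_mult_right has_integral_sin_sin) auto
    also have "(\<Sum>k<K. p ^ k * (if k = 0 then pi / 2 else 0)) = (\<Sum>k<K. if k = 0 then pi / 2 else 0)"
      by (intro sum.cong) auto
    also have "\<dots> = pi / 2" using K by (simp add: sum.delta)
    finally have S: "(?S has_integral (pi / 2)) {0..pi}" .
    have "norm (integral {0..pi} ?f - pi / 2) \<le> (C * \<bar>p\<bar> ^ K) * Henstock_Kurzweil_Integration.content {0..pi}"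
    proof (rule has_integral_bound_real[OF _ _ has_integral_diff[OF int S]])
      show "0 \<le> C * \<bar>p\<bar> ^ K" by (simp add: C_def)
      fix \<phi> :: real
      have Seq: "?S \<phi> = sin \<phi> * (\<Sum>k<K. p ^ k * sin (real (Suc k) * \<phi>))"
        by (simp add: sum_distrib_left algebra_simps)
      have "?f \<phi> - ?S \<phi> = sin \<phi> * (sin \<phi> - cden p \<phi> * (\<Sum>k<K. p ^ k * sin (real (Suc k) * \<phi>))) / cden p \<phi>"
        unfolding Seq using nz[of \<phi>] by (simp add: field_simps power2_eq_square)
      also have "\<dots> = sin \<phi> * (p ^ K * sin (real (Suc K) * \<phi>) - p ^ Suc K * sin (real K * \<phi>)) / cden p \<phi>"
        unfolding cden_sin_sum by (simp add: algebra_simps)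
      finally have eq: "?f \<phi> - ?S \<phi> = sin \<phi> * (p ^ K * sin (real (Suc K) * \<phi>) - p ^ Suc K * sin (real K * \<phi>)) / cden p \<phi>" .
      have pp: "\<bar>p\<bar> ^ Suc K \<le> \<bar>p\<bar> ^ K" using p by (simp add: mult_left_le_one_le)
      have "\<bar>p ^ K * sin (real (Suc K) * \<phi>)\<bar> \<le> \<bar>p\<bar> ^ K * 1"
        unfolding abs_mult power_abs by (intro mult_left_mono) auto
      moreover have "\<bar>p ^ Suc K * sin (real K * \<phi>)\<bar> \<le> \<bar>p\<bar> ^ Suc K * 1"
        unfolding abs_mult[of "p ^ Suc K"] power_abs by (intro mult_left_mono) auto
      ultimately have b2: "\<bar>p ^ K * sin (real (Suc K) * \<phi>) - p ^ Suc K * sin (real K * \<phi>)\<bar> \<le> 2 * \<bar>p\<bar> ^ K"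
        using pp by linarith
      have "\<bar>sin \<phi> * (p ^ K * sin (real (Suc K) * \<phi>) - p ^ Suc K * sin (real K * \<phi>))\<bar> \<le> 1 * (2 * \<bar>p\<bar> ^ K)"
        unfolding abs_mult[of "sin \<phi>"] by (intro mult_mono b2) auto
      then have "\<bar>?f \<phi> - ?S \<phi>\<bar> \<le> (2 * \<bar>p\<bar> ^ K) / (1 - \<bar>p\<bar>)\<^sup>2"
        unfolding eq abs_divide
        by (intro frac_le) (use p cden_ge[of p \<phi>] cden_nonneg[of p \<phi>] in auto)
      then show "norm (?f \<phi> - ?S \<phi>) \<le> C * \<bar>p\<bar> ^ K" by (simp add: C_def)
    qed auto
    then show ?thesis by simp
  qed
  have "(\<lambda>K. C * \<bar>p\<bar> ^ K * pi) \<longlonglongrightarrow> C * 0 * pi"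
    by (intro tendsto_intros LIMSEQ_power_zero) (use p in auto)
  then have "\<bar>integral {0..pi} ?f - pi / 2\<bar> \<le> C * 0 * pi"
    by (rule Lim_bounded2[where N = 1]) (use bound in auto)
  then have "integral {0..pi} ?f = pi / 2" by simp
  then show ?thesis using int by metis
qed

text \<open>All rests on \<open>p * cden q \<phi> - q * cden p \<phi> = (p - q) * (1 - p *
  q)\<close>, where the cosines cancel.\<close>

lemma cden_partial_fractions:
  assumes "A \<noteq> 0" "B \<noteq> 0" "p \<noteq> q" "p * q \<noteq> 1" and A: "A = cden p \<phi>" and B: "B = cden q \<phi>"
  shows "s / (A * B) = (p * (s / A) - q * (s / B)) / ((p - q) * (1 - p * q))"
proof -
  have e: "p * B - q * A = (p - q) * (1 - p * q)"
    unfolding A B cden_def by (simp add: power2_eq_square algebra_simps)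
  have "(p - q) * (1 - p * q) \<noteq> 0" using assms by auto
  moreover have "p * (s / A) - q * (s / B) = s * (p * B - q * A) / (A * B)"
    using assms(1,2) by (simp add: field_simps)
  ultimately show ?thesis unfolding e by simp
qed

lemma abs_mult_less_1: "\<bar>p\<bar> < 1 \<Longrightarrow> \<bar>q\<bar> \<le> 1 \<Longrightarrow> p * q < (1::real)"
proof -
  assume a: "\<bar>p\<bar> < 1" "\<bar>q\<bar> \<le> 1"
  have "p * q \<le> \<bar>p\<bar> * \<bar>q\<bar>" by (simp flip: abs_mult)
  also have "\<dots> \<le> \<bar>p\<bar> * 1" using a by (intro mult_left_mono) auto
  finally show ?thesis using a by simp
qed

lemma has_integral_cden2:
  assumes "\<bar>p\<bar> < 1" "\<bar>q\<bar> < 1" "p \<noteq> q"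
  shows "((\<lambda>\<phi>. (sin \<phi>)\<^sup>2 / (cden p \<phi> * cden q \<phi>)) has_integral (pi / 2 / (1 - p * q))) {0..pi}"
proof -
  have pq: "p * q < 1" using assms by (intro abs_mult_less_1) auto
  have "((\<lambda>\<phi>. (p * ((sin \<phi>)\<^sup>2 / cden p \<phi>) - q * ((sin \<phi>)\<^sup>2 / cden q \<phi>)) / ((p - q) * (1 - p * q)))
      has_integral ((p * (pi / 2) - q * (pi / 2)) / ((p - q) * (1 - p * q)))) {0..pi}"
    by (intro has_integral_divide has_integral_diff has_integral_mult_right has_integral_cden1 assms)
  moreover have "(p * (pi / 2) - q * (pi / 2)) / ((p - q) * (1 - p * q)) = pi / 2 / (1 - p * q)"
    unfolding left_diff_distrib[symmetric] using pq assms by simp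
  moreover have "(sin \<phi>)\<^sup>2 / (cden p \<phi> * cden q \<phi>) =
     (p * ((sin \<phi>)\<^sup>2 / cden p \<phi>) - q * ((sin \<phi>)\<^sup>2 / cden q \<phi>)) / ((p - q) * (1 - p * q))" for \<phi>
    using cden_pos[of p \<phi>] cden_pos[of q \<phi>] assms pq
    by (intro cden_partial_fractions[where \<phi>=\<phi>]) auto
  ultimately show ?thesis by simp
qed

text \<open>Partial fractions in \<open>p\<close> and \<open>q\<close>, with \<open>cden r\<close>
  carried along, reduce the integral to two factors. Distinctness of the roots comes from the
  division by \<open>p - q\<close> and is relaxed afterwards by limits.\<close>

lemma has_integral_cden3_distinct:
  assumes "\<bar>p\<bar> < 1" "\<bar>q\<bar> < 1" "\<bar>r\<bar> < 1" "p \<noteq> q" "p \<noteq> r" "q \<noteq> r"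
  shows "((\<lambda>\<phi>. (sin \<phi>)\<^sup>2 / (cden p \<phi> * cden q \<phi> * cden r \<phi>)) has_integral
    (pi / 2 / ((1 - p * q) * (1 - p * r) * (1 - q * r)))) {0..pi}"
proof -
  have pq: "p * q < 1" "p * r < 1" "q * r < 1" using assms by (auto intro!: abs_mult_less_1)
  have "((\<lambda>\<phi>. (p * ((sin \<phi>)\<^sup>2 / (cden p \<phi> * cden r \<phi>)) - q * ((sin \<phi>)\<^sup>2 / (cden q \<phi> * cden r \<phi>))) / ((p - q) * (1 - p * q)))
      has_integral ((p * (pi / 2 / (1 - p * r)) - q * (pi / 2 / (1 - q * r))) / ((p - q) * (1 - p * q)))) {0..pi}"
    by (intro has_integral_divide has_integral_diff has_integral_mult_right has_integral_cden2 assms)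
  moreover have "(p * (pi / 2 / (1 - p * r)) - q * (pi / 2 / (1 - q * r))) / ((p - q) * (1 - p * q))
     = pi / 2 / ((1 - p * q) * (1 - p * r) * (1 - q * r))"
  proof -
    have "p * (pi / 2 / (1 - p * r)) - q * (pi / 2 / (1 - q * r))
        = (p - q) * (pi / 2) / ((1 - p * r) * (1 - q * r))"
      using pq by (simp add: divide_simps) (simp add: algebra_simps)
    then show ?thesis using assms by simp
  qed
  moreover have "(sin \<phi>)\<^sup>2 / (cden p \<phi> * cden q \<phi> * cden r \<phi>) =
     (p * ((sin \<phi>)\<^sup>2 / (cden p \<phi> * cden r \<phi>)) - q * ((sin \<phi>)\<^sup>2 / (cden q \<phi> * cden r \<phi>))) / ((p - q) * (1 - p * q))" for \<phi>
  proof -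
    have "(sin \<phi>)\<^sup>2 / cden r \<phi> / (cden p \<phi> * cden q \<phi>) =
     (p * ((sin \<phi>)\<^sup>2 / cden r \<phi> / cden p \<phi>) - q * ((sin \<phi>)\<^sup>2 / cden r \<phi> / cden q \<phi>)) / ((p - q) * (1 - p * q))"
      using cden_pos[of p \<phi>] cden_pos[of q \<phi>] assms pq
      by (intro cden_partial_fractions[where \<phi>=\<phi>]) auto
    then show ?thesis by (simp add: mult_ac)
  qed
  ultimately show ?thesis by simp
qed

section \<open>Coinciding roots and roots on the unit circle\<close>

lemma tendsto_cden [tendsto_intros]:
  "(f \<longlongrightarrow> p) F \<Longrightarrow> ((\<lambda>k. cden (f k) \<phi>) \<longlongrightarrow> cden p \<phi>) F"
  unfolding cden_def by (intro tendsto_intros)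

lemma has_integral_dominated_limit:
  fixes f :: "nat \<Rightarrow> real \<Rightarrow> real"
  assumes f: "\<And>k. (f k has_integral I k) {a..b}"
    and le: "\<And>k x. x \<in> {a..b} \<Longrightarrow> \<bar>f k x\<bar> \<le> C"
    and lim: "\<And>x. x \<in> {a..b} \<Longrightarrow> (\<lambda>k. f k x) \<longlonglongrightarrow> g x" and I: "I \<longlonglongrightarrow> J"
  shows "(g has_integral J) {a..b}"
proof -
  have "g integrable_on {a..b}" "(\<lambda>k. integral {a..b} (f k)) \<longlonglongrightarrow> integral {a..b} g"
    using dominated_convergence[of f "{a..b}" "\<lambda>_. C" g] f le lim by (auto simp: has_integral_iff)
  moreover have "integral {a..b} (f k) = I k" for k using f by (simp add: integral_unique)
  ultimately show ?thesis using I by (simp add: has_integral_iff LIMSEQ_unique)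
qed

lemma sin2_div_cden_le: "(sin \<phi>)\<^sup>2 / cden q \<phi> \<le> 1"
  using sin2_le_cden[of \<phi> q] cden_nonneg[of q \<phi>] by (simp add: divide_le_eq)

lemma inverse_cden_le: "\<bar>p\<bar> < 1 \<Longrightarrow> 1 / cden p \<phi> \<le> 1 / (1 - \<bar>p\<bar>)\<^sup>2"
  using cden_ge[of p \<phi>] cden_pos[of p \<phi>] by (intro divide_left_mono) auto

text \<open>Supplies approximating sequences of roots that avoid the other roots.\<close>

lemma islimpt_minus_finite:
  fixes x :: "'a :: t1_space"
  assumes "x islimpt A" "finite F"
  shows "x islimpt (A - F)"
proof -
  have "x islimpt ((A - F) \<union> F)" using assms(1) by (rule islimpt_subset) auto
  then show ?thesis using islimpt_finite[OF assms(2), of x] by (simp only: islimpt_Un simp_thms)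
qed

text \<open>The root \<open>q\<close> is approached from inside the disc by roots different from
  \<open>p\<close> and \<open>r\<close>. Since \<open>sin^2 \<le> cden q\<close> uniformly in
  \<open>q\<close>, there is a constant majorant even if \<open>q\<close> ends on the unit
  circle.\<close>

lemma has_integral_cden3_strict:
  assumes "\<bar>p\<bar> < 1" "\<bar>q\<bar> \<le> 1" "\<bar>r\<bar> < 1" "p \<noteq> r"
  shows "((\<lambda>\<phi>. (sin \<phi>)\<^sup>2 / (cden p \<phi> * cden q \<phi> * cden r \<phi>)) has_integral
    (pi / 2 / ((1 - p * q) * (1 - p * r) * (1 - q * r)))) {0..pi}"
proof -
  have pq: "p * q < 1" "p * r < 1" "r * q < 1" using assms by (auto intro!: abs_mult_less_1)
  have "q islimpt {-1<..<1}"
  proof (cases "q = 1")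
    case True
    then show ?thesis using islimpt_greaterThanLessThan2[of "-1" "1::real"] by simp
  next
    case False
    then have "q islimpt {q<..<1}" using assms by (intro islimpt_greaterThanLessThan1) auto
    then show ?thesis by (rule islimpt_subset) (use assms in auto)
  qed
  then have "q islimpt ({-1<..<1} - {p,r})" by (rule islimpt_minus_finite) simp
  then obtain qk where qk: "\<And>k. qk k \<in> {-1<..<1} - {p,r} - {q}" "qk \<longlonglongrightarrow> q"
    unfolding islimpt_sequential by blast
  show ?thesis
  proof (rule has_integral_dominated_limit)
    fix k
    show "((\<lambda>\<phi>. (sin \<phi>)\<^sup>2 / (cden p \<phi> * cden (qk k) \<phi> * cden r \<phi>)) has_integral
       (pi / 2 / ((1 - p * qk k) * (1 - p * r) * (1 - qk k * r)))) {0..pi}"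
      using qk(1)[of k] assms by (intro has_integral_cden3_distinct) auto
  next
    fix k \<phi>
    have "(sin \<phi>)\<^sup>2 / cden (qk k) \<phi> * (1 / cden p \<phi>) * (1 / cden r \<phi>)
       \<le> 1 * (1 / (1 - \<bar>p\<bar>)\<^sup>2) * (1 / (1 - \<bar>r\<bar>)\<^sup>2)"
      using assms by (intro mult_mono sin2_div_cden_le inverse_cden_le)
        (auto intro!: mult_nonneg_nonneg divide_nonneg_nonneg cden_nonneg)
    then show "\<bar>(sin \<phi>)\<^sup>2 / (cden p \<phi> * cden (qk k) \<phi> * cden r \<phi>)\<bar> \<le> 1 / (1 - \<bar>p\<bar>)\<^sup>2 * (1 / (1 - \<bar>r\<bar>)\<^sup>2)"
      by (simp add: cden_nonneg mult_ac)
  next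
    fix \<phi> :: real
    show "(\<lambda>k. (sin \<phi>)\<^sup>2 / (cden p \<phi> * cden (qk k) \<phi> * cden r \<phi>)) \<longlonglongrightarrow> (sin \<phi>)\<^sup>2 / (cden p \<phi> * cden q \<phi> * cden r \<phi>)"
    proof (cases "sin \<phi> = 0")
      case False
      then show ?thesis using cden_pos'[of \<phi>] by (intro tendsto_intros qk) (auto simp: less_le)
    qed auto
  next
    show "(\<lambda>k. pi / 2 / ((1 - p * qk k) * (1 - p * r) * (1 - qk k * r))) \<longlonglongrightarrow> pi / 2 / ((1 - p * q) * (1 - p * r) * (1 - q * r))"
      using pq by (intro tendsto_intros qk) (auto simp: mult.commute)
  qed
qed

text \<open>This covers \<alpha> = 1, where the support reaches 0 and \<open>r = -1\<close>. If also
  \<open>q = 1\<close>, one factor \<open>sin^2\<close> has to control two vanishing denominators;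
  this works because they vanish at opposite ends of \<open>[0, pi]\<close>.\<close>

lemma has_integral_cden3_edge:
  assumes p: "\<bar>p\<bar> < 1" and q: "-1 < q" "q \<le> 1"
  shows "((\<lambda>\<phi>. (sin \<phi>)\<^sup>2 / (cden p \<phi> * cden q \<phi> * cden (-1) \<phi>)) has_integral
    (pi / 2 / ((1 - p * q) * (1 + p) * (1 + q)))) {0..pi}"
proof -
  have pq: "p * q < 1" using assms by (auto intro!: abs_mult_less_1)
  have "(-1) islimpt ({-1<..<-1/2::real} - {p})"
    by (intro islimpt_minus_finite islimpt_greaterThanLessThan1) auto
  then obtain rk where rk: "\<And>k. rk k \<in> {-1<..<-1/2} - {p} - {-1}" "rk \<longlonglongrightarrow> -1"
    unfolding islimpt_sequential by blast
  define C where "C = max 1 (1 / (1 - \<bar>q\<bar>)\<^sup>2)"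
  have *: "(sin \<phi>)\<^sup>2 / (cden q \<phi> * cden (rk k) \<phi>) \<le> C" for k \<phi>
  proof (cases "q = 1")
    case False
    then have "(sin \<phi>)\<^sup>2 / cden (rk k) \<phi> * (1 / cden q \<phi>) \<le> 1 * (1 / (1 - \<bar>q\<bar>)\<^sup>2)"
      using q by (intro mult_mono sin2_div_cden_le inverse_cden_le)
        (auto intro!: mult_nonneg_nonneg divide_nonneg_nonneg cden_nonneg)
    also have "\<dots> = 1 / (1 - \<bar>q\<bar>)\<^sup>2" by simp
    also have "\<dots> \<le> C" by (simp add: C_def)
    finally show ?thesis by (simp add: mult_ac)
  next
    case True
    show ?thesis
    proof (cases "sin \<phi> = 0")
      case True then show ?thesis by (simp add: C_def)
    next
      case False
      have c1: "0 \<le> 1 + cos \<phi>" using cos_ge_minus_one[of \<phi>] by linarith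
      have "cden (rk k) \<phi> = (1 + rk k)\<^sup>2 + 2 * (- rk k) * (1 + cos \<phi>)"
        by (simp add: cden_def power2_eq_square algebra_simps)
      \<comment> \<open>Here \<open>rk k < -1/2\<close> is used; the approximating roots were taken
        from that interval for this purpose.\<close>
      moreover have "1 * (1 + cos \<phi>) \<le> 2 * (- rk k) * (1 + cos \<phi>)"
        by (rule mult_right_mono) (use rk(1)[of k] c1 in simp_all)
      ultimately have r1: "1 + cos \<phi> \<le> cden (rk k) \<phi>"
        using zero_le_power2[of "1 + rk k"] by (metis add_increasing order_trans mult_1)
      have q1: "cden q \<phi> = 2 * (1 - cos \<phi>)" using True by (simp add: cden_def)
      have "(1 + cos \<phi>) * cden q \<phi> \<le> cden (rk k) \<phi> * cden q \<phi>"
        by (rule mult_right_mono[OF r1 cden_nonneg])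
      moreover have "(1 + cos \<phi>) * cden q \<phi> = 2 * (sin \<phi>)\<^sup>2"
        unfolding q1 sin_squared_eq by (simp add: power2_eq_square algebra_simps)
      ultimately have "2 * (sin \<phi>)\<^sup>2 \<le> cden q \<phi> * cden (rk k) \<phi>"
        by (metis mult.commute)
      then have "(sin \<phi>)\<^sup>2 \<le> 1 * (cden q \<phi> * cden (rk k) \<phi>)"
        using zero_le_power2[of "sin \<phi>"] by linarith
      then have "(sin \<phi>)\<^sup>2 / (cden q \<phi> * cden (rk k) \<phi>) \<le> 1"
        using False cden_pos'[of \<phi>] by (simp add: divide_le_eq)
      then show ?thesis by (simp add: C_def)
    qed
  qed
  have "((\<lambda>\<phi>. (sin \<phi>)\<^sup>2 / (cden p \<phi> * cden q \<phi> * cden (-1) \<phi>)) has_integral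
    (pi / 2 / ((1 - p * q) * (1 - p * -1) * (1 - q * -1)))) {0..pi}"
  proof (rule has_integral_dominated_limit)
    fix k
    show "((\<lambda>\<phi>. (sin \<phi>)\<^sup>2 / (cden p \<phi> * cden q \<phi> * cden (rk k) \<phi>)) has_integral
       (pi / 2 / ((1 - p * q) * (1 - p * rk k) * (1 - q * rk k)))) {0..pi}"
      using rk(1)[of k] assms by (intro has_integral_cden3_strict) auto
  next
    fix k \<phi>
    have "(sin \<phi>)\<^sup>2 / (cden q \<phi> * cden (rk k) \<phi>) * (1 / cden p \<phi>) \<le> C * (1 / (1 - \<bar>p\<bar>)\<^sup>2)"
      using assms by (intro mult_mono * inverse_cden_le)
        (auto intro!: mult_nonneg_nonneg divide_nonneg_nonneg cden_nonneg simp: C_def)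
    then show "\<bar>(sin \<phi>)\<^sup>2 / (cden p \<phi> * cden q \<phi> * cden (rk k) \<phi>)\<bar> \<le> C * (1 / (1 - \<bar>p\<bar>)\<^sup>2)"
      by (simp add: cden_nonneg mult_ac)
  next
    fix \<phi> :: real
    show "(\<lambda>k. (sin \<phi>)\<^sup>2 / (cden p \<phi> * cden q \<phi> * cden (rk k) \<phi>)) \<longlonglongrightarrow> (sin \<phi>)\<^sup>2 / (cden p \<phi> * cden q \<phi> * cden (-1) \<phi>)"
    proof (cases "sin \<phi> = 0")
      case False
      then show ?thesis using cden_pos'[of \<phi>] by (intro tendsto_intros rk) (auto simp: less_le)
    qed auto
  next
    show "(\<lambda>k. pi / 2 / ((1 - p * q) * (1 - p * rk k) * (1 - q * rk k))) \<longlonglongrightarrow> pi / 2 / ((1 - p * q) * (1 - p * -1) * (1 - q * -1))"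
      using pq p q by (intro tendsto_intros rk) auto
  qed
  then show ?thesis by simp
qed

lemma has_integral_cden3:
  assumes "\<bar>p\<bar> < 1" "\<bar>q\<bar> \<le> 1" "-1 \<le> r" "r < 0" "p \<noteq> r" "q * r \<noteq> 1"
  shows "((\<lambda>\<phi>. (sin \<phi>)\<^sup>2 / (cden p \<phi> * cden q \<phi> * cden r \<phi>)) has_integral
    (pi / 2 / ((1 - p * q) * (1 - p * r) * (1 - q * r)))) {0..pi}"
proof (cases "r = -1")
  case True
  then have "-1 < q" using assms by (auto simp: abs_le_iff less_le)
  then show ?thesis using has_integral_cden3_edge[of p q] assms True by (auto simp: algebra_simps)
qed (intro has_integral_cden3_strict; use assms in auto)

text \<open>For a nonnegative integrand, gauge integrability of the pulled back function already is
  absolute integrability, which the substitution rule demands.\<close>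

lemma nn_integral_change_of_variables_pos:
  fixes f g g' :: "real \<Rightarrow> real"
  assumes S: "S \<in> sets lebesgue"
    and der: "\<And>x. x \<in> S \<Longrightarrow> (g has_field_derivative g' x) (at x within S)"
    and inj: "inj_on g S"
    and f0: "\<And>x. x \<in> S \<Longrightarrow> 0 \<le> f (g x)"
    and I: "((\<lambda>x. \<bar>g' x\<bar> * f (g x)) has_integral I) S"
  shows "(\<integral>\<^sup>+x. indicator (g ` S) x * f x \<partial>lborel) = ennreal I"
proof -
  have "(\<lambda>x. \<bar>g' x\<bar> * f (g x)) absolutely_integrable_on S"
    using f0 I by (intro nonnegative_absolutely_integrable_1) (auto simp: has_integral_iff)
  then have "f absolutely_integrable_on (g ` S) \<and> integral (g ` S) f = I"
    using has_absolute_integral_change_of_variables_1'[OF S der inj, of f I] I by (auto simp: has_integral_iff)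
  then have "(f has_integral I) (g ` S)"
    by (auto simp: has_integral_iff absolutely_integrable_on_def)
  then show ?thesis using f0 by (intro nn_integral_has_integral_lebesgue) auto
qed

text \<open>Under \<open>x = 1 + \<alpha> + 2 sqrt \<alpha> cos \<phi>\<close> the three linear factors in \<open>x\<close> become multiples of \<open>cden p\<close>,
  \<open>cden q\<close> and \<open>cden r\<close>. Since \<open>cden (1 / p)\<close> is a multiple of \<open>cden p\<close>, the roots can be taken in the closed unit disc; the case
  distinctions for \<open>q\<close> and \<open>r\<close> are those of the two atoms.\<close>

lemma mp_ac_integral:
  assumes a: "\<alpha> > 0" and t: "t = \<theta> - 1" "\<theta> > 0" and y: "0 \<le> y" "y < 1" "y < \<alpha>"
    and r: "r = - sqrt \<alpha> \<and> kr = 1 \<and> \<alpha> \<le> 1 \<or> r = - 1 / sqrt \<alpha> \<and> kr = \<alpha> \<and> \<alpha> > 1"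
    and q: "q = t * sqrt \<alpha> \<and> kq = 1 \<and> \<bar>t * sqrt \<alpha>\<bar> \<le> 1 \<or> q = 1 / (t * sqrt \<alpha>) \<and> kq = \<alpha> * t\<^sup>2 \<and> \<bar>t * sqrt \<alpha>\<bar> > 1"
    and p: "p = - y / sqrt \<alpha>"
  shows "(\<integral>\<^sup>+x. ennreal (mp_density \<alpha> \<theta> x * (1 / (y * x + (\<alpha> - y) * (1 - y)))) \<partial>lborel) =
    ennreal (\<theta> / (kr * kq * ((1 - p * q) * (1 - p * r) * (1 - q * r))))" (is "?L = ennreal ?V")
    and "\<And>x. 0 \<le> mp_density \<alpha> \<theta> x"
    and "\<And>x. x \<in> {mp_left \<alpha><..<mp_right \<alpha>} \<Longrightarrow> x > 0"
proof -
  define w where "w = sqrt \<alpha>"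
  have w: "w > 0" "w * w = \<alpha>" "w\<^sup>2 = \<alpha>" using a by (auto simp: w_def)
  have w1: "w \<le> 1 \<longleftrightarrow> \<alpha> \<le> 1" by (simp add: w_def)
  \<comment> \<open>\<open>sqrt \<alpha>\<close> lies between 1 and \<alpha>, and \<open>y\<close>
    is below both. This places \<open>p\<close> inside the unit disc.\<close>
  have yw: "y < w"
  proof (cases "\<alpha> \<le> 1")
    case True
    then have "w \<le> 1" using w1 by simp
    then have "w * w \<le> w" using w by (intro mult_left_le) auto
    then show ?thesis using w y by simp
  qed (use y w1 in auto)
  define g where "g \<phi> = 1 + \<alpha> + 2 * w * cos \<phi>" for \<phi>
  define g' where "g' \<phi> = - 2 * w * sin \<phi>" for \<phi>
  have pw: "p = - y / w" using p by (simp add: w_def)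
  have p1: "\<bar>p\<bar> < 1" using yw y w by (simp add: pw abs_mult)
  have r': "-1 \<le> r" "r < 0" "p \<noteq> r" "kr > 0"
  proof -
    have "-1 \<le> r \<and> r < 0 \<and> p \<noteq> r \<and> kr > 0"
    proof (cases "\<alpha> \<le> 1")
      case True
      then have "r = - w" "kr = 1" using r by (auto simp: w_def)
      moreover have "p \<noteq> - w" using w y by (auto simp: pw field_simps)
      ultimately show ?thesis using w w1 True by auto
    next
      case False
      then have "r = - 1 / w" "kr = \<alpha>" using r by (auto simp: w_def)
      moreover have "p \<noteq> - 1 / w" using w y by (auto simp: pw field_simps)
      moreover have "1 / w < 1" using False w1 w by (simp add: not_le)
      ultimately show ?thesis using w a by auto
    qed
    then show "-1 \<le> r" "r < 0" "p \<noteq> r" "kr > 0" by auto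
  qed
  have q': "\<bar>q\<bar> \<le> 1" "kq > 0"
  proof -
    have "\<bar>q\<bar> \<le> 1 \<and> kq > 0"
    proof (cases "\<bar>t * w\<bar> \<le> 1")
      case True
      then show ?thesis using q by (auto simp: w_def)
    next
      case False
      then have "q = 1 / (t * w)" "kq = \<alpha> * t\<^sup>2" using q by (auto simp: w_def)
      moreover have "t \<noteq> 0" using False by auto
      moreover have "1 / \<bar>t * w\<bar> \<le> 1" using False by (subst divide_le_eq_1) auto
      ultimately show ?thesis using a by auto
    qed
    then show "\<bar>q\<bar> \<le> 1" "kq > 0" by auto
  qed
  \<comment> \<open>Both roots lie in the closed disc and \<open>r < 0\<close>, so the product is 1
    only for \<open>q = r = -1\<close>. That means \<alpha> = 1 and \<open>t = -1\<close>, that is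
    \<theta> = 0.\<close>
  have qr: "q * r \<noteq> 1"
  proof
    assume e: "q * r = 1"
    have "\<bar>q\<bar> * \<bar>r\<bar> = 1" using e by (simp flip: abs_mult)
    moreover have "\<bar>q\<bar> * \<bar>r\<bar> \<le> 1 * \<bar>r\<bar>" using q' by (intro mult_right_mono) auto
    moreover have "\<bar>r\<bar> \<le> 1" using r' by auto
    ultimately have "\<bar>r\<bar> = 1" by linarith
    then have rm: "r = -1" using r' by auto
    then have qm: "q = -1" using e by simp
    have "\<alpha> = 1"
    proof (cases "\<alpha> \<le> 1")
      case True
      then have "w = 1" using r rm by (auto simp: w_def)
      then show ?thesis using w by simp
    next
      case False
      then have "1 / w = 1" using r rm by (auto simp: w_def)
      then show ?thesis using w by simp
    qed
    then have "t = -1" using q qm by (auto simp: field_simps)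
    then show False using t by simp
  qed
  have fr: "g \<phi> = kr * cden r \<phi>" for \<phi>
  proof (cases "\<alpha> \<le> 1")
    case True
    then have "r = - w" "kr = 1" using r by (auto simp: w_def)
    then show ?thesis using w by (simp add: g_def cden_def)
  next
    case False
    then have "r = - 1 / w" "kr = w * w" using r w by (auto simp: w_def)
    moreover have "1 + w * w + 2 * w * cos \<phi> = w * w * (1 - 2 * (- 1 / w) * cos \<phi> + (- 1 / w)\<^sup>2)"
      using w(1) by (simp add: power2_eq_square field_simps)
    ultimately show ?thesis unfolding g_def cden_def w(2) by simp
  qed
  have fq: "g \<phi> * (1 - \<theta>) + \<theta> * (\<alpha> * \<theta> - \<alpha> + 1) = kq * cden q \<phi>" for \<phi>
  proof -
    have th: "\<theta> = 1 + t" using t by simp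
    have e: "g \<phi> * (1 - \<theta>) + \<theta> * (\<alpha> * \<theta> - \<alpha> + 1) = 1 - 2 * (t * w) * cos \<phi> + (t * w)\<^sup>2"
      unfolding th power_mult_distrib w(3) by (simp add: g_def power2_eq_square algebra_simps)
    show ?thesis
    proof (cases "\<bar>t * w\<bar> \<le> 1")
      case True
      then have "q = t * w" "kq = 1" using q by (auto simp: w_def)
      then show ?thesis unfolding e by (simp add: cden_def)
    next
      case False
      then have "q = 1 / (t * w)" "kq = (t * w)\<^sup>2" using q w by (auto simp: w_def power_mult_distrib mult.commute)
      moreover have "1 - 2 * z * c + z\<^sup>2 = z\<^sup>2 * (1 - 2 * (1 / z) * c + (1 / z)\<^sup>2)" if "z \<noteq> 0" for z c :: real
        using that by (simp add: power2_eq_square field_simps)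
      moreover have "t * w \<noteq> 0" using False by auto
      ultimately show ?thesis unfolding e cden_def by simp
    qed
  qed
  \<comment> \<open>For \<open>y > 0\<close> the linear factor is \<open>y (x + s)\<close> with
    \<open>s = (\<alpha> - y) (1 - y) / y\<close>, and its zero at \<open>-s\<close> corresponds to
    the root \<open>p = - y / sqrt \<alpha>\<close>.\<close>
  have fp: "y * g \<phi> + (\<alpha> - y) * (1 - y) = \<alpha> * cden p \<phi>" for \<phi>
  proof -
    have "\<alpha> * cden p \<phi> = w * w * cden p \<phi>" using w by simp
    also have "\<dots> = w * w + 2 * y * w * cos \<phi> + y * y"
      using w(1) by (simp add: cden_def pw power2_eq_square field_simps)
    finally show ?thesis using w by (simp add: g_def algebra_simps)
  qed
  have ab: "mp_left \<alpha> = 1 + \<alpha> - 2 * w" "mp_right \<alpha> = 1 + \<alpha> + 2 * w"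
    using w by (auto simp: mp_left_def mp_right_def w_def[symmetric] power2_eq_square algebra_simps)
  have sq: "sqrt ((mp_right \<alpha> - g \<phi>) * (g \<phi> - mp_left \<alpha>)) = 2 * w * sin \<phi>" if "\<phi> \<in> {0<..<pi}" for \<phi>
  proof -
    have "(mp_right \<alpha> - g \<phi>) * (g \<phi> - mp_left \<alpha>) = (2 * w) * (2 * w) * (1 - cos \<phi> * cos \<phi>)"
      unfolding ab g_def by (simp add: algebra_simps)
    also have "\<dots> = (2 * w * sin \<phi>)\<^sup>2"
      by (simp add: power2_eq_square[symmetric] power_mult_distrib sin_squared_eq[symmetric])
    finally show ?thesis using w sin_gt_zero[of \<phi>] that by simp
  qed
  have gin: "g \<phi> \<in> {mp_left \<alpha><..<mp_right \<alpha>}" if "\<phi> \<in> {0<..<pi}" for \<phi>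
  proof -
    have "cos \<phi> < cos 0" "cos pi < cos \<phi>" using that by (intro cos_monotone_0_pi; simp)+
    then have "w * cos \<phi> < w * 1" "w * (-1) < w * cos \<phi>" using w(1) mult_strict_left_mono[of "cos \<phi>" 1 w] mult_strict_left_mono[of "-1" "cos \<phi>" w] by simp_all
    then show ?thesis unfolding ab g_def by auto
  qed
  have img: "g ` {0<..<pi} = {mp_left \<alpha><..<mp_right \<alpha>}"
  proof (intro equalityI subsetI)
    fix x assume x: "x \<in> {mp_left \<alpha><..<mp_right \<alpha>}"
    define c where "c = (x - 1 - \<alpha>) / (2 * w)"
    have c: "-1 < c" "c < 1" using x w by (auto simp: c_def ab field_simps)
    have "g (arccos c) = x" using c w by (simp add: g_def c_def)
    moreover have "arccos c \<in> {0<..<pi}" using arccos_lt_bounded[of c] c by auto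
    ultimately show "x \<in> g ` {0<..<pi}" by blast
  qed (use gin in auto)
  have "g \<phi> > 0" if "\<phi> \<in> {0<..<pi}" for \<phi>
    unfolding fr using r' cden_pos'[of \<phi> r] sin_gt_zero[of \<phi>] that by (intro mult_pos_pos) auto
  then show pos: "\<And>x. x \<in> {mp_left \<alpha><..<mp_right \<alpha>} \<Longrightarrow> x > 0" unfolding img[symmetric] by auto
  have qpos: "x * (1 - \<theta>) + \<theta> * (\<alpha> * \<theta> - \<alpha> + 1) > 0" if "x \<in> {mp_left \<alpha><..<mp_right \<alpha>}" for x
  proof -
    have "x \<in> g ` {0<..<pi}" using that img by simp
    then obtain \<phi> where "\<phi> \<in> {0<..<pi}" "x = g \<phi>" by blast
    then show ?thesis using fq[of \<phi>] q' cden_pos'[of \<phi> q] sin_gt_zero[of \<phi>] by auto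
  qed
  show nn: "0 \<le> mp_density \<alpha> \<theta> x" for x
  proof (cases "x \<in> {mp_left \<alpha><..<mp_right \<alpha>}")
    case True
    have "0 \<le> \<theta> * sqrt ((mp_right \<alpha> - x) * (x - mp_left \<alpha>)) /
        (2 * pi * x * (x * (1 - \<theta>) + \<theta> * (\<alpha> * \<theta> - \<alpha> + 1)))"
      using True pos[OF True] qpos[OF True] t by (intro divide_nonneg_pos mult_nonneg_nonneg mult_pos_pos) auto
    then show ?thesis using True by (simp add: mp_density_def)
  qed (simp add: mp_density_def)
  define f where "f x = mp_density \<alpha> \<theta> x * (1 / (y * x + (\<alpha> - y) * (1 - y)))" for x
  \<comment> \<open>The square root in the density and the Jacobian contribute one factor
    \<open>2 w sin \<phi>\<close> each; the resulting \<open>w^2\<close> cancels against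
    \<alpha>.\<close>
  have fg: "\<bar>g' \<phi>\<bar> * f (g \<phi>) = 2 * \<theta> / (pi * kr * kq) * ((sin \<phi>)\<^sup>2 / (cden p \<phi> * cden q \<phi> * cden r \<phi>))"
    if ph: "\<phi> \<in> {0<..<pi}" for \<phi>
  proof -
    have s: "sin \<phi> > 0" using sin_gt_zero[of \<phi>] ph by auto
    have "f (g \<phi>) = \<theta> * (2 * w * sin \<phi>) / (2 * pi * (kr * cden r \<phi>) * (kq * cden q \<phi>)) * (1 / (\<alpha> * cden p \<phi>))"
      using gin[OF ph] by (simp only: f_def mp_density_def sq[OF ph] fq fp indicator_simps fr[symmetric])
    moreover have "\<bar>g' \<phi>\<bar> = 2 * w * sin \<phi>" using s w by (simp add: g'_def abs_mult)
    ultimately have "\<bar>g' \<phi>\<bar> * f (g \<phi>) = (w * w) / \<alpha> * (2 * w * 0 + 2 * \<theta> / (pi * kr * kq) * ((sin \<phi>)\<^sup>2 / (cden p \<phi> * cden q \<phi> * cden r \<phi>)))"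
      by (simp add: power2_eq_square field_simps)
    then show ?thesis using w a by simp
  qed
  have "?L = (\<integral>\<^sup>+x. indicator (g ` {0<..<pi}) x * f x \<partial>lborel)"
    unfolding img f_def mp_density_def by (intro nn_integral_cong) (auto simp: indicator_def)
  also have "\<dots> = ennreal (2 * \<theta> / (pi * kr * kq) * (pi / 2 / ((1 - p * q) * (1 - p * r) * (1 - q * r))))"
  proof (rule nn_integral_change_of_variables_pos)
    show "(g has_field_derivative g' x) (at x within {0<..<pi})" for x
      unfolding g_def[abs_def] g'_def by (auto intro!: derivative_eq_intros)
    show "inj_on g {0<..<pi}"
    proof (rule inj_onI)
      fix x z assume xz: "x \<in> {0<..<pi}" "z \<in> {0<..<pi}" "g x = g z"
      then have "cos x = cos z" using w by (simp add: g_def)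
      then show "x = z" using xz cos_inj_pi[of x z] by auto
    qed
    show "0 \<le> f (g x)" if "x \<in> {0<..<pi}" for x
    proof -
      have "y * g x + (\<alpha> - y) * (1 - y) \<ge> 0" unfolding fp using a cden_nonneg by auto
      then show ?thesis using nn[of "g x"] by (simp add: f_def)
    qed
    have "((\<lambda>\<phi>. 2 * \<theta> / (pi * kr * kq) * ((sin \<phi>)\<^sup>2 / (cden p \<phi> * cden q \<phi> * cden r \<phi>))) has_integral
      2 * \<theta> / (pi * kr * kq) * (pi / 2 / ((1 - p * q) * (1 - p * r) * (1 - q * r)))) {0..pi}"
      by (intro has_integral_mult_right has_integral_cden3 p1 q' r' qr)
    then have "((\<lambda>\<phi>. 2 * \<theta> / (pi * kr * kq) * ((sin \<phi>)\<^sup>2 / (cden p \<phi> * cden q \<phi> * cden r \<phi>))) has_integral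
      2 * \<theta> / (pi * kr * kq) * (pi / 2 / ((1 - p * q) * (1 - p * r) * (1 - q * r)))) {0<..<pi}"
      by (simp add: has_integral_Icc_iff_Ioo)
    then show "((\<lambda>x. \<bar>g' x\<bar> * f (g x)) has_integral
      2 * \<theta> / (pi * kr * kq) * (pi / 2 / ((1 - p * q) * (1 - p * r) * (1 - q * r)))) {0<..<pi}"
      by (rule has_integral_eq[rotated]) (simp only: fg)
  qed (auto intro: lmeasurable_interval)
  also have "2 * \<theta> / (pi * kr * kq) * (pi / 2 / ((1 - p * q) * (1 - p * r) * (1 - q * r))) = ?V"
    by simp
  finally show "?L = ennreal ?V" .
qed

section \<open>The limit law as the sum of a density and two atoms\<close>

lemma nn_integral_add_measure:
  assumes s: "sets M = sets N" and f: "f \<in> borel_measurable M"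
  shows "(\<integral>\<^sup>+x. f x \<partial>add_measure M N) = (\<integral>\<^sup>+x. f x \<partial>M) + (\<integral>\<^sup>+x. f x \<partial>N)"
proof -
  note sA = sets_add_measure[of M N]
  have sp: "space (add_measure M N) = space M" "space N = space M"
    using sets_eq_imp_space_eq[OF sA] sets_eq_imp_space_eq[OF s] by auto
  have mA: "g \<in> borel_measurable (add_measure M N)" "g \<in> borel_measurable N" if "g \<in> borel_measurable M" for g :: "'a \<Rightarrow> ennreal"
    using that measurable_cong_sets[OF sA refl, of borel] measurable_cong_sets[OF s refl, of borel] by auto
  show ?thesis
    using f
  proof (induction rule: borel_measurable_induct)
    case (cong f g)
    have "integral\<^sup>N K f = integral\<^sup>N K g" if "space K = space M" for K
      by (rule nn_integral_cong) (use cong that in auto)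
    then show ?case using cong sp by simp
  next
    case (set A)
    have "(\<integral>\<^sup>+x. indicator A x \<partial>K) = emeasure K A" if "sets K = sets M" for K
      by (rule nn_integral_indicator) (use set that in simp)
    then show ?case using set s sA emeasure_add_measure[OF s set] by simp
  next
    case (mult u c)
    have "(\<integral>\<^sup>+x. c * u x \<partial>K) = c * (\<integral>\<^sup>+x. u x \<partial>K)" if "u \<in> borel_measurable K" for K
      using that by (rule nn_integral_cmult)
    from this[OF mult.hyps(2)] this[OF mA(1)[OF mult.hyps(2)]] this[OF mA(2)[OF mult.hyps(2)]] mult.IH
    show ?case by (simp only: distrib_left)
  next
    case (add u v)
    have "(\<integral>\<^sup>+x. v x + u x \<partial>K) = (\<integral>\<^sup>+x. v x \<partial>K) + (\<integral>\<^sup>+x. u x \<partial>K)"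
      if "v \<in> borel_measurable K" "u \<in> borel_measurable K" for K
      using that by (rule nn_integral_add)
    from this[OF add.hyps(3) add.hyps(1)] this[OF mA(1)[OF add.hyps(3)] mA(1)[OF add.hyps(1)]] this[OF mA(2)[OF add.hyps(3)] mA(2)[OF add.hyps(1)]] add.IH
    show ?case by (simp only: add_ac)
  next
    case (seq U)
    have sup: "(SUP i. U i) = (\<lambda>x. SUP i. U i x)" by (simp add: fun_eq_iff image_comp)
    have *: "(\<integral>\<^sup>+x. (SUP i. U i) x \<partial>K) = (SUP i. \<integral>\<^sup>+x. U i x \<partial>K)"
      if "\<And>i. U i \<in> borel_measurable K" for K
      unfolding sup by (rule nn_integral_monotone_convergence_SUP[OF seq.hyps(3) that])
    have inc: "incseq (\<lambda>i. \<integral>\<^sup>+x. U i x \<partial>K)" for K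
      unfolding incseq_def
    proof (intro allI impI nn_integral_mono)
      fix i j :: nat and x assume "i \<le> j"
      then have "U i \<le> U j" using seq.hyps(3) by (simp add: incseq_def)
      then show "U i x \<le> U j x" by (simp add: le_fun_def)
    qed
    have mU: "U i \<in> borel_measurable (add_measure M N)" "U i \<in> borel_measurable N" for i
      by (rule mA(1)[OF seq.hyps(1)], rule mA(2)[OF seq.hyps(1)])
    have "(\<integral>\<^sup>+x. (SUP i. U i) x \<partial>add_measure M N) = (SUP i. (\<integral>\<^sup>+x. U i x \<partial>M) + (\<integral>\<^sup>+x. U i x \<partial>N))"
      unfolding *[OF mU(1)] seq.IH ..
    also have "\<dots> = (SUP i. \<integral>\<^sup>+x. U i x \<partial>M) + (SUP i. \<integral>\<^sup>+x. U i x \<partial>N)"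
      by (rule ennreal_SUP_add[OF inc[of M] inc[of N]])
    finally show ?case unfolding *[OF seq.hyps(1)] *[OF mU(2)] .
  qed
qed

lemma measurable_mp_density [measurable]: "mp_density \<alpha> \<theta> \<in> borel_measurable borel"
  unfolding mp_density_def[abs_def] by measurable

lemma sets_mp_spiked: "sets (mp_spiked \<alpha> \<theta>) = sets borel"
  by (simp add: mp_spiked_def sets_add_measure)

lemma nn_integral_mp_spiked:
  assumes [measurable]: "f \<in> borel_measurable borel"
  shows "(\<integral>\<^sup>+x. f x \<partial>mp_spiked \<alpha> \<theta>) =
    (\<integral>\<^sup>+x. ennreal (mp_density \<alpha> \<theta> x) * f x \<partial>lborel)
      + (if \<alpha> < 1 then ennreal (mp_c \<alpha> \<theta>) * f 0 else 0)
      + (if \<bar>\<theta> - 1\<bar> > 1 / sqrt \<alpha> then ennreal (mp_d \<alpha> \<theta>) * f (mp_x \<alpha> \<theta>) else 0)"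
proof -
  have s: "sets (density lborel (\<lambda>x. ennreal (mp_density \<alpha> \<theta> x))) = sets borel"
    "sets (if \<alpha> < 1 then scale_measure (ennreal (mp_c \<alpha> \<theta>)) (return borel 0) else null_measure borel) = sets borel"
    "sets (if \<bar>\<theta> - 1\<bar> > 1 / sqrt \<alpha> then scale_measure (ennreal (mp_d \<alpha> \<theta>)) (return borel (mp_x \<alpha> \<theta>)) else null_measure borel) = sets borel"
    by auto
  have "(\<integral>\<^sup>+x. f x \<partial>(if \<alpha> < 1 then scale_measure (ennreal (mp_c \<alpha> \<theta>)) (return borel 0) else null_measure borel)) =
      (if \<alpha> < 1 then ennreal (mp_c \<alpha> \<theta>) * f 0 else 0)"
    by (simp add: nn_integral_scale_measure nn_integral_return)
  moreover have "(\<integral>\<^sup>+x. f x \<partial>(if \<bar>\<theta> - 1\<bar> > 1 / sqrt \<alpha> then scale_measure (ennreal (mp_d \<alpha> \<theta>)) (return borel (mp_x \<alpha> \<theta>)) else null_measure borel)) =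
      (if \<bar>\<theta> - 1\<bar> > 1 / sqrt \<alpha> then ennreal (mp_d \<alpha> \<theta>) * f (mp_x \<alpha> \<theta>) else 0)"
    by (simp add: nn_integral_scale_measure nn_integral_return)
  ultimately show ?thesis
    unfolding mp_spiked_def using s
    by (simp add: nn_integral_add_measure sets_add_measure measurable_cong_sets[OF sets_add_measure refl] nn_integral_density)
qed

text \<open>One test function serves for mass and transform: at \<open>y = 0\<close> it is the
  constant \<open>1 / \<alpha>\<close>, and for \<open>y > 0\<close> it is
  \<open>1 / (y (x + s))\<close> with \<open>s = (\<alpha> - y) (1 - y) / y\<close>. The absolutely
  continuous part has different closed forms according to \<open>\<alpha> \<le> 1\<close> and to the
  presence of the spike atom, but adding the atoms always leads to the same rational
  function.\<close>

lemma mp_spiked_total: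
  assumes a: "\<alpha> > 0" and th: "\<theta> \<ge> 0" "\<not> (\<alpha> = 1 \<and> \<theta> = 0)" and y: "0 \<le> y" "y < 1" "y < \<alpha>"
  shows "(\<integral>\<^sup>+x. ennreal (1 / (y * x + (\<alpha> - y) * (1 - y))) \<partial>mp_spiked \<alpha> \<theta>) = ennreal (1 / ((\<alpha> - y) * (1 + (\<theta> - 1) * y)))"
    and "AE x in mp_spiked \<alpha> \<theta>. 0 \<le> x"
proof -
  define t where "t = \<theta> - 1"
  define w where "w = sqrt \<alpha>"
  have w: "w > 0" "w * w = \<alpha>" using a by (auto simp: w_def)
  have w1: "w \<le> 1 \<longleftrightarrow> \<alpha> \<le> 1" by (simp add: w_def)
  have theta: "\<theta> = 1 + t" by (simp add: t_def)
  have t1: "t \<ge> -1" using th by (simp add: t_def)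
  define spike where "spike \<longleftrightarrow> \<bar>t * w\<bar> > 1"
  have spike: "\<bar>\<theta> - 1\<bar> > 1 / sqrt \<alpha> \<longleftrightarrow> spike"
    using w by (simp add: spike_def t_def w_def[symmetric] divide_less_eq abs_mult)
  have yp: "1 - y > 0" "\<alpha> - y > 0" using y by auto
  have ty1: "1 + t * y > 0"
  proof (cases "t \<ge> 0")
    case True then show ?thesis using y by (intro add_pos_nonneg mult_nonneg_nonneg) auto
  next
    case False
    then have "- t * y \<le> 1 * y" using t1 y by (intro mult_right_mono) auto
    then show ?thesis using y by simp
  qed
  \<comment> \<open>A spike forces \<open>t\<close> and \<open>\<alpha> t + 1\<close> to have the
    same sign. For \<open>t < 0\<close> one has \<open>|t| \<le> 1\<close> from \<theta> \<ge> 0,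
    hence \<open>w > 1\<close> and \<open>\<alpha> |t| = w (|t| w) > w > 1\<close>.\<close>
  have tneg: "t * (\<alpha> * t + 1) > 0" "t \<noteq> 0" "\<alpha> * t + y \<noteq> 0" "\<alpha> * t\<^sup>2 > 1" if sp: spike
  proof -
    have tw: "\<bar>t\<bar> * w > 1" using sp w by (simp add: spike_def abs_mult)
    show t0: "t \<noteq> 0" using tw by auto
    have "1 < (\<bar>t\<bar> * w) * (\<bar>t\<bar> * w)" using tw by (metis less_trans mult.right_neutral mult_strict_mono' less_eq_real_def zero_less_one zero_le_one)
    also have "\<dots> = \<alpha> * t\<^sup>2" using w by (simp add: power2_eq_square algebra_simps flip: abs_mult)
    finally show "\<alpha> * t\<^sup>2 > 1" .
    have *: "\<alpha> * t + 1 < 0 \<and> \<alpha> * t + y < 0" if neg: "t < 0"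
    proof -
      have "\<bar>t\<bar> \<le> 1" using neg t1 by auto
      then have "\<bar>t\<bar> * w \<le> 1 * w" using w by (intro mult_right_mono) auto
      then have "w > 1" using tw by simp
      moreover have "w * 1 < w * (\<bar>t\<bar> * w)" using tw w by (intro mult_strict_left_mono) auto
      moreover have "w * (\<bar>t\<bar> * w) = - (\<alpha> * t)" using neg w by (simp add: algebra_simps)
      ultimately show ?thesis using y by auto
    qed
    show "t * (\<alpha> * t + 1) > 0"
    proof (cases "t > 0")
      case True then show ?thesis using a by (intro mult_pos_pos add_pos_pos) auto
    next
      case False then show ?thesis using * t0 by (intro mult_neg_neg) auto
    qed
    show "\<alpha> * t + y \<noteq> 0"
    proof (cases "t > 0")
      case True then show ?thesis using a y by (metis add_pos_nonneg less_numeral_extra(3) mult_pos_pos)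
    next
      case False then show ?thesis using * t0 by auto
    qed
  qed
  have B0: "\<alpha> * t + 1 \<noteq> 0" if spike using tneg(1)[OF that] by auto
  have xnn: "0 \<le> mp_x \<alpha> \<theta>" if sp: spike
  proof -
    have "mp_x \<alpha> \<theta> = \<theta> * (t * (\<alpha> * t + 1)) / t\<^sup>2"
      using tneg(2)[OF sp] unfolding mp_x_def theta by (simp add: power2_eq_square field_simps)
    then show ?thesis using th tneg(1)[OF sp] by simp
  qed
  have d: "mp_d \<alpha> \<theta> = (\<alpha> * t\<^sup>2 - 1) / (t * (\<alpha> * t + 1))" if sp: spike
  proof -
    have "1 + 1 / (\<alpha> * t) = (\<alpha> * t + 1) / (\<alpha> * t)" using tneg(2)[OF sp] a by (simp add: field_simps)
    moreover have "1 - 1 / (\<alpha> * t\<^sup>2) = (\<alpha> * t\<^sup>2 - 1) / (\<alpha> * t\<^sup>2)" using tneg(2)[OF sp] a by (simp add: field_simps)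
    ultimately show ?thesis
      using tneg(2)[OF sp] B0[OF sp] a unfolding mp_d_def theta by (simp add: power2_eq_square)
  qed
  have dnn: "0 \<le> mp_d \<alpha> \<theta>" if sp: spike
    unfolding d[OF sp] using tneg[OF sp] by (intro divide_nonneg_pos) auto
  have aT: "\<alpha> * t + 1 > 0" if "\<alpha> < 1"
  proof -
    have "\<alpha> * (-1) \<le> \<alpha> * t" using a t1 by (intro mult_left_mono) auto
    then show ?thesis using that by simp
  qed
  have c: "mp_c \<alpha> \<theta> = (1 - \<alpha>) / (\<alpha> * t + 1)" by (simp add: mp_c_def t_def)
  have cnn: "0 \<le> mp_c \<alpha> \<theta>" if "\<alpha> < 1" unfolding c using aT[OF that] that by (intro divide_nonneg_pos) auto
  define g where "g x = 1 / (y * x + (\<alpha> - y) * (1 - y))" for x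
  have gnn: "0 \<le> g x" if "0 \<le> x" for x unfolding g_def using y that by (intro divide_nonneg_nonneg add_nonneg_nonneg mult_nonneg_nonneg) auto
  have g0: "g 0 = 1 / ((\<alpha> - y) * (1 - y))" by (simp add: g_def)
  have gx: "mp_d \<alpha> \<theta> * g (mp_x \<alpha> \<theta>) = (\<alpha> * t\<^sup>2 - 1) / ((\<alpha> * t + 1) * (\<alpha> * t + y) * (1 + t * y))" if sp: spike
  proof -
    have "y * mp_x \<alpha> \<theta> + (\<alpha> - y) * (1 - y) = (\<alpha> * t + y) * (1 + t * y) / t"
      using tneg(2)[OF sp] unfolding mp_x_def theta by (simp add: field_simps)
    then show ?thesis using tneg(2)[OF sp] unfolding g_def d[OF sp] by simp
  qed
  obtain I where I: "(\<integral>\<^sup>+x. ennreal (mp_density \<alpha> \<theta> x * g x) \<partial>lborel) = ennreal I" "0 \<le> I"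
    "\<And>x. 0 \<le> mp_density \<alpha> \<theta> x" "\<And>x. mp_density \<alpha> \<theta> x \<noteq> 0 \<Longrightarrow> 0 \<le> x"
    "I + (if \<alpha> < 1 then mp_c \<alpha> \<theta> * g 0 else 0) + (if spike then mp_d \<alpha> \<theta> * g (mp_x \<alpha> \<theta>) else 0) = 1 / ((\<alpha> - y) * (1 + t * y))"
  \<comment> \<open>For \<theta> = 0 the density vanishes and all mass sits at 0: it is the first
    atom if \<alpha> < 1 and the spike atom, whose position is then 0, if \<alpha> > 1.\<close>
  proof (cases "\<theta> = 0")
    case True
    then have t: "t = -1" by (simp add: t_def)
    have dens: "mp_density \<alpha> \<theta> x = 0" for x using True by (simp add: mp_density_def)
    have sp: "spike \<longleftrightarrow> \<alpha> > 1" using w w1 by (auto simp: spike_def t not_le)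
    have "\<alpha> \<noteq> 1" using th True by auto
    have "0 + (if \<alpha> < 1 then mp_c \<alpha> \<theta> * g 0 else 0) + (if spike then mp_d \<alpha> \<theta> * g (mp_x \<alpha> \<theta>) else 0) = 1 / ((\<alpha> - y) * (1 + t * y))"
    proof (cases "\<alpha> < 1")
      case True
      then show ?thesis using sp by (simp add: c g0 t)
    next
      case False
      then have sp': spike using sp \<open>\<alpha> \<noteq> 1\<close> by auto
      have "mp_d \<alpha> \<theta> * g (mp_x \<alpha> \<theta>) = (\<alpha> - 1) / ((1 - \<alpha>) * (y - \<alpha>) * (1 - y))" unfolding gx[OF sp'] by (simp add: t)
      also have "\<dots> = 1 / ((\<alpha> - y) * (1 - y))"
        using yp \<open>\<alpha> \<noteq> 1\<close> by (simp add: divide_simps) (simp add: algebra_simps)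
      finally show ?thesis using False sp' by (simp add: t)
    qed
    then show ?thesis by (intro that[of 0]) (auto simp: dens)
  next
    case False
    then have th0: "\<theta> > 0" using th by auto
    then have t0: "t > -1" by (simp add: t_def)
    define r where "r = (if \<alpha> \<le> 1 then - sqrt \<alpha> else - 1 / sqrt \<alpha>)"
    define kr where "kr = (if \<alpha> \<le> 1 then 1 else \<alpha>)"
    define q where "q = (if spike then 1 / (t * sqrt \<alpha>) else t * sqrt \<alpha>)"
    define kq where "kq = (if spike then \<alpha> * t\<^sup>2 else 1)"
    define p where "p = - y / sqrt \<alpha>"
    define I where "I = \<theta> / (kr * kq * ((1 - p * q) * (1 - p * r) * (1 - q * r)))"
    have r: "r = - sqrt \<alpha> \<and> kr = 1 \<and> \<alpha> \<le> 1 \<or> r = - 1 / sqrt \<alpha> \<and> kr = \<alpha> \<and> \<alpha> > 1"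
      by (auto simp: r_def kr_def)
    have q: "q = t * sqrt \<alpha> \<and> kq = 1 \<and> \<bar>t * sqrt \<alpha>\<bar> \<le> 1 \<or> q = 1 / (t * sqrt \<alpha>) \<and> kq = \<alpha> * t\<^sup>2 \<and> \<bar>t * sqrt \<alpha>\<bar> > 1"
      by (auto simp: q_def kq_def spike_def w_def)
    note ac = mp_ac_integral[OF a t_def th0 y r q p_def]
    have pr: "p * r = (if \<alpha> \<le> 1 then y else y / \<alpha>)" using w by (simp add: p_def r_def w_def[symmetric])
    have pq: "p * q = (if spike then - y / (\<alpha> * t) else - t * y)" using w by (simp add: p_def q_def w_def[symmetric] mult.commute mult.left_commute)
    have qr: "q * r = (if spike then (if \<alpha> \<le> 1 then - 1 / t else - 1 / (\<alpha> * t)) else (if \<alpha> \<le> 1 then - t * \<alpha> else - t))"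
      using w by (simp add: q_def r_def w_def[symmetric] mult.commute mult.left_commute)
    have id: "I + (if \<alpha> < 1 then mp_c \<alpha> \<theta> * g 0 else 0) + (if spike then mp_d \<alpha> \<theta> * g (mp_x \<alpha> \<theta>) else 0) = 1 / ((\<alpha> - y) * (1 + t * y))"
    proof (cases "\<alpha> \<le> 1")
      case al: True
      have B: "\<alpha> * t + 1 > 0"
      proof -
        have "\<alpha> * (-1) < \<alpha> * t" using a t0 by (intro mult_strict_left_mono) auto
        then show ?thesis using al by simp
      qed
      have cc: "(if \<alpha> < 1 then mp_c \<alpha> \<theta> * g 0 else 0) = (1 - \<alpha>) / ((\<alpha> * t + 1) * ((\<alpha> - y) * (1 - y)))"
        using al unfolding c g0 by auto
      show ?thesis
      proof (cases spike)
        case sp: False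
        have "I = (1 + t) / ((1 + t * y) * (1 - y) * (\<alpha> * t + 1))"
          unfolding I_def pr pq qr using al sp by (simp add: kr_def kq_def theta algebra_simps)
        moreover have "(1 + t) / ((1 + t * y) * (1 - y) * (\<alpha> * t + 1)) + (1 - \<alpha>) / ((\<alpha> * t + 1) * ((\<alpha> - y) * (1 - y))) = 1 / ((\<alpha> - y) * (1 + t * y))"
          using yp B ty1 by (simp add: divide_simps) (simp add: algebra_simps)
        ultimately show ?thesis unfolding cc using sp by simp
      next
        case sp: True
        have tp: "t > 0"
        proof (rule ccontr)
          assume "\<not> t > 0"
          then have "t * (\<alpha> * t + 1) \<le> 0" using B by (intro mult_nonpos_nonneg) auto
          then show False using tneg(1)[OF sp] by simp
        qed
        have A: "\<alpha> * t + y > 0" using tp a y by (intro add_pos_nonneg) auto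
        have 1: "1 - - y / (\<alpha> * t) = (\<alpha> * t + y) / (\<alpha> * t)" "1 - - 1 / t = (1 + t) / t" using tp a by (auto simp: field_simps)
        have "I = (1 + t) / (1 * (\<alpha> * t\<^sup>2) * ((\<alpha> * t + y) / (\<alpha> * t) * (1 - y) * ((1 + t) / t)))"
          unfolding I_def pr pq qr using al sp by (simp only: kr_def kq_def theta if_True 1)
        also have "\<dots> = 1 / ((\<alpha> * t + y) * (1 - y))"
          using tp a t0 by (simp add: power2_eq_square)
        finally have I': "I = 1 / ((\<alpha> * t + y) * (1 - y))" .
        have "1 / ((\<alpha> * t + y) * (1 - y)) + (1 - \<alpha>) / ((\<alpha> * t + 1) * ((\<alpha> - y) * (1 - y)))
            + (\<alpha> * t\<^sup>2 - 1) / ((\<alpha> * t + 1) * (\<alpha> * t + y) * (1 + t * y)) = 1 / ((\<alpha> - y) * (1 + t * y))"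
          using yp B ty1 A by (simp add: divide_simps) (simp add: algebra_simps power2_eq_square)
        then show ?thesis unfolding cc I' using sp gx[OF sp] by simp
      qed
    next
      case al: False
      show ?thesis
      proof (cases spike)
        case sp: False
        have 1: "1 - y / \<alpha> = (\<alpha> - y) / \<alpha>" using a by (simp add: field_simps)
        have "I = (1 + t) / (\<alpha> * 1 * ((1 - - t * y) * ((\<alpha> - y) / \<alpha>) * (1 - - t)))"
          unfolding I_def pr pq qr using al sp by (simp only: kr_def kq_def theta if_False 1)
        also have "\<dots> = 1 / ((\<alpha> - y) * (1 + t * y))" using a t0 by simp
        finally show ?thesis using al sp by simp
      next
        case sp: True
        have 1: "1 - y / \<alpha> = (\<alpha> - y) / \<alpha>" "1 - - y / (\<alpha> * t) = (\<alpha> * t + y) / (\<alpha> * t)" "1 - - 1 / (\<alpha> * t) = (\<alpha> * t + 1) / (\<alpha> * t)"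
          using a tneg(2)[OF sp] by (auto simp: field_simps)
        have "I = (1 + t) / (\<alpha> * (\<alpha> * t\<^sup>2) * ((\<alpha> * t + y) / (\<alpha> * t) * ((\<alpha> - y) / \<alpha>) * ((\<alpha> * t + 1) / (\<alpha> * t))))"
          unfolding I_def pr pq qr using al sp by (simp only: kr_def kq_def theta if_True if_False 1)
        also have "\<dots> = (1 + t) * \<alpha> / ((\<alpha> * t + y) * (\<alpha> - y) * (\<alpha> * t + 1))"
          using a tneg(2)[OF sp] by (simp add: power2_eq_square)
        finally have I': "I = (1 + t) * \<alpha> / ((\<alpha> * t + y) * (\<alpha> - y) * (\<alpha> * t + 1))" .
        have "(1 + t) * \<alpha> / ((\<alpha> * t + y) * (\<alpha> - y) * (\<alpha> * t + 1))
            + (\<alpha> * t\<^sup>2 - 1) / ((\<alpha> * t + 1) * (\<alpha> * t + y) * (1 + t * y)) = 1 / ((\<alpha> - y) * (1 + t * y))"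
          using yp B0[OF sp] ty1 tneg(3)[OF sp] by (simp add: divide_simps) (simp add: algebra_simps power2_eq_square)
        then show ?thesis unfolding I' using sp al gx[OF sp] by simp
      qed
    qed
    have Inn: "0 \<le> I"
    proof -
      have "p * q \<le> 1" "p * r \<le> 1" "q * r \<le> 1"
      proof -
        have yw: "y < w"
        proof (cases "\<alpha> \<le> 1")
          case True
          then have "w * w \<le> w" using w w1 by (intro mult_left_le) auto
          then show ?thesis using w y by simp
        qed (use y w1 in auto)
        have p1: "\<bar>p\<bar> < 1" using yw y w by (simp add: p_def w_def[symmetric] abs_mult)
        have r1: "\<bar>r\<bar> \<le> 1" using w w1 by (auto simp: r_def w_def[symmetric] abs_mult)
        have q1: "\<bar>q\<bar> \<le> 1" using tneg(2) by (auto simp: q_def spike_def w_def abs_mult divide_le_eq_1)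
        show "p * q \<le> 1" "p * r \<le> 1" using abs_mult_less_1[OF p1 q1] abs_mult_less_1[OF p1 r1] by auto
        have "\<bar>q * r\<bar> \<le> 1 * 1" unfolding abs_mult using q1 r1 by (intro mult_mono) auto
        then show "q * r \<le> 1" by simp
      qed
      moreover have "kr \<ge> 0" "kq \<ge> 0" using a by (auto simp: kr_def kq_def)
      ultimately show ?thesis unfolding I_def using th0 by (intro divide_nonneg_nonneg mult_nonneg_nonneg) auto
    qed
    show ?thesis
    proof (rule that[OF _ Inn _ _ id])
      show "(\<integral>\<^sup>+x. ennreal (mp_density \<alpha> \<theta> x * g x) \<partial>lborel) = ennreal I"
        using ac(1) unfolding g_def I_def .
      show "0 \<le> x" if "mp_density \<alpha> \<theta> x \<noteq> 0" for x
      proof -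
        have "x \<in> {mp_left \<alpha><..<mp_right \<alpha>}" using that by (auto simp: mp_density_def indicator_def split: if_splits)
        then show ?thesis using ac(3) by force
      qed
    qed (rule ac(2))
  qed
  have "(\<integral>\<^sup>+x. ennreal (g x) \<partial>mp_spiked \<alpha> \<theta>) =
    (\<integral>\<^sup>+x. ennreal (mp_density \<alpha> \<theta> x) * ennreal (g x) \<partial>lborel)
      + (if \<alpha> < 1 then ennreal (mp_c \<alpha> \<theta>) * ennreal (g 0) else 0)
      + (if spike then ennreal (mp_d \<alpha> \<theta>) * ennreal (g (mp_x \<alpha> \<theta>)) else 0)"
    unfolding spike[symmetric] by (rule nn_integral_mp_spiked) (auto simp: g_def[abs_def])
  also have "(\<integral>\<^sup>+x. ennreal (mp_density \<alpha> \<theta> x) * ennreal (g x) \<partial>lborel) = ennreal I"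
    using I(1,3) by (simp add: ennreal_mult')
  also have "(if \<alpha> < 1 then ennreal (mp_c \<alpha> \<theta>) * ennreal (g 0) else 0) = ennreal (if \<alpha> < 1 then mp_c \<alpha> \<theta> * g 0 else 0)"
    using cnn by (simp add: ennreal_mult')
  also have "(if spike then ennreal (mp_d \<alpha> \<theta>) * ennreal (g (mp_x \<alpha> \<theta>)) else 0) = ennreal (if spike then mp_d \<alpha> \<theta> * g (mp_x \<alpha> \<theta>) else 0)"
    using dnn by (simp add: ennreal_mult')
  also have "ennreal I + ennreal (if \<alpha> < 1 then mp_c \<alpha> \<theta> * g 0 else 0) + ennreal (if spike then mp_d \<alpha> \<theta> * g (mp_x \<alpha> \<theta>) else 0) =
     ennreal (1 / ((\<alpha> - y) * (1 + t * y)))"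
    using I(2,5) cnn dnn gnn[of 0] gnn[OF xnn] by (simp flip: ennreal_plus)
  finally show "(\<integral>\<^sup>+x. ennreal (1 / (y * x + (\<alpha> - y) * (1 - y))) \<partial>mp_spiked \<alpha> \<theta>) = ennreal (1 / ((\<alpha> - y) * (1 + (\<theta> - 1) * y)))"
    unfolding g_def t_def .
  have "emeasure (mp_spiked \<alpha> \<theta>) {..<0} = (\<integral>\<^sup>+x. indicator {..<0} x \<partial>mp_spiked \<alpha> \<theta>)"
    by (simp add: sets_mp_spiked)
  also have "\<dots> = (\<integral>\<^sup>+x. ennreal (mp_density \<alpha> \<theta> x) * indicator {..<0} x \<partial>lborel)"
    using xnn by (subst nn_integral_mp_spiked) (auto simp: spike)
  also have "\<dots> = (\<integral>\<^sup>+x. 0 \<partial>(lborel :: real measure))"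
    using I(4) by (intro nn_integral_cong) (auto simp: indicator_def, metis ennreal_0 not_less)
  finally have "emeasure (mp_spiked \<alpha> \<theta>) {..<0} = 0" by simp
  then show "AE x in mp_spiked \<alpha> \<theta>. 0 \<le> x"
    by (intro AE_I[where N = "{..<0}"]) (auto simp: sets_mp_spiked not_le)
qed

section \<open>Weak convergence from Stieltjes transforms at negative reals\<close>

text \<open>Measurability is demanded for all \<open>n \<ge> 1\<close> instead of eventually: in a
  limit over \<open>k\<close> at fixed \<open>n\<close>, thresholds depending on \<open>k\<close>
  would leave no \<open>n\<close> at which all approximants are known to be measurable.\<close>

definition tends_prob :: "'w measure \<Rightarrow> (nat \<Rightarrow> 'w \<Rightarrow> real) \<Rightarrow> real \<Rightarrow> bool" where
  "tends_prob M Y c \<longleftrightarrow> (\<forall>n\<ge>1. Y n \<in> borel_measurable M) \<and>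
     (\<forall>\<epsilon>>0. (\<lambda>n. measure M {\<omega> \<in> space M. \<bar>Y n \<omega> - c\<bar> > \<epsilon>}) \<longlonglongrightarrow> 0)"

lemma tends_prob_imp_conv_in_prob: "tends_prob M Y c \<Longrightarrow> conv_in_prob M Y c"
  unfolding tends_prob_def conv_in_prob_def by (auto simp: eventually_sequentially)

lemma tends_probD:
  "tends_prob M Y c \<Longrightarrow> \<epsilon> > 0 \<Longrightarrow> (\<lambda>n. measure M {\<omega> \<in> space M. \<bar>Y n \<omega> - c\<bar> > \<epsilon>}) \<longlonglongrightarrow> 0"
  by (simp add: tends_prob_def)

lemma tends_prob_cong:
  assumes "tends_prob M Y c" "\<And>n \<omega>. n \<ge> 1 \<Longrightarrow> \<omega> \<in> space M \<Longrightarrow> Y n \<omega> = Z n \<omega>"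
  shows "tends_prob M Z c"
  unfolding tends_prob_def
proof (intro conjI allI impI)
  fix n :: nat assume "n \<ge> 1"
  then show "Z n \<in> borel_measurable M"
    using assms measurable_cong[of M "Y n" "Z n" borel] by (auto simp: tends_prob_def)
next
  fix \<epsilon> :: real assume "\<epsilon> > 0"
  then have "(\<lambda>n. measure M {\<omega> \<in> space M. \<bar>Y n \<omega> - c\<bar> > \<epsilon>}) \<longlonglongrightarrow> 0"
    using assms(1) by (auto simp: tends_prob_def)
  moreover have "eventually (\<lambda>n. measure M {\<omega> \<in> space M. \<bar>Y n \<omega> - c\<bar> > \<epsilon>} = measure M {\<omega> \<in> space M. \<bar>Z n \<omega> - c\<bar> > \<epsilon>}) sequentially"
    using assms(2) by (intro eventually_sequentiallyI[of 1] arg_cong[where f = "measure M"]) auto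
  ultimately show "(\<lambda>n. measure M {\<omega> \<in> space M. \<bar>Z n \<omega> - c\<bar> > \<epsilon>}) \<longlonglongrightarrow> 0"
    by (blast intro: Lim_transform_eventually)
qed

lemma tends_prob_const: "tends_prob M (\<lambda>n \<omega>. c) c"
  by (auto simp: tends_prob_def)

context prob_space
begin

text \<open>The approximation error may itself be random, provided it tends in probability to a
  deterministic \<open>dk k\<close> that becomes small. Measurability of \<open>Y n\<close> is
  inherited from the approximants at the same \<open>n\<close>.\<close>

lemma tends_prob_approx:
  assumes Y: "\<And>k. tends_prob M (Yk k) (ck k)" and D: "\<And>k. tends_prob M (Dk k) (dk k)"
    and le: "\<And>k n \<omega>. n \<ge> 1 \<Longrightarrow> \<omega> \<in> space M \<Longrightarrow> \<bar>Y n \<omega> - Yk k n \<omega>\<bar> \<le> Dk k n \<omega>"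
    and le': "\<And>k. \<bar>c - ck k\<bar> \<le> dk k" and d: "dk \<longlonglongrightarrow> 0"
    and lim: "\<And>n \<omega>. n \<ge> 1 \<Longrightarrow> \<omega> \<in> space M \<Longrightarrow> (\<lambda>k. Yk k n \<omega>) \<longlonglongrightarrow> Y n \<omega>"
  shows "tends_prob M Y c"
  unfolding tends_prob_def
proof (intro conjI allI impI)
  have measYk: "Yk k n \<in> borel_measurable M" "Dk k n \<in> borel_measurable M" if "n \<ge> 1" for k n
    using Y D that by (auto simp: tends_prob_def)
  show measY: "Y n \<in> borel_measurable M" if "n \<ge> 1" for n
    by (rule borel_measurable_LIMSEQ_real[where u = "\<lambda>k. Yk k n"]) (use that lim measYk in auto)
  fix \<epsilon> :: real assume e: "\<epsilon> > 0"
  \<comment> \<open>In \<open>|Y - c| \<le> Dk + |Yk - ck| + dk\<close> the two occurrences of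
    \<open>dk k\<close> and the two allowed deviations cost at most a quarter of \<epsilon>
    each.\<close>
  obtain k where k: "dk k < \<epsilon> / 4"
    using order_tendstoD(2)[OF d, of "\<epsilon> / 4"] e by (auto simp: eventually_sequentially)
  let ?A = "\<lambda>n. {\<omega> \<in> space M. \<bar>Yk k n \<omega> - ck k\<bar> > \<epsilon> / 4}"
  let ?B = "\<lambda>n. {\<omega> \<in> space M. \<bar>Dk k n \<omega> - dk k\<bar> > \<epsilon> / 4}"
  have lim0: "(\<lambda>n. measure M (?A n) + measure M (?B n)) \<longlonglongrightarrow> 0 + 0"
    using e by (intro tendsto_add tends_probD[OF Y] tends_probD[OF D]) simp_all
  show "(\<lambda>n. measure M {\<omega> \<in> space M. \<bar>Y n \<omega> - c\<bar> > \<epsilon>}) \<longlonglongrightarrow> 0"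
  proof (rule tendsto_sandwich[OF _ _ tendsto_const])
    show "\<forall>\<^sub>F n in sequentially. measure M {\<omega> \<in> space M. \<bar>Y n \<omega> - c\<bar> > \<epsilon>} \<le> measure M (?A n) + measure M (?B n)"
    proof (rule eventually_sequentiallyI[of 1])
      fix n :: nat assume n: "n \<ge> 1"
      have [measurable]: "Y n \<in> borel_measurable M" "Yk k n \<in> borel_measurable M" "Dk k n \<in> borel_measurable M"
        using measY measYk n by auto
      have "{\<omega> \<in> space M. \<bar>Y n \<omega> - c\<bar> > \<epsilon>} \<subseteq> ?A n \<union> ?B n"
      proof
        fix \<omega> assume w: "\<omega> \<in> {\<omega> \<in> space M. \<bar>Y n \<omega> - c\<bar> > \<epsilon>}"
        then have "\<bar>Y n \<omega> - Yk k n \<omega>\<bar> \<le> Dk k n \<omega>" using le n by auto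
        then have "\<bar>Yk k n \<omega> - ck k\<bar> > \<epsilon> / 4 \<or> \<bar>Dk k n \<omega> - dk k\<bar> > \<epsilon> / 4"
          using le'[of k] k w by (simp only: mem_Collect_eq) linarith
        then show "\<omega> \<in> ?A n \<union> ?B n" using w by blast
      qed
      then have "measure M {\<omega> \<in> space M. \<bar>Y n \<omega> - c\<bar> > \<epsilon>} \<le> measure M (?A n \<union> ?B n)"
        by (intro finite_measure_mono) measurable
      also have "\<dots> \<le> measure M (?A n) + measure M (?B n)" by (intro measure_Un_le) measurable
      finally show "measure M {\<omega> \<in> space M. \<bar>Y n \<omega> - c\<bar> > \<epsilon>} \<le> measure M (?A n) + measure M (?B n)" .
    qed
  qed (use lim0 in \<open>auto simp: measure_nonneg\<close>)
qed

lemma tends_prob_add: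
  assumes Y: "tends_prob M Y c" and Z: "tends_prob M Z d"
  shows "tends_prob M (\<lambda>n \<omega>. Y n \<omega> + Z n \<omega>) (c + d)"
  unfolding tends_prob_def
proof (intro conjI allI impI)
  fix n :: nat assume "n \<ge> 1"
  then show "(\<lambda>\<omega>. Y n \<omega> + Z n \<omega>) \<in> borel_measurable M"
    using Y Z by (intro borel_measurable_add) (auto simp: tends_prob_def)
next
  fix \<epsilon> :: real assume e: "\<epsilon> > 0"
  let ?A = "\<lambda>n. {\<omega> \<in> space M. \<bar>Y n \<omega> - c\<bar> > \<epsilon> / 2}"
  let ?B = "\<lambda>n. {\<omega> \<in> space M. \<bar>Z n \<omega> - d\<bar> > \<epsilon> / 2}"
  have lim0: "(\<lambda>n. measure M (?A n) + measure M (?B n)) \<longlonglongrightarrow> 0 + 0"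
    using e by (intro tendsto_add tends_probD[OF Y] tends_probD[OF Z]) simp_all
  show "(\<lambda>n. measure M {\<omega> \<in> space M. \<bar>Y n \<omega> + Z n \<omega> - (c + d)\<bar> > \<epsilon>}) \<longlonglongrightarrow> 0"
  proof (rule tendsto_sandwich[OF _ _ tendsto_const])
    show "\<forall>\<^sub>F n in sequentially. measure M {\<omega> \<in> space M. \<bar>Y n \<omega> + Z n \<omega> - (c + d)\<bar> > \<epsilon>} \<le> measure M (?A n) + measure M (?B n)"
    proof (rule eventually_sequentiallyI[of 1])
      fix n :: nat assume n: "n \<ge> 1"
      have [measurable]: "Y n \<in> borel_measurable M" "Z n \<in> borel_measurable M"
        using Y Z n by (auto simp: tends_prob_def)
      have "measure M {\<omega> \<in> space M. \<bar>Y n \<omega> + Z n \<omega> - (c + d)\<bar> > \<epsilon>} \<le> measure M (?A n \<union> ?B n)"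
      proof (intro finite_measure_mono subsetI)
        fix \<omega> assume w: "\<omega> \<in> {\<omega> \<in> space M. \<bar>Y n \<omega> + Z n \<omega> - (c + d)\<bar> > \<epsilon>}"
        have "\<bar>Y n \<omega> + Z n \<omega> - (c + d)\<bar> \<le> \<bar>Y n \<omega> - c\<bar> + \<bar>Z n \<omega> - d\<bar>" by linarith
        then show "\<omega> \<in> ?A n \<union> ?B n" using w by auto
      qed measurable
      also have "\<dots> \<le> measure M (?A n) + measure M (?B n)" by (intro measure_Un_le) measurable
      finally show "measure M {\<omega> \<in> space M. \<bar>Y n \<omega> + Z n \<omega> - (c + d)\<bar> > \<epsilon>} \<le> measure M (?A n) + measure M (?B n)" .
    qed
  qed (use lim0 in \<open>auto simp: measure_nonneg\<close>)
qed

lemma tends_prob_cmult: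
  assumes Y: "tends_prob M Y c"
  shows "tends_prob M (\<lambda>n \<omega>. a * Y n \<omega>) (a * c)"
proof (cases "a = 0")
  case False
  show ?thesis unfolding tends_prob_def
  proof (intro conjI allI impI)
    fix n :: nat assume "n \<ge> 1"
    then show "(\<lambda>\<omega>. a * Y n \<omega>) \<in> borel_measurable M"
      using Y by (intro borel_measurable_times) (auto simp: tends_prob_def)
  next
    fix \<epsilon> :: real assume e: "\<epsilon> > 0"
    have "\<bar>a * y - a * c\<bar> > \<epsilon> \<longleftrightarrow> \<bar>y - c\<bar> > \<epsilon> / \<bar>a\<bar>" for y
    proof -
      have "\<bar>a * y - a * c\<bar> = \<bar>a\<bar> * \<bar>y - c\<bar>" by (simp flip: abs_mult right_diff_distrib)
      then show ?thesis using False by (simp add: divide_less_eq mult.commute)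
    qed
    then show "(\<lambda>n. measure M {\<omega> \<in> space M. \<bar>a * Y n \<omega> - a * c\<bar> > \<epsilon>}) \<longlonglongrightarrow> 0"
      using Y e False by (simp add: tends_prob_def)
  qed
qed (simp add: tends_prob_const)

end

definition bounded_borel :: "(real \<Rightarrow> real) \<Rightarrow> bool" where
  "bounded_borel f \<longleftrightarrow> f \<in> borel_measurable borel \<and> (\<exists>B. \<forall>x. \<bar>f x\<bar> \<le> B)"

lemma bounded_borelI: "f \<in> borel_measurable borel \<Longrightarrow> (\<And>x. \<bar>f x\<bar> \<le> B) \<Longrightarrow> bounded_borel f"
  by (auto simp: bounded_borel_def)

lemma bounded_borel_integrable:
  assumes "bounded_borel f" "prob_space P" "sets P = sets borel"
  shows "integrable P f"
proof -
  interpret prob_space P by fact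
  have "f \<in> borel_measurable P" using assms by (simp add: bounded_borel_def measurable_cong_sets[OF assms(3) refl])
  moreover obtain B where "\<And>x. \<bar>f x\<bar> \<le> B" using assms(1) by (auto simp: bounded_borel_def)
  ultimately show ?thesis by (intro integrable_const_bound[where B = B]) auto
qed

lemma bounded_borel_cmult: "bounded_borel f \<Longrightarrow> bounded_borel (\<lambda>x. a * f x)"
  unfolding bounded_borel_def
proof (elim conjE exE, intro conjI)
  fix B assume "\<forall>x. \<bar>f x\<bar> \<le> B"
  then show "\<exists>B. \<forall>x. \<bar>a * f x\<bar> \<le> B"
    by (intro exI[of _ "\<bar>a\<bar> * B"]) (auto simp: abs_mult intro: mult_left_mono)
qed auto

text \<open>The truncation \<open>max 0 x\<close> keeps the test functions bounded on the whole real line.\<close>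

locale random_half_line_measures = prob_space M for M :: "'w measure" +
  fixes \<mu> :: "nat \<Rightarrow> 'w \<Rightarrow> real measure" and \<nu> :: "real measure" and s0 :: real
  assumes mu: "\<And>n \<omega>. n \<ge> 1 \<Longrightarrow> \<omega> \<in> space M \<Longrightarrow>
      prob_space (\<mu> n \<omega>) \<and> sets (\<mu> n \<omega>) = sets borel \<and> (AE x in \<mu> n \<omega>. 0 \<le> x)"
    and nu: "prob_space \<nu>" "sets \<nu> = sets borel" "AE x in \<nu>. 0 \<le> x"
    and s0: "s0 > 0"
    and stieltjes: "\<And>s. s \<ge> s0 \<Longrightarrow>
      tends_prob M (\<lambda>n \<omega>. \<integral>x. 1 / (max 0 x + s) \<partial>\<mu> n \<omega>) (\<integral>x. 1 / (max 0 x + s) \<partial>\<nu>)"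
begin

definition good_test :: "(real \<Rightarrow> real) \<Rightarrow> bool" where
  "good_test f \<longleftrightarrow> bounded_borel f \<and> tends_prob M (\<lambda>n \<omega>. \<integral>x. f x \<partial>\<mu> n \<omega>) (\<integral>x. f x \<partial>\<nu>)"

lemma integrable_mu: "bounded_borel f \<Longrightarrow> n \<ge> 1 \<Longrightarrow> \<omega> \<in> space M \<Longrightarrow> integrable (\<mu> n \<omega>) f"
  using mu by (intro bounded_borel_integrable) auto

lemma integrable_nu: "bounded_borel f \<Longrightarrow> integrable \<nu> f"
  using nu by (intro bounded_borel_integrable) auto

lemma good_test_const: "good_test (\<lambda>x. c)"
  unfolding good_test_def
proof
  interpret nu: prob_space \<nu> by (rule nu)
  show "tends_prob M (\<lambda>n \<omega>. \<integral>x. c \<partial>\<mu> n \<omega>) (\<integral>x. c \<partial>\<nu>)"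
  proof (rule tends_prob_cong)
    show "tends_prob M (\<lambda>n \<omega>. c) (\<integral>x. c \<partial>\<nu>)" by (simp add: tends_prob_const nu.prob_space)
    fix n \<omega> assume "(n::nat) \<ge> 1" "\<omega> \<in> space M"
    then interpret mu: prob_space "\<mu> n \<omega>" using mu by auto
    show "c = (\<integral>x. c \<partial>\<mu> n \<omega>)" by (simp add: mu.prob_space)
  qed
qed (auto intro: bounded_borelI)

lemma good_test_cmult:
  assumes "good_test f" shows "good_test (\<lambda>x. a * f x)"
  using assms tends_prob_cmult[of "\<lambda>n \<omega>. \<integral>x. f x \<partial>\<mu> n \<omega>" "\<integral>x. f x \<partial>\<nu>" a]
  unfolding good_test_def by (simp add: bounded_borel_cmult)

lemma good_test_add:
  assumes "good_test f" "good_test g" shows "good_test (\<lambda>x. f x + g x)"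
  unfolding good_test_def
proof
  have b: "bounded_borel f" "bounded_borel g" using assms by (auto simp: good_test_def)
  then obtain B C where "\<And>x. \<bar>f x\<bar> \<le> B" "\<And>x. \<bar>g x\<bar> \<le> C" "f \<in> borel_measurable borel" "g \<in> borel_measurable borel"
    by (auto simp: bounded_borel_def)
  then show "bounded_borel (\<lambda>x. f x + g x)"
    by (intro bounded_borelI[where B = "B + C"]) (auto intro: order_trans[OF abs_triangle_ineq] add_mono)
  have "tends_prob M (\<lambda>n \<omega>. (\<integral>x. f x \<partial>\<mu> n \<omega>) + (\<integral>x. g x \<partial>\<mu> n \<omega>)) ((\<integral>x. f x \<partial>\<nu>) + (\<integral>x. g x \<partial>\<nu>))"
    using assms by (intro tends_prob_add) (auto simp: good_test_def)
  also have "(\<integral>x. f x \<partial>\<nu>) + (\<integral>x. g x \<partial>\<nu>) = (\<integral>x. f x + g x \<partial>\<nu>)" using b integrable_nu by simp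
  finally show "tends_prob M (\<lambda>n \<omega>. \<integral>x. f x + g x \<partial>\<mu> n \<omega>) (\<integral>x. f x + g x \<partial>\<nu>)"
    by (rule tends_prob_cong) (use b integrable_mu in simp)
qed

lemma good_test_sum: "(\<And>i. i \<in> A \<Longrightarrow> good_test (f i)) \<Longrightarrow> good_test (\<lambda>x. \<Sum>i\<in>A. f i x)"
  by (induction A rule: infinite_finite_induct) (auto simp: good_test_const good_test_add)

text \<open>A uniform error passes to the integral against every probability measure, so the
  approximation error is deterministic and common to all \<open>n\<close>.\<close>

lemma good_test_limit:
  assumes f: "f \<in> borel_measurable borel" and fk: "\<And>k. good_test (fk k)"
    and le: "\<And>k x. \<bar>f x - fk k x\<bar> \<le> d k" and d: "d \<longlonglongrightarrow> 0"
  shows "good_test f"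
proof -
  have bk: "bounded_borel (fk k)" for k using fk by (simp add: good_test_def)
  then obtain B where B: "\<And>x. \<bar>fk 0 x\<bar> \<le> B" by (auto simp: bounded_borel_def)
  have b: "bounded_borel f"
  proof (rule bounded_borelI[OF f])
    fix x show "\<bar>f x\<bar> \<le> B + d 0" using B[of x] le[of x 0] by linarith
  qed
  have le_int: "\<bar>(\<integral>x. f x \<partial>P) - (\<integral>x. fk k x \<partial>P)\<bar> \<le> d k" if P: "prob_space P" "sets P = sets borel" for P k
  proof -
    interpret P: prob_space P by fact
    have i: "integrable P f" "integrable P (fk k)" using b bk P by (auto intro: bounded_borel_integrable)
    have "\<bar>\<integral>x. f x - fk k x \<partial>P\<bar> \<le> (\<integral>x. \<bar>f x - fk k x\<bar> \<partial>P)" by (rule integral_abs_bound)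
    also have "\<dots> \<le> (\<integral>x. d k \<partial>P)" using i by (intro integral_mono integrable_abs integrable_diff le) auto
    finally show ?thesis using i by (simp add: P.prob_space)
  qed
  have "tends_prob M (\<lambda>n \<omega>. \<integral>x. f x \<partial>\<mu> n \<omega>) (\<integral>x. f x \<partial>\<nu>)"
  proof (rule tends_prob_approx[where Yk = "\<lambda>k n \<omega>. \<integral>x. fk k x \<partial>\<mu> n \<omega>" and ck = "\<lambda>k. \<integral>x. fk k x \<partial>\<nu>"
        and Dk = "\<lambda>k n \<omega>. d k" and dk = d])
    fix n \<omega> assume n: "(n::nat) \<ge> 1" "\<omega> \<in> space M"
    have l: "\<bar>(\<integral>x. f x \<partial>\<mu> n \<omega>) - (\<integral>x. fk k x \<partial>\<mu> n \<omega>)\<bar> \<le> d k" for k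
      using mu[OF n] by (intro le_int) auto
    have "(\<lambda>k. (\<integral>x. fk k x \<partial>\<mu> n \<omega>) - (\<integral>x. f x \<partial>\<mu> n \<omega>)) \<longlonglongrightarrow> 0"
      by (rule Lim_null_comparison[OF _ d]) (use l in \<open>simp add: abs_minus_commute\<close>)
    then show "(\<lambda>k. \<integral>x. fk k x \<partial>\<mu> n \<omega>) \<longlonglongrightarrow> (\<integral>x. f x \<partial>\<mu> n \<omega>)" by (simp add: LIM_zero_iff)
  next
    fix k n \<omega> assume n: "(n::nat) \<ge> 1" "\<omega> \<in> space M"
    show "\<bar>(\<integral>x. f x \<partial>\<mu> n \<omega>) - (\<integral>x. fk k x \<partial>\<mu> n \<omega>)\<bar> \<le> d k" using mu[OF n] by (intro le_int) auto
  qed (use fk d le_int nu in \<open>auto simp: good_test_def tends_prob_const\<close>)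
  then show ?thesis using b by (simp add: good_test_def)
qed

text \<open>This coordinate sends \<open>[0, \<infinity>)\<close> to \<open>(0, 1 / s0]\<close> and
  turns the kernel of the transform at \<open>s0\<close> into the identity function.\<close>

definition inv_coord :: "real \<Rightarrow> real" where
  "inv_coord x = 1 / (max 0 x + s0)"

lemma inv_coord_bounds: "0 < inv_coord x" "inv_coord x \<le> 1 / s0"
  using s0 by (auto simp: inv_coord_def intro!: divide_left_mono divide_pos_pos mult_pos_pos add_nonneg_pos)

lemma inv_coord_measurable [measurable]: "inv_coord \<in> borel_measurable borel"
  unfolding inv_coord_def[abs_def] by measurable

lemma stieltjes_good: "s \<ge> s0 \<Longrightarrow> good_test (\<lambda>x. 1 / (max 0 x + s))"
  unfolding good_test_def using stieltjes s0
  by (auto intro!: bounded_borelI[where B = "1 / s"] divide_left_mono mult_pos_pos add_nonneg_pos)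

text \<open>With \<open>u = inv_coord x\<close>, the resolvent \<open>1 / (x + s0 + h) = u / (1 + h u)\<close> generates the powers of \<open>u\<close>:
  after removing the first \<open>k\<close> terms of its power series in \<open>h\<close>, let \<open>h \<rightarrow> 0\<close>.\<close>

lemma good_test_inv_coord_power: "good_test (\<lambda>x. inv_coord x ^ k)"
proof (induction k rule: less_induct)
  case (less k)
  show ?case
  proof (cases k)
    case 0
    then show ?thesis by (simp add: good_test_const)
  next
    case (Suc j)
    define h where "h i = 1 / real (Suc i)" for i
    have h: "h i > 0" for i by (simp add: h_def)
    \<comment> \<open>With \<open>k = j + 1\<close>, the first \<open>j\<close> terms of the power
      series are removed and the rest is divided by \<open>(- h)^j\<close>, leaving
      \<open>u ^ k / (1 + h u)\<close>. The removed powers are test functions by the induction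
      hypothesis.\<close>
    let ?g = "\<lambda>i x. (1 / (- h i) ^ j) * (1 / (max 0 x + (s0 + h i)) + (\<Sum>l<j. (- ((- h i) ^ l)) * inv_coord x ^ Suc l))"
    have g: "?g i x = inv_coord x ^ k / (1 + h i * inv_coord x)" for i x
    proof -
      let ?u = "inv_coord x"
      have u: "?u > 0" using inv_coord_bounds by auto
      have p: "1 + h i * ?u > 0" using h[of i] u by (intro add_pos_pos mult_pos_pos) auto
      have e: "1 / (max 0 x + (s0 + h i)) = ?u / (1 + h i * ?u)"
        using s0 h[of i] by (simp add: inv_coord_def field_simps)
      have "(1 + h i * ?u) * (\<Sum>l<j. (- h i) ^ l * ?u ^ Suc l) = ?u * ((1 - (- h i * ?u)) * (\<Sum>l<j. (- h i * ?u) ^ l))"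
        by (simp add: sum_distrib_left power_mult_distrib[symmetric] mult_ac)
      also have "(1 - (- h i * ?u)) * (\<Sum>l<j. (- h i * ?u) ^ l) = 1 - (- h i * ?u) ^ j"
        by (simp only: one_diff_power_eq)
      finally have s: "(\<Sum>l<j. (- h i) ^ l * ?u ^ Suc l) = ?u * (1 - (- h i * ?u) ^ j) / (1 + h i * ?u)"
        using p by (simp add: field_simps)
      have "?g i x = (1 / (- h i) ^ j) * (?u / (1 + h i * ?u) - (\<Sum>l<j. (- h i) ^ l * ?u ^ Suc l))"
        unfolding e by (simp add: sum_negf)
      also have "\<dots> = (1 / (- h i) ^ j) * (?u * (- h i * ?u) ^ j / (1 + h i * ?u))"
        unfolding s by (simp add: diff_divide_distrib[symmetric] right_diff_distrib)
      also have "\<dots> = ?u ^ k / (1 + h i * ?u)"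
        using h[of i] unfolding Suc power_mult_distrib[of "- h i"] by simp
      finally show ?thesis .
    qed
    show ?thesis
    proof (rule good_test_limit[where fk = ?g and d = "\<lambda>i. h i * (1 / s0) ^ Suc k"])
      fix i
      have "good_test (\<lambda>x. 1 / (max 0 x + (s0 + h i)))" using h[of i] by (intro stieltjes_good) auto
      moreover have "good_test (\<lambda>x. (- ((- h i) ^ l)) * inv_coord x ^ Suc l)" if "l \<in> {..<j}" for l
        using less[of "Suc l"] that Suc by (intro good_test_cmult) auto
      ultimately show "good_test (?g i)"
        by (intro good_test_cmult[where f = "\<lambda>x. 1 / (max 0 x + (s0 + h i)) + (\<Sum>l<j. (- ((- h i) ^ l)) * inv_coord x ^ Suc l)"] good_test_add good_test_sum)
    next
      fix i x
      let ?u = "inv_coord x"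
      have u: "0 < ?u" "?u \<le> 1 / s0" using inv_coord_bounds by auto
      have p: "1 + h i * ?u \<ge> 1" using h[of i] u by simp
      have e: "?u ^ k - ?g i x = h i * ?u ^ Suc k / (1 + h i * ?u)"
        unfolding g using p by (simp add: field_simps)
      have "\<bar>?u ^ k - ?g i x\<bar> = h i * ?u ^ Suc k / (1 + h i * ?u)"
        unfolding e using p u h[of i] by (intro abs_of_nonneg divide_nonneg_nonneg mult_nonneg_nonneg) auto
      also have "\<dots> \<le> h i * ?u ^ Suc k / 1"
        using p u h[of i] by (intro divide_left_mono mult_nonneg_nonneg) (simp_all add: add_pos_pos)
      also have "\<dots> \<le> h i * (1 / s0) ^ Suc k"
      proof -
        have "?u ^ Suc k \<le> (1 / s0) ^ Suc k" by (rule power_mono[OF u(2) less_imp_le[OF u(1)]])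
        then have "h i * ?u ^ Suc k \<le> h i * (1 / s0) ^ Suc k" by (rule mult_left_mono[OF _ less_imp_le[OF h]])
        then show ?thesis by (simp only: div_by_1)
      qed
      finally show "\<bar>?u ^ k - ?g i x\<bar> \<le> h i * (1 / s0) ^ Suc k" .
    next
      have "h \<longlonglongrightarrow> 0"
        unfolding h_def using LIMSEQ_inverse_real_of_nat by (simp add: inverse_eq_divide)
      then have "(\<lambda>i. h i * (1 / s0) ^ Suc k) \<longlonglongrightarrow> 0 * (1 / s0) ^ Suc k"
        by (rule tendsto_mult_right)
      then show "(\<lambda>i. h i * (1 / s0) ^ Suc k) \<longlonglongrightarrow> 0" by simp
    qed measurable
  qed
qed

text \<open>Weierstrass approximation on \<open>[0, 1 / s0]\<close>, which contains all values of
  \<open>inv_coord\<close> and the point 0 that stands for \<open>x = \<infinity>\<close>.\<close>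

lemma good_test_continuous_inv_coord:
  assumes F: "continuous_on {0..1 / s0} F" and meas: "(\<lambda>x. F (inv_coord x)) \<in> borel_measurable borel"
  shows "good_test (\<lambda>x. F (inv_coord x))"
proof -
  have "\<exists>g. polynomial_function g \<and> (\<forall>x\<in>{0..1 / s0}. norm (F x - g x) < 1 / real (Suc k))" for k
    by (rule Stone_Weierstrass_polynomial_function[OF _ F]) auto
  then obtain g :: "nat \<Rightarrow> real \<Rightarrow> real" where
    g: "\<And>k. polynomial_function (g k)" "\<And>k x. x \<in> {0..1 / s0} \<Longrightarrow> norm (F x - g k x) < 1 / real (Suc k)"
    by metis
  show ?thesis
  proof (rule good_test_limit[where fk = "\<lambda>k x. g k (inv_coord x)" and d = "\<lambda>k. 1 / real (Suc k)"])
    fix k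
    obtain a N where "g k = (\<lambda>x. \<Sum>i\<le>(N::nat). a i * x ^ i)"
      using g(1)[of k] unfolding real_polynomial_function_eq[symmetric] real_polynomial_function_iff_sum by blast
    then show "good_test (\<lambda>x. g k (inv_coord x))"
      by (auto intro!: good_test_sum good_test_cmult good_test_inv_coord_power)
  next
    fix k x
    show "\<bar>F (inv_coord x) - g k (inv_coord x)\<bar> \<le> 1 / real (Suc k)"
      using g(2)[of "inv_coord x" k] inv_coord_bounds[of x] by auto
  qed (use meas LIMSEQ_inverse_real_of_nat[unfolded inverse_eq_divide] in auto)
qed

text \<open>Tightness: \<open>K / (x + K) \<up> 1\<close> as \<open>K \<rightarrow> \<infinity>\<close>, and these functions are test functions themselves.\<close>

lemma tends_prob_bounded_continuous:
  assumes f: "continuous_on UNIV f" and B: "\<And>x. \<bar>f x\<bar> \<le> B"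
  shows "tends_prob M (\<lambda>n \<omega>. \<integral>x. f x \<partial>\<mu> n \<omega>) (\<integral>x. f x \<partial>\<nu>)"
proof -
  have fm [measurable]: "f \<in> borel_measurable borel" using f by (rule borel_measurable_continuous_onI)
  have bf: "bounded_borel f" using fm B by (rule bounded_borelI)
  define K where "K i = s0 + real i" for i
  have K: "K i > 0" "K i \<ge> s0" for i using s0 by (auto simp: K_def)
  define w where "w i x = K i / (max 0 x + K i)" for i x
  have w: "0 \<le> w i x" "w i x \<le> 1" for i x
    using K[of i] by (auto simp: w_def intro!: divide_nonneg_pos add_nonneg_pos)
  have wm [measurable]: "w i \<in> borel_measurable borel" for i unfolding w_def[abs_def] by measurable
  have wlim: "(\<lambda>i. w i x) \<longlonglongrightarrow> 1" for x
  proof -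
    have "filterlim (\<lambda>i. real i) at_top sequentially" by (rule filterlim_real_sequentially)
    then have "filterlim (\<lambda>i. (max 0 x + s0) + real i) at_top sequentially"
      by (rule filterlim_tendsto_add_at_top[OF tendsto_const])
    then have "(\<lambda>i. max 0 x / ((max 0 x + s0) + real i)) \<longlonglongrightarrow> 0"
      by (rule real_tendsto_divide_at_top[OF tendsto_const])
    then have "(\<lambda>i. 1 - max 0 x / ((max 0 x + s0) + real i)) \<longlonglongrightarrow> 1 - 0"
      by (intro tendsto_diff tendsto_const)
    moreover have "1 - max 0 x / ((max 0 x + s0) + real i) = w i x" for i
    proof -
      have "max 0 x + s0 + real i > 0" using s0 by (intro add_pos_nonneg add_nonneg_pos) auto
      then show ?thesis by (simp add: w_def K_def field_simps)
    qed
    ultimately show ?thesis by simp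
  qed
  have bw: "bounded_borel (\<lambda>x. f x * w i x)" for i
  proof (rule bounded_borelI[where B = "B"])
    fix x
    have "\<bar>f x\<bar> * w i x \<le> B * 1" using B[of x] w by (intro mult_mono) auto
    then show "\<bar>f x * w i x\<bar> \<le> B" using w by (simp add: abs_mult)
  qed measurable
  have good_w: "good_test (w i)" for i
    using good_test_cmult[OF stieltjes_good[OF K(2)[of i]], of "K i"] by (simp add: w_def[abs_def])
  have good_fw: "good_test (\<lambda>x. f (max 0 x) * w i x)" for i
  proof -
    \<comment> \<open>\<open>F\<close> is \<open>f * w i\<close> in the coordinate
      \<open>v = 1 / (x + s0)\<close>. A bounded continuous \<open>f\<close> need not have a limit
      at infinity, but \<open>w i\<close> vanishes there, so \<open>F\<close> extends continuously
      by 0 to \<open>v = 0\<close>.\<close>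
    define F where "F v = (if v = 0 then 0 else f (1 / v - s0) * (K i * v / (1 + (K i - s0) * v)))" for v
    have pos: "1 + (K i - s0) * v > 0" if "v \<ge> 0" for v
      using that K[of i] by (intro add_pos_nonneg mult_nonneg_nonneg) auto
    have eq: "F (inv_coord x) = f (max 0 x) * w i x" for x
    proof -
      have "1 / inv_coord x - s0 = max 0 x" by (simp add: inv_coord_def)
      moreover have "K i * inv_coord x / (1 + (K i - s0) * inv_coord x) = w i x"
      proof -
        have "max 0 x + s0 > 0" using s0 by (intro add_nonneg_pos) auto
        then have "inv_coord x / (1 + (K i - s0) * inv_coord x) = 1 / (max 0 x + K i)"
          by (simp add: inv_coord_def field_simps)
        then show ?thesis unfolding w_def times_divide_eq_right[symmetric] by (metis mult.right_neutral times_divide_eq_right)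
      qed
      ultimately show ?thesis using inv_coord_bounds[of x] by (simp add: F_def)
    qed
    have "continuous_on {0..1 / s0} F"
      unfolding continuous_on_eq_continuous_within
    proof
      fix v assume v: "v \<in> {0..1 / s0}"
      show "continuous (at v within {0..1 / s0}) F"
      proof (cases "v = 0")
        case True
        have "((\<lambda>v. F v) \<longlongrightarrow> 0) (at 0 within {0..1 / s0})"
        proof (rule Lim_null_comparison)
          show "\<forall>\<^sub>F v in at 0 within {0..1 / s0}. norm (F v) \<le> B * (K i * v)"
            unfolding eventually_at_filter
          proof (intro always_eventually allI impI)
            fix v assume "v \<noteq> (0::real)" "v \<in> {0..1 / s0}"
            then have v: "v > 0" by auto
            have "K i * v / (1 + (K i - s0) * v) \<le> K i * v / 1"
              using v K[of i] by (intro divide_left_mono) (auto intro!: mult_pos_pos pos)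
            then have "\<bar>f (1 / v - s0)\<bar> * (K i * v / (1 + (K i - s0) * v)) \<le> B * (K i * v)"
              using v K[of i] B[of "1 / v - s0"] pos[of v] by (intro mult_mono) auto
            then show "norm (F v) \<le> B * (K i * v)"
              using v K[of i] pos[of v] by (simp add: F_def abs_mult)
          qed
          have "((\<lambda>v. B * (K i * v)) \<longlongrightarrow> B * (K i * 0)) (at 0 within {0..1 / s0})"
            by (intro tendsto_intros)
          then show "((\<lambda>v. B * (K i * v)) \<longlongrightarrow> 0) (at 0 within {0..1 / s0})" by simp
        qed
        moreover have "F 0 = 0" by (simp add: F_def)
        ultimately show ?thesis using True by (simp add: continuous_within)
      next
        case False
        have "isCont (\<lambda>v. 1 / v - s0) v" using False by (intro continuous_intros) auto
        moreover have "isCont f (1 / v - s0)" using f by (simp add: continuous_on_eq_continuous_at)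
        ultimately have "isCont (\<lambda>v. f (1 / v - s0)) v" by (rule isCont_o2)
        moreover have "isCont (\<lambda>v. K i * v / (1 + (K i - s0) * v)) v"
          using pos[of v] v by (intro continuous_intros) auto
        ultimately have "isCont (\<lambda>v. f (1 / v - s0) * (K i * v / (1 + (K i - s0) * v))) v"
          by (rule isCont_mult)
        moreover have "eventually (\<lambda>v. F v = f (1 / v - s0) * (K i * v / (1 + (K i - s0) * v))) (nhds v)"
          using False t1_space_nhds[of v 0] by (auto simp: F_def elim: eventually_mono)
        ultimately have "isCont F v" by (simp add: isCont_cong)
        then show ?thesis by (rule continuous_at_imp_continuous_at_within)
      qed
    qed
    then show ?thesis using good_test_continuous_inv_coord[of F] unfolding eq by simp
  qed
  \<comment> \<open>Stated for an arbitrary bounded \<open>f\<close>, since it is applied both to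
    the given function and to the constant 1.\<close>
  have lim_int: "(\<lambda>i. \<integral>x. f x * w i x \<partial>P) \<longlonglongrightarrow> (\<integral>x. f x * 1 \<partial>P)"
    if P: "prob_space P" "sets P = sets borel" and fm: "f \<in> borel_measurable borel" and B: "\<And>x. \<bar>f x\<bar> \<le> B" for P and f :: "real \<Rightarrow> real" and B
  proof -
    interpret P: prob_space P by fact
    have [measurable]: "f \<in> borel_measurable P" "\<And>i. w i \<in> borel_measurable P"
      using fm wm by (simp_all add: measurable_cong_sets[OF P(2) refl])
    show ?thesis
    proof (rule integral_dominated_convergence[where w = "\<lambda>_. B"])
      show "AE x in P. (\<lambda>i. f x * w i x) \<longlonglongrightarrow> f x * 1" by (intro AE_I2 tendsto_intros wlim)
      show "AE x in P. norm (f x * w i x) \<le> B" for i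
      proof (intro AE_I2)
        fix x
        have "\<bar>f x\<bar> * w i x \<le> B * 1" using B[of x] w by (intro mult_mono) auto
        then show "norm (f x * w i x) \<le> B" using w by (simp add: abs_mult)
      qed
    qed auto
  qed
  \<comment> \<open>The truncation error is controlled by \<open>B\<close> times the missing mass
    \<open>1 - \<integral> w i\<close>. For the measures \<open>\<mu> n \<omega>\<close> this is
    random, but \<open>w i\<close> is a test function, so it converges in probability.\<close>
  have le_int: "\<bar>(\<integral>x. f x \<partial>P) - (\<integral>x. f x * w i x \<partial>P)\<bar> \<le> B * (1 + (-1) * (\<integral>x. w i x \<partial>P))"
    if P: "prob_space P" "sets P = sets borel" for P i
  proof -
    interpret P: prob_space P by fact
    have i: "integrable P f" "integrable P (\<lambda>x. f x * w i x)" "integrable P (w i)"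
      using bf bw good_w[of i] P by (auto intro: bounded_borel_integrable simp: good_test_def)
    have "\<bar>\<integral>x. f x - f x * w i x \<partial>P\<bar> \<le> (\<integral>x. \<bar>f x - f x * w i x\<bar> \<partial>P)" by (rule integral_abs_bound)
    also have "\<dots> \<le> (\<integral>x. B * (1 - w i x) \<partial>P)"
    proof (intro integral_mono)
      fix x
      have "f x - f x * w i x = f x * (1 - w i x)" by (simp add: algebra_simps)
      then show "\<bar>f x - f x * w i x\<bar> \<le> B * (1 - w i x)"
        using w[of i x] B[of x] by (simp add: abs_mult mult_right_mono)
    qed (use i in auto)
    also have "\<dots> = B * (1 + (-1) * (\<integral>x. w i x \<partial>P))" using i by (simp add: P.prob_space)
    finally show ?thesis using i by simp
  qed
  show ?thesis
  proof (rule tends_prob_approx[where Yk = "\<lambda>k n \<omega>. \<integral>x. f x * w k x \<partial>\<mu> n \<omega>" and ck = "\<lambda>k. \<integral>x. f x * w k x \<partial>\<nu>"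
        and Dk = "\<lambda>k n \<omega>. B * (1 + (-1) * (\<integral>x. w k x \<partial>\<mu> n \<omega>))" and dk = "\<lambda>k. B * (1 + (-1) * (\<integral>x. w k x \<partial>\<nu>))"])
    fix k
    have "tends_prob M (\<lambda>n \<omega>. \<integral>x. f (max 0 x) * w k x \<partial>\<mu> n \<omega>) (\<integral>x. f (max 0 x) * w k x \<partial>\<nu>)"
      using good_fw[of k] by (simp add: good_test_def)
    also have "(\<integral>x. f (max 0 x) * w k x \<partial>\<nu>) = (\<integral>x. f x * w k x \<partial>\<nu>)"
    proof (rule integral_cong_AE)
      show "AE x in \<nu>. f (max 0 x) * w k x = f x * w k x" using nu(3) by eventually_elim (simp add: max_def)
    qed (simp_all add: measurable_cong_sets[OF nu(2) refl])
    finally show "tends_prob M (\<lambda>n \<omega>. \<integral>x. f x * w k x \<partial>\<mu> n \<omega>) (\<integral>x. f x * w k x \<partial>\<nu>)"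
    proof (rule tends_prob_cong)
      fix n \<omega> assume n: "(n::nat) \<ge> 1" "\<omega> \<in> space M"
      show "(\<integral>x. f (max 0 x) * w k x \<partial>\<mu> n \<omega>) = (\<integral>x. f x * w k x \<partial>\<mu> n \<omega>)"
      proof (rule integral_cong_AE)
        show "AE x in \<mu> n \<omega>. f (max 0 x) * w k x = f x * w k x"
          using mu[OF n] by (auto elim!: eventually_mono simp: max_def)
      qed (simp_all add: measurable_cong_sets[OF mu[OF n, THEN conjunct2, THEN conjunct1] refl])
    qed
    show "tends_prob M (\<lambda>n \<omega>. B * (1 + (-1) * (\<integral>x. w k x \<partial>\<mu> n \<omega>))) (B * (1 + (-1) * (\<integral>x. w k x \<partial>\<nu>)))"
      using good_w[of k] by (intro tends_prob_cmult tends_prob_add tends_prob_const) (auto simp: good_test_def)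
    show "\<bar>(\<integral>x. f x \<partial>\<nu>) - (\<integral>x. f x * w k x \<partial>\<nu>)\<bar> \<le> B * (1 + (-1) * (\<integral>x. w k x \<partial>\<nu>))"
      by (rule le_int) (fact nu)+
  next
    fix k n \<omega> assume n: "(n::nat) \<ge> 1" "\<omega> \<in> space M"
    show "\<bar>(\<integral>x. f x \<partial>\<mu> n \<omega>) - (\<integral>x. f x * w k x \<partial>\<mu> n \<omega>)\<bar> \<le> B * (1 + (-1) * (\<integral>x. w k x \<partial>\<mu> n \<omega>))"
      using mu[OF n] by (intro le_int) auto
  next
    fix n \<omega> assume n: "(n::nat) \<ge> 1" "\<omega> \<in> space M"
    show "(\<lambda>k. \<integral>x. f x * w k x \<partial>\<mu> n \<omega>) \<longlonglongrightarrow> (\<integral>x. f x \<partial>\<mu> n \<omega>)"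
      using lim_int[of "\<mu> n \<omega>" f B] mu[OF n] B fm by simp
  next
    interpret nu: prob_space \<nu> by (rule nu)
    have "(\<lambda>k. \<integral>x. 1 * w k x \<partial>\<nu>) \<longlonglongrightarrow> (\<integral>x. 1 * 1 \<partial>\<nu>)"
      by (rule lim_int[OF nu(1,2), of "\<lambda>_. 1" 1]) simp_all
    then have "(\<lambda>k. \<integral>x. w k x \<partial>\<nu>) \<longlonglongrightarrow> 1" by (simp add: nu.prob_space)
    then have "(\<lambda>k. B * (1 + (-1) * (\<integral>x. w k x \<partial>\<nu>))) \<longlonglongrightarrow> B * (1 + (-1) * 1)"
      by (intro tendsto_intros)
    then show "(\<lambda>k. B * (1 + (-1) * (\<integral>x. w k x \<partial>\<nu>))) \<longlonglongrightarrow> 0" by simp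
  qed
qed

theorem weak_conv: "weak_conv_in_prob M \<mu> \<nu>"
  unfolding weak_conv_in_prob_def
proof (intro allI impI tends_prob_imp_conv_in_prob)
  fix f :: "real \<Rightarrow> real" assume f: "continuous_on UNIV f" "bounded (range f)"
  then obtain B where "\<And>x. \<bar>f x\<bar> \<le> B" by (auto simp: bounded_iff)
  then show "tends_prob M (\<lambda>n \<omega>. \<integral>x. f x \<partial>\<mu> n \<omega>) (\<integral>x. f x \<partial>\<nu>)"
    using f by (intro tends_prob_bounded_continuous)
qed

end

section \<open>The spectral measure in the direction of the spike\<close>

text \<open>At \<open>y = 0\<close> both the integrand and the value in
  \<open>mp_spiked_total\<close> are \<open>1 / \<alpha>\<close>.\<close>

lemma mp_spiked_prob:
  assumes "\<alpha> > 0" "\<theta> \<ge> 0" "\<not> (\<alpha> = 1 \<and> \<theta> = 0)"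
  shows "prob_space (mp_spiked \<alpha> \<theta>)"
proof
  have "(\<integral>\<^sup>+x. ennreal (1 / \<alpha>) \<partial>mp_spiked \<alpha> \<theta>) = ennreal (1 / \<alpha>)"
    using mp_spiked_total(1)[OF assms, of 0] assms(1) by simp
  then have "ennreal (1 / \<alpha>) * emeasure (mp_spiked \<alpha> \<theta>) (space (mp_spiked \<alpha> \<theta>)) = ennreal (1 / \<alpha>) * 1"
    by simp
  moreover have "ennreal (1 / \<alpha>) \<noteq> 0" "ennreal (1 / \<alpha>) \<noteq> \<infinity>" using assms(1) by auto
  ultimately show "emeasure (mp_spiked \<alpha> \<theta>) (space (mp_spiked \<alpha> \<theta>)) = 1"
    unfolding ennreal_mult_cancel_left infinity_ennreal_def by blast
qed

lemma mp_spiked_nonneg: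
  assumes "\<alpha> > 0" "\<theta> \<ge> 0" "\<not> (\<alpha> = 1 \<and> \<theta> = 0)"
  shows "AE x in mp_spiked \<alpha> \<theta>. 0 \<le> x"
  by (rule mp_spiked_total(2)[where y = 0]) (use assms in auto)

text \<open>The parameter \<open>y = 1 - s g\<close> rationalizes the fixed point equation: \<open>s = (\<alpha> - y) (1 - y) / y\<close> and
  \<open>g = y / (\<alpha> - y)\<close>.\<close>

lemma mp_spiked_stieltjes:
  assumes a: "\<alpha> > 0" "\<theta> \<ge> 0" "\<not> (\<alpha> = 1 \<and> \<theta> = 0)" and s: "s \<ge> 1"
    and g: "g > 0" "s * g + \<alpha> * g / (1 + g) = 1"
  shows "(\<integral>x. 1 / (max 0 x + s) \<partial>mp_spiked \<alpha> \<theta>) = g / (\<theta> + s * (1 - \<theta>) * g)"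
proof -
  interpret P: prob_space "mp_spiked \<alpha> \<theta>" by (rule mp_spiked_prob[OF a])
  note [measurable_cong] = sets_mp_spiked[of \<alpha> \<theta>]
  define y where "y = \<alpha> * g / (1 + g)"
  have y: "0 < y" "y < 1" "y < \<alpha>" "y = 1 - s * g"
  proof -
    show "0 < y" using a g by (simp add: y_def)
    show e: "y = 1 - s * g" using g by (simp add: y_def)
    have "0 < s * g" using s g by simp
    then show "y < 1" using e by simp
    show "y < \<alpha>" using a g by (simp add: y_def divide_less_eq)
  qed
  have ay: "\<alpha> - y = \<alpha> / (1 + g)" using g(1) by (simp add: y_def field_simps)
  have gy: "g * (\<alpha> - y) = y" using ay by (simp add: y_def mult.commute)
  have sy: "(\<alpha> - y) * (1 - y) = y * s"
  proof -
    have "(\<alpha> - y) * (1 - y) = s * (g * (\<alpha> - y))" using y(4) by simp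
    then show ?thesis using gy by simp
  qed
  have s0: "s > 0" using s by simp
  have fn: "(\<integral>\<^sup>+x. ennreal (1 / (max 0 x + s)) \<partial>mp_spiked \<alpha> \<theta>) = ennreal (y / ((\<alpha> - y) * (1 + (\<theta> - 1) * y)))"
  proof -
    have "(\<integral>\<^sup>+x. ennreal (1 / (max 0 x + s)) \<partial>mp_spiked \<alpha> \<theta>) =
        (\<integral>\<^sup>+x. ennreal y * ennreal (1 / (y * x + (\<alpha> - y) * (1 - y))) \<partial>mp_spiked \<alpha> \<theta>)"
    proof (rule nn_integral_cong_AE)
      show "AE x in mp_spiked \<alpha> \<theta>. ennreal (1 / (max 0 x + s)) = ennreal y * ennreal (1 / (y * x + (\<alpha> - y) * (1 - y)))"
        using mp_spiked_nonneg[OF a]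
      proof eventually_elim
        case x: (elim x)
        have "y * x + (\<alpha> - y) * (1 - y) = y * (x + s)" unfolding sy by (simp add: distrib_left)
        then have "1 / (max 0 x + s) = y * (1 / (y * x + (\<alpha> - y) * (1 - y)))" using x y s0 by simp
        then show ?case using y by (simp only: ennreal_mult' less_imp_le)
      qed
    qed
    also have "\<dots> = ennreal y * ennreal (1 / ((\<alpha> - y) * (1 + (\<theta> - 1) * y)))"
      using mp_spiked_total(1)[OF a, of y] y by (subst nn_integral_cmult) auto
    also have "\<dots> = ennreal (y / ((\<alpha> - y) * (1 + (\<theta> - 1) * y)))"
      using y by (simp flip: ennreal_mult')
    finally show ?thesis .
  qed
  have pos: "0 < 1 + (\<theta> - 1) * y"
  proof -
    have "1 + (\<theta> - 1) * y = (1 - y) + \<theta> * y" by (simp add: algebra_simps)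
    then show ?thesis using y a by (simp add: add_pos_nonneg)
  qed
  have "(\<integral>x. 1 / (max 0 x + s) \<partial>mp_spiked \<alpha> \<theta>) = enn2real (\<integral>\<^sup>+x. ennreal (1 / (max 0 x + s)) \<partial>mp_spiked \<alpha> \<theta>)"
    using s0 by (intro integral_eq_nn_integral) (auto intro!: AE_I2 divide_nonneg_nonneg)
  also have "\<dots> = y / ((\<alpha> - y) * (1 + (\<theta> - 1) * y))"
    unfolding fn using y pos by (intro enn2real_ennreal divide_nonneg_nonneg mult_nonneg_nonneg) auto
  also have "\<dots> = g / (1 + (\<theta> - 1) * y)"
  proof -
    have "g = y / (\<alpha> - y)" using gy y(3) by (subst nonzero_eq_divide_eq) auto
    then show ?thesis by simp
  qed
  also have "1 + (\<theta> - 1) * y = \<theta> + s * (1 - \<theta>) * g" unfolding y(4) by (simp add: algebra_simps)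
  finally show ?thesis .
qed

text \<open>The left side of the equation is 0 at \<open>g = 0\<close> and
  \<open>s + \<alpha> / 2 \<ge> 1\<close> at \<open>g = 1\<close>.\<close>

lemma companion_fixed_point_exists:
  fixes \<alpha> s :: real
  assumes "\<alpha> > 0" "s \<ge> 1"
  obtains g where "g > 0" "s * g + \<alpha> * g / (1 + g) = 1"
proof -
  have "continuous_on {0..1} (\<lambda>g. s * g + \<alpha> * g / (1 + g))" by (intro continuous_intros) auto
  then obtain g where g: "0 \<le> g" "g \<le> 1" "s * g + \<alpha> * g / (1 + g) = 1"
    using IVT'[of "\<lambda>g. s * g + \<alpha> * g / (1 + g)" 0 1 1] assms by auto
  then have "g \<noteq> 0" by auto
  then have "g > 0" using g by simp
  then show thesis using g(3) by (rule that)
qed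

theorem proposition4:
  fixes M :: "'w measure" and N :: "'b measure" and \<xi> :: "'b \<Rightarrow> real"
    and m :: "nat \<Rightarrow> nat" and \<alpha> \<theta> :: real
    and X \<Sigma> :: "nat \<Rightarrow> 'w \<Rightarrow> real mat" and v :: "nat \<Rightarrow> 'w \<Rightarrow> real vec"
    and lam :: "nat \<Rightarrow> 'w \<Rightarrow> nat \<Rightarrow> real" and \<phi> :: "nat \<Rightarrow> 'w \<Rightarrow> nat \<Rightarrow> real vec"
  assumes M: "prob_space M"
    and alpha: "\<alpha> > 0" "(\<lambda>n. real (m n) / real n) \<longlonglongrightarrow> \<alpha>"
    and theta: "\<theta> \<ge> 0" "\<not> (\<alpha> = 1 \<and> \<theta> = 0)"
    and xi: "prob_space N" "\<xi> \<in> borel_measurable N"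
      "\<And>k. integrable N (\<lambda>x. \<xi> x ^ k)" "(\<integral>x. \<xi> x \<partial>N) = 0" "(\<integral>x. (\<xi> x)\<^sup>2 \<partial>N) = 1"
    and X_dim: "\<And>n \<omega>. n \<ge> 1 \<Longrightarrow> \<omega> \<in> space M \<Longrightarrow> X n \<omega> \<in> carrier_mat n (m n)"
    and X_indep: "\<And>n. n \<ge> 1 \<Longrightarrow>
      prob_space.indep_vars M (\<lambda>_. borel) (\<lambda>ij \<omega>. X n \<omega> $$ ij) ({..<n} \<times> {..<m n})"
    and X_distr: "\<And>n i j. n \<ge> 1 \<Longrightarrow> i < n \<Longrightarrow> j < m n \<Longrightarrow>
      distr M borel (\<lambda>\<omega>. X n \<omega> $$ (i, j)) = distr N borel \<xi>"
    and Sigma: "\<And>n \<omega>. n \<ge> 1 \<Longrightarrow> \<omega> \<in> space M \<Longrightarrow>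
      \<Sigma> n \<omega> \<in> carrier_mat n n \<and> transpose_mat (\<Sigma> n \<omega>) = \<Sigma> n \<omega> \<and>
      has_eigenvalues (\<Sigma> n \<omega>) (\<theta> # replicate (n - 1) 1)"
    and v: "\<And>n \<omega>. n \<ge> 1 \<Longrightarrow> \<omega> \<in> space M \<Longrightarrow>
      v n \<omega> \<in> carrier_vec n \<and> scalar_prod (v n \<omega>) (v n \<omega>) = 1 \<and>
      eigenvector (\<Sigma> n \<omega>) (v n \<omega>) \<theta>"
    and Sigma_indep: "\<And>n. n \<ge> 1 \<Longrightarrow>
      prob_space.indep_set M
        (rv_sigma M ({..<n} \<times> {..<m n}) (\<lambda>ij \<omega>. X n \<omega> $$ ij))
        (rv_sigma M ({..<n} \<times> {..<n}) (\<lambda>ij \<omega>. \<Sigma> n \<omega> $$ ij))"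
    and v_indep: "\<And>n. n \<ge> 1 \<Longrightarrow>
      prob_space.indep_set M
        (rv_sigma M ({..<n} \<times> {..<m n}) (\<lambda>ij \<omega>. X n \<omega> $$ ij))
        (rv_sigma M {..<n} (\<lambda>i \<omega>. vec_index (v n \<omega>) i))"
    and eigen: "\<And>n \<omega>. n \<ge> 1 \<Longrightarrow> \<omega> \<in> space M \<Longrightarrow>
      ordered_eigenbasis n (sample_cov n (\<Sigma> n \<omega>) (X n \<omega>)) (lam n \<omega>) (\<phi> n \<omega>)"
  shows "weak_conv_in_prob M (\<lambda>n \<omega>. spectral_measure n (lam n \<omega>) (\<phi> n \<omega>) (v n \<omega>))
    (mp_spiked \<alpha> \<theta>)"
proof -
  interpret M: prob_space M by (rule M)
  interpret N: prob_space N by (rule xi(1))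
  let ?D = "distr N borel \<xi>"
  interpret iid_entries ?D
  proof -
    interpret D: prob_space ?D by (rule N.prob_space_distr[OF xi(2)])
    show "iid_entries ?D"
      by unfold_locales (use xi in \<open>auto simp: integrable_distr_eq integral_distr\<close>)
  qed
  have v1: "ip n (($) (v n \<omega>)) (($) (v n \<omega>)) = 1" if "n \<ge> 1" "\<omega> \<in> space M" for n \<omega>
    using v[OF that] scalar_prod_ip[of "v n \<omega>" n "v n \<omega>"] by simp
  have basis: "\<phi> n \<omega> i \<in> carrier_vec n" "eigenvector (sample_cov n (\<Sigma> n \<omega>) (X n \<omega>)) (\<phi> n \<omega> i) (lam n \<omega> i)"
    "\<And>j. j < n \<Longrightarrow> scalar_prod (\<phi> n \<omega> i) (\<phi> n \<omega> j) = (if i = j then 1 else 0)"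
    if "n \<ge> 1" "\<omega> \<in> space M" "i < n" for n \<omega> i
    using eigen[OF that(1,2)] that(3) unfolding ordered_eigenbasis_def by auto
  define h where "h s n \<omega> = quad n (cov_resolvent n s [0..<m n] (entries (X n \<omega>))) (($) (v n \<omega>))" for s n \<omega>
  have weights: "(scalar_prod (\<phi> n \<omega> i) (v n \<omega>))\<^sup>2 = (ip n (($) (v n \<omega>)) (($) (\<phi> n \<omega> i)))\<^sup>2"
    if "n \<ge> 1" "\<omega> \<in> space M" "i < n" for n \<omega> i
    using scalar_prod_ip[OF basis(1)[OF that], of "v n \<omega>"] v[OF that(1,2)] by (simp add: ip_commute)
  have pars: "(\<Sum>i<n. ip n u (($) (\<phi> n \<omega> i)) * ip n w (($) (\<phi> n \<omega> i))) = ip n u w"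
    if "n \<ge> 1" "\<omega> \<in> space M" for n \<omega> u w
    by (rule parseval) (use basis that in auto)
  have eig: "0 \<le> lam n \<omega> i"
    "sqrt \<theta> * ip n (app n (cov_resolvent n s [0..<m n] (entries (X n \<omega>))) (($) (v n \<omega>))) (($) (\<phi> n \<omega> i))
        + (1 - sqrt \<theta>) * h s n \<omega> * ip n (($) (v n \<omega>)) (($) (\<phi> n \<omega> i))
      = ip n (($) (v n \<omega>)) (($) (\<phi> n \<omega> i)) * (\<theta> + s * (1 - \<theta>) * h s n \<omega>) / (lam n \<omega> i + s)"
    if n: "n \<ge> 1" and w: "\<omega> \<in> space M" and i: "i < n" and s: "s > 0" for n \<omega> i s
  proof -
    have "ip n (($) (\<phi> n \<omega> i)) (($) (\<phi> n \<omega> i)) = 1"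
      using basis(3)[OF n w i i] scalar_prod_ip[OF basis(1)[OF n w i] basis(1)[OF n w i]] by simp
    moreover have "lam n \<omega> i * \<phi> n \<omega> i $ k = spike_map n (sqrt \<theta> - 1) (($) (v n \<omega>))
        (app n (outer_sum (columns n [0..<m n] (entries (X n \<omega>)))) (spike_map n (sqrt \<theta> - 1) (($) (v n \<omega>)) (($) (\<phi> n \<omega> i)))) k"
      if k: "k < n" for k
      using Sigma[OF n w] v[OF n w] by (intro sample_cov_eigen[OF _ _ _ n theta(1) _ _ _ X_dim[OF n w] basis(1,2)[OF n w i] k]) auto
    ultimately show "0 \<le> lam n \<omega> i"
      "sqrt \<theta> * ip n (app n (cov_resolvent n s [0..<m n] (entries (X n \<omega>))) (($) (v n \<omega>))) (($) (\<phi> n \<omega> i))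
        + (1 - sqrt \<theta>) * h s n \<omega> * ip n (($) (v n \<omega>)) (($) (\<phi> n \<omega> i))
      = ip n (($) (v n \<omega>)) (($) (\<phi> n \<omega> i)) * (\<theta> + s * (1 - \<theta>) * h s n \<omega>) / (lam n \<omega> i + s)"
      using spiked_eigen_identity[OF s theta(1) v1[OF n w]] unfolding h_def quad_def cov_resolvent_def by blast+
  qed
  have h_bounds: "0 < h s n \<omega>" "s * h s n \<omega> \<le> 1" if "n \<ge> 1" "\<omega> \<in> space M" "s > 0" for s n \<omega>
  proof -
    show "0 < h s n \<omega>" unfolding h_def cov_resolvent_def by (rule resolvent_quad_pos[OF that(3) v1[OF that(1,2)]])
    show "s * h s n \<omega> \<le> 1"
      using contractive_form[OF contractive_cov_resolvent[OF that(3)] that(3), of n "($) (v n \<omega>)"]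
      unfolding v1[OF that(1,2)] h_def quad_def .
  qed
  have transform: "(\<integral>x. 1 / (max 0 x + s) \<partial>spectral_measure n (lam n \<omega>) (\<phi> n \<omega>) (v n \<omega>)) = h s n \<omega> / (\<theta> + s * (1 - \<theta>) * h s n \<omega>)"
    if n: "n \<ge> 1" and w: "\<omega> \<in> space M" and s: "s > 0" for s n \<omega>
  proof -
    let ?c = "\<lambda>i. ip n (($) (v n \<omega>)) (($) (\<phi> n \<omega> i))"
    let ?z = "app n (cov_resolvent n s [0..<m n] (entries (X n \<omega>))) (($) (v n \<omega>))"
    let ?h = "h s n \<omega>"
    define G where "G = (\<Sum>i<n. ?c i * ?c i / (lam n \<omega> i + s))"
    have "(\<integral>x. 1 / (max 0 x + s) \<partial>spectral_measure n (lam n \<omega>) (\<phi> n \<omega>) (v n \<omega>)) = G"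
      unfolding G_def using eig(1)[OF n w _ s]
      by (subst integral_spectral_measure) (auto intro!: sum.cong simp: weights[OF n w] power2_eq_square[symmetric] max_def)
    \<comment> \<open>The eigenvector identity is multiplied by \<open>v \<bullet> \<phi>\<close>
      and summed over the basis. By Parseval one side becomes
      \<open>sqrt \<theta> (v \<bullet> z) + (1 - sqrt \<theta>) h = h\<close>.\<close>
    moreover have "?h = G * (\<theta> + s * (1 - \<theta>) * ?h)"
    proof -
      have "G * (\<theta> + s * (1 - \<theta>) * ?h) = (\<Sum>i<n. ?c i * (?c i * (\<theta> + s * (1 - \<theta>) * ?h) / (lam n \<omega> i + s)))"
        unfolding G_def sum_distrib_right by (intro sum.cong refl) simp
      also have "\<dots> = (\<Sum>i<n. ?c i * (sqrt \<theta> * ip n ?z (($) (\<phi> n \<omega> i)) + (1 - sqrt \<theta>) * ?h * ?c i))"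
        by (intro sum.cong refl arg_cong2[where f = "(*)"] eig(2)[OF n w _ s, symmetric]) simp
      also have "\<dots> = sqrt \<theta> * (\<Sum>i<n. ?c i * ip n ?z (($) (\<phi> n \<omega> i))) + (1 - sqrt \<theta>) * ?h * (\<Sum>i<n. ?c i * ?c i)"
        unfolding sum_distrib_left sum.distrib[symmetric] by (intro sum.cong refl) (simp add: algebra_simps)
      also have "\<dots> = sqrt \<theta> * ?h + (1 - sqrt \<theta>) * ?h"
        unfolding pars[OF n w] v1[OF n w] by (simp add: h_def quad_def)
      finally show ?thesis by (simp add: algebra_simps)
    qed
    moreover have "0 < \<theta> + s * (1 - \<theta>) * ?h"
      by (rule spiked_transform_lipschitz(2)[OF theta(1) h_bounds[OF n w s] h_bounds[OF n w s] s])
    ultimately show ?thesis by (simp add: nonzero_eq_divide_eq)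
  qed
  have X_meas: "(\<lambda>\<omega>. X n \<omega> $$ ij) \<in> borel_measurable M" if "n \<ge> 1" "ij \<in> {..<n} \<times> {..<m n}" for n ij
    by (rule rv_sigma_measurable[OF M.indep_set_events(1)[OF v_indep[OF that(1)]] that(2)])
  have v_meas: "(\<lambda>\<omega>. v n \<omega> $ i) \<in> borel_measurable M" if "n \<ge> 1" "i < n" for n i
    using that by (intro rv_sigma_measurable[OF M.indep_set_events(2)[OF v_indep[OF that(1)]]]) auto
  \<comment> \<open>Only the entries of \<open>X\<close> and \<open>v\<close> enter
    \<open>h\<close>; this is the source of measurability for the integrals against the spectral
    measure.\<close>
  have h_meas: "h s n \<in> borel_measurable M" if "n \<ge> 1" for s n
    unfolding h_def by (intro measurable_quad measurable_cov_resolvent) (auto simp: entries_def intro!: X_meas v_meas that)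
  have stieltjes: "tends_prob M (\<lambda>n \<omega>. \<integral>x. 1 / (max 0 x + s) \<partial>spectral_measure n (lam n \<omega>) (\<phi> n \<omega>) (v n \<omega>))
      (\<integral>x. 1 / (max 0 x + s) \<partial>mp_spiked \<alpha> \<theta>)" if s: "s \<ge> 1" for s
  proof -
    have s0: "s > 0" using s by simp
    obtain g where g: "g > 0" "s * g + \<alpha> * g / (1 + g) = 1"
      by (rule companion_fixed_point_exists[OF alpha(1) s])
    have sg: "s * g \<le> 1"
    proof -
      have "0 \<le> \<alpha> * g / (1 + g)" using alpha(1) g(1) by simp
      then show ?thesis using g(2) by linarith
    qed
    define G where "G n \<omega> = h s n \<omega> / (\<theta> + s * (1 - \<theta>) * h s n \<omega>)" for n \<omega>
    define c where "c = g / (\<theta> + s * (1 - \<theta>) * g)"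
    define L where "L = \<theta> / (min \<theta> 1)\<^sup>2"
    have L0: "0 \<le> L" using theta(1) by (simp add: L_def)
    have lip: "\<bar>G n \<omega> - c\<bar> \<le> L * \<bar>h s n \<omega> - g\<bar>" if "n \<ge> 1" "\<omega> \<in> space M" for n \<omega>
      unfolding G_def c_def L_def
      by (rule spiked_transform_lipschitz(1)[OF theta(1) h_bounds[OF that s0] g(1) sg s0])
    have G_meas: "G n \<in> borel_measurable M" if "n \<ge> 1" for n
      using h_meas[OF that, of s] unfolding G_def[abs_def] by measurable
    have "tends_prob M G c"
      unfolding tends_prob_def
    proof (intro conjI allI impI G_meas)
      fix \<epsilon> :: real assume e: "\<epsilon> > 0"
      let ?dev = "\<lambda>n. deviation s \<alpha> n (m n)"
      \<comment> \<open>As \<alpha> > 0, the matrices eventually have at least one column, which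
        \<open>quad_L1_random\<close> requires.\<close>
      have "eventually (\<lambda>n. real (m n) / real n > 0) sequentially"
        using order_tendstoD(1)[OF alpha(2) alpha(1)] .
      then have ev: "eventually (\<lambda>n. n \<ge> 1 \<and> m n \<ge> 1) sequentially"
        by eventually_elim (auto simp: zero_less_divide_iff Suc_le_eq)
      have lim: "(\<lambda>n. L / \<epsilon> * ?dev n) \<longlonglongrightarrow> 0"
        using tendsto_mult_right[OF deviation_tendsto[OF alpha(2), of s], of "L / \<epsilon>"] by (simp add: mult.commute)
      show "(\<lambda>n. measure M {\<omega> \<in> space M. \<bar>G n \<omega> - c\<bar> > \<epsilon>}) \<longlonglongrightarrow> 0"
      proof (rule tendsto_sandwich[OF _ _ tendsto_const lim])
        show "\<forall>\<^sub>F n in sequentially. measure M {\<omega> \<in> space M. \<bar>G n \<omega> - c\<bar> > \<epsilon>} \<le> L / \<epsilon> * ?dev n"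
          using ev
        proof eventually_elim
          case (elim n)
          then have n: "n \<ge> 1" "m n \<ge> 1" by auto
          have [measurable]: "h s n \<in> borel_measurable M" "G n \<in> borel_measurable M"
            by (rule h_meas[OF n(1)], rule G_meas[OF n(1)])
          have "(\<integral>\<^sup>+\<omega>. ennreal \<bar>h s n \<omega> - g\<bar> \<partial>M) \<le> ennreal (?dev n)"
            unfolding h_def
          proof (rule quad_L1_random[OF M n])
            show "M.indep_vars (\<lambda>_. borel) (\<lambda>ij \<omega>. entries (X n \<omega>) ij) ({..<n} \<times> {..<m n})"
              using X_indep[OF n(1)] by (simp add: entries_def)
            show "distr M borel (\<lambda>\<omega>. entries (X n \<omega>) ij) = ?D" if "ij \<in> {..<n} \<times> {..<m n}" for ij
              using that X_distr[OF n(1), of "fst ij" "snd ij"] by (auto simp: entries_def)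
            show "M.indep_set (rv_sigma M ({..<n} \<times> {..<m n}) (\<lambda>ij \<omega>. entries (X n \<omega>) ij)) (rv_sigma M {..<n} (\<lambda>i \<omega>. v n \<omega> $ i))"
              using v_indep[OF n(1)] by (simp add: entries_def)
          qed (use v1[OF n(1)] s alpha(1) g in auto)
          moreover have "0 \<le> ?dev n"
            using alpha(1) s m4_ge by (auto simp: deviation_def Let_def rate_def intro!: add_nonneg_nonneg mult_nonneg_nonneg divide_nonneg_nonneg)
          ultimately have dv: "(\<integral>\<^sup>+\<omega>. ennreal \<bar>h s n \<omega> - g\<bar> \<partial>M) \<le> ennreal (?dev n)" "0 \<le> ?dev n" by auto
          \<comment> \<open>Markov's inequality with threshold 1: by the Lipschitz bound the event
            lies in the set where \<open>L / \<epsilon> * |h - g|\<close> is at least 1.\<close>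
          have "emeasure M {\<omega> \<in> space M. \<bar>G n \<omega> - c\<bar> > \<epsilon>} \<le> emeasure M {\<omega> \<in> space M. 1 \<le> ennreal (L / \<epsilon>) * ennreal \<bar>h s n \<omega> - g\<bar>}"
          proof (rule emeasure_mono)
            show "{\<omega> \<in> space M. \<bar>G n \<omega> - c\<bar> > \<epsilon>} \<subseteq> {\<omega> \<in> space M. 1 \<le> ennreal (L / \<epsilon>) * ennreal \<bar>h s n \<omega> - g\<bar>}"
            proof safe
              fix \<omega> assume w: "\<omega> \<in> space M" "\<bar>G n \<omega> - c\<bar> > \<epsilon>"
              then have "\<epsilon> < L * \<bar>h s n \<omega> - g\<bar>" using lip[OF n(1) w(1)] by linarith
              then have "1 \<le> L / \<epsilon> * \<bar>h s n \<omega> - g\<bar>" using e by (simp add: le_divide_eq)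
              then have "ennreal 1 \<le> ennreal (L / \<epsilon> * \<bar>h s n \<omega> - g\<bar>)" by (rule ennreal_leI)
              then show "1 \<le> ennreal (L / \<epsilon>) * ennreal \<bar>h s n \<omega> - g\<bar>"
                using L0 e by (subst ennreal_mult[symmetric]) (auto simp del: times_divide_eq_left)
            qed
          qed measurable
          also have "\<dots> \<le> ennreal (L / \<epsilon>) * (\<integral>\<^sup>+\<omega>. ennreal \<bar>h s n \<omega> - g\<bar> * indicator (space M) \<omega> \<partial>M)"
            by (rule nn_integral_Markov_inequality) auto
          also have "(\<integral>\<^sup>+\<omega>. ennreal \<bar>h s n \<omega> - g\<bar> * indicator (space M) \<omega> \<partial>M) = (\<integral>\<^sup>+\<omega>. ennreal \<bar>h s n \<omega> - g\<bar> \<partial>M)"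
            by (intro nn_integral_cong) simp
          also have "ennreal (L / \<epsilon>) * \<dots> \<le> ennreal (L / \<epsilon>) * ennreal (?dev n)" by (intro mult_left_mono dv) auto
          also have "\<dots> = ennreal (L / \<epsilon> * ?dev n)" using L0 e dv(2) by (intro ennreal_mult[symmetric]) auto
          finally have "ennreal (measure M {\<omega> \<in> space M. \<bar>G n \<omega> - c\<bar> > \<epsilon>}) \<le> ennreal (L / \<epsilon> * ?dev n)"
            by (simp add: M.emeasure_eq_measure)
          then show ?case using L0 e dv(2) by (subst (asm) ennreal_le_iff) auto
        qed
      qed (simp add: measure_nonneg)
    qed
    moreover have "c = (\<integral>x. 1 / (max 0 x + s) \<partial>mp_spiked \<alpha> \<theta>)"
      unfolding c_def by (rule mp_spiked_stieltjes[OF alpha(1) theta s g, symmetric])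
    ultimately have "tends_prob M G (\<integral>x. 1 / (max 0 x + s) \<partial>mp_spiked \<alpha> \<theta>)" by simp
    then show ?thesis by (rule tends_prob_cong) (simp add: G_def transform s0)
  qed
  interpret H: random_half_line_measures M "\<lambda>n \<omega>. spectral_measure n (lam n \<omega>) (\<phi> n \<omega>) (v n \<omega>)" "mp_spiked \<alpha> \<theta>" 1
  proof (intro random_half_line_measures.intro random_half_line_measures_axioms.intro)
    fix n \<omega> assume n: "(n :: nat) \<ge> 1" and w: "\<omega> \<in> space M"
    let ?\<mu> = "spectral_measure n (lam n \<omega>) (\<phi> n \<omega>) (v n \<omega>)"
    have sets: "sets ?\<mu> = sets borel" by (simp add: spectral_measure_def)
    have sp: "space ?\<mu> = UNIV" using sets_eq_imp_space_eq[OF sets] by simp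
    have "emeasure ?\<mu> UNIV = ennreal (\<Sum>i<n. (ip n (($) (v n \<omega>)) (($) (\<phi> n \<omega> i)))\<^sup>2)"
      by (subst emeasure_spectral_measure) (auto simp: weights[OF n w] intro!: sum.cong)
    also have "(\<Sum>i<n. (ip n (($) (v n \<omega>)) (($) (\<phi> n \<omega> i)))\<^sup>2) = 1"
      using pars[OF n w, of "($) (v n \<omega>)" "($) (v n \<omega>)"] v1[OF n w] by (simp add: power2_eq_square)
    finally have "prob_space ?\<mu>" by (intro prob_spaceI) (simp add: sp)
    moreover have "AE x in ?\<mu>. 0 \<le> x"
    proof (rule AE_I[where N = "{..<0}"])
      show "emeasure ?\<mu> {..<0} = 0"
        using eig(1)[OF n w, of _ 1] by (subst emeasure_spectral_measure) (auto simp: indicator_def intro!: sum.neutral simp flip: not_le)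
    qed (auto simp: sets not_le)
    ultimately show "prob_space ?\<mu> \<and> sets ?\<mu> = sets borel \<and> (AE x in ?\<mu>. 0 \<le> x)" using sets by simp
  next
    show "AE x in mp_spiked \<alpha> \<theta>. 0 \<le> x"
      by (rule mp_spiked_nonneg[OF alpha(1) theta])
  qed (use mp_spiked_prob[OF alpha(1) theta] sets_mp_spiked stieltjes M in auto)
  show ?thesis by (rule H.weak_conv)
qed

end
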